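(* Let $m\in\mathbb N_0$ and let $(s_j)_{j=0}^{m}\in\mathcal K^{\ge}_{m}$. Let $\langle (s_j)_{j=0}^{m}\rangle$ denote the set of all $(t_j)_{j=0}^{m}\in\mathcal K^{\ge}_{m}$ with $(t_j)_{j=0}^{m}\sim(s_j)_{j=0}^{m}$. Then $\langle (s_j)_{j=0}^{m}\rangle\cap\mathcal K^{\ge,e}_{m}=\{(\tilde s_j)_{j=0}^{m}\}$, where $\tilde s_j:=s_j$ for all $j\in\{0,\dots,m-1\}$ and $\tilde s_m:=\Gamma_m$.
   Context: $q$ is a positive integer and $\alpha$ is a fixed real number. For complex $q\times q$ matrices, $A\le B$ means that $A,B$ are Hermitian and $B-A$ is non-negative Hermitian (positive semidefinite). $M^\dagger$ is the Moore–Penrose inverse and $\mathcal R(M)$ the column space of a matrix $M$. For a non-negative Hermitian $q\times q$ matrix $A$ and a linear subspace $\mathcal V$ of $\mathbb C^q$, let $P_{A,\mathcal V}$ be the matrix of the orthogonal projection of $\mathbb C^q$ onto $\{x\in\mathbb C^q:\sqrt A\,x\in\mathcal V\}$ ($\sqrt A$ the non-negative Hermitian square root), and $\mathcal S(A,\mathcal V):=\sqrt A\,P_{A,\mathcal V}\sqrt A$. For a sequence $(s_j)$ of complex $q\times q$ matrices put $H_n:=(s_{j+k})_{j,k=0}^n$, $\Theta_0:=0_{q\times q}$ and, for $n\ge1$, $\Theta_n:=z\,H_{n-1}^\dagger\,y$, where $y$ is the block column with blocks $s_n,\dots,s_{2n-1}$ and $z$ is the block row $[s_n,\dots,s_{2n-1}]$.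 Put $s_{\alpha,j}:=-\alpha s_j+s_{j+1}$; $H_{\alpha,n}$ and $\Theta_{\alpha,n}$ denote the matrices built in the same way from the sequence $(s_{\alpha,j})$ (so $\Theta_{\alpha,0}=0_{q\times q}$). $\mathcal K^{\ge}_{0}$ is the set of one-term sequences $(s_0)$ with $s_0$ non-negative Hermitian. For $n\ge1$, $\mathcal K^{\ge}_{2n}$ is the set of all sequences $(s_j)_{j=0}^{2n}$ of complex $q\times q$ matrices with $H_n$ and $H_{\alpha,n-1}$ both non-negative Hermitian; for $n\ge0$, $\mathcal K^{\ge}_{2n+1}$ is the set of all sequences $(s_j)_{j=0}^{2n+1}$ with $H_n$ and $H_{\alpha,n}$ both non-negative Hermitian. $\mathcal K^{\ge,e}_{m}$ is the set of all sequences $(s_j)_{j=0}^m$ of complex $q\times q$ matrices for which there is a complex $q\times q$ matrix $s_{m+1}$ with $(s_j)_{j=0}^{m+1}\in\mathcal K^{\ge}_{m+1}$. Put $Q_{2k}:=s_{2k}-\Theta_k$ and $Q_{2k+1}:=s_{\alpha,2k}-\Theta_{\alpha,k}$; put $\mathfrak a_{2k-1}:=\Theta_k$ and $\mathfrak a_{2k}:=\alpha s_{2k}+\Theta_{\alpha,k}$ ($k\in\mathbb N_0$). If $(s_j)_{j=0}^m\in\mathcal K^{\ge}_{m}$, then $Q_0,\dots,Q_m$ are non-negative Hermitian, so one may define $\Gamma_0:=s_0$ and $\Gamma_m:=\mathfrak a_{m-1}+\mathcal S(Q_m,\mathcal R(Q_{m-1}))$ for $m\ge1$. A non-negative Hermitian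 $q\times q$ measure on $[\alpha,\infty)$ is a $\sigma$-additive map from the Borel subsets of $[\alpha,\infty)$ to the non-negative Hermitian $q\times q$ matrices. Let $\mathcal M_\le[(s_j)_{j=0}^{m}]$ be the set of all such measures $\sigma$ for which the moment $\int_{[\alpha,\infty)}x^{m}\sigma(dx)$ exists (then all moments of lower order exist as well), $s_m-\int_{[\alpha,\infty)}x^{m}\sigma(dx)$ is non-negative Hermitian, and $\int_{[\alpha,\infty)}x^j\sigma(dx)=s_j$ for all $j\in\{0,\dots,m-1\}$. For two sequences in $\mathcal K^{\ge}_{m}$, write $(s_j)_{j=0}^{m}\sim(t_j)_{j=0}^{m}$ if $\mathcal M_\le[(s_j)_{j=0}^{m}]=\mathcal M_\le[(t_j)_{j=0}^{m}]$; this is an equivalence relation on $\mathcal K^{\ge}_{m}$. *)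

theory Defs
  imports
    "HOL-Analysis.Analysis"
    "Jordan_Normal_Form.VS_Connect"
    "Jordan_Normal_Form.Schur_Decomposition"
begin

text \<open>
  Matrices are Jordan_Normal_Form matrices, because the block Hankel matrices below have a size
  that varies inside the statement. The inner product is \<open>v \<bullet>c w\<close>, linear in \<open>v\<close>.
\<close>


section \<open>Matrices\<close>

text \<open>The order on the complex numbers is that of Complex_Order, so \<open>0 \<le> z\<close> includes that
  \<open>z\<close> is real.\<close>

definition nonneg_hermitian :: "complex mat \<Rightarrow> bool" where
  "nonneg_hermitian A \<longleftrightarrow> square_mat A \<and> mat_adjoint A = A \<and>
     (\<forall>v\<in>carrier_vec (dim_row A). 0 \<le> (A *\<^sub>v v) \<bullet>c v)"

definition mat_sqrt :: "complex mat \<Rightarrow> complex mat" where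
  "mat_sqrt A = (THE B. B \<in> carrier_mat (dim_row A) (dim_row A) \<and> nonneg_hermitian B \<and> B * B = A)"

definition moore_penrose :: "complex mat \<Rightarrow> complex mat" where
  "moore_penrose A = (THE X. X \<in> carrier_mat (dim_col A) (dim_row A) \<and>
     A * X * A = A \<and> X * A * X = X \<and>
     mat_adjoint (A * X) = A * X \<and> mat_adjoint (X * A) = X * A)"

text \<open>\<open>orth_proj q W\<close> is meant for linear subspaces \<open>W\<close> of \<open>\<complex>\<^sup>q\<close>.\<close>

definition orth_proj :: "nat \<Rightarrow> complex vec set \<Rightarrow> complex mat" where
  "orth_proj q W = (THE P. P \<in> carrier_mat q q \<and>
     (\<forall>x\<in>carrier_vec q. P *\<^sub>v x \<in> W \<and> (\<forall>w\<in>W. (x - P *\<^sub>v x) \<bullet>c w = 0)))"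

text \<open>\<open>\<S>(A, V)\<close> for a non-negative Hermitian matrix \<open>A\<close> and a linear subspace \<open>V\<close>.\<close>

definition schur_short :: "complex mat \<Rightarrow> complex vec set \<Rightarrow> complex mat" where
  "schur_short A V =
     mat_sqrt A * orth_proj (dim_row A) {x \<in> carrier_vec (dim_row A). mat_sqrt A *\<^sub>v x \<in> V} * mat_sqrt A"


section \<open>Sequences of matrices\<close>

text \<open>
  A finite sequence \<open>(s\<^sub>j)\<^sub>j\<^sub>=\<^sub>0\<^sup>m\<close> is a function that is extensional outside \<open>{..m}\<close> (see
  \<open>stieltjes_seqs\<close>), so that equality of functions is equality of finite sequences. In a block
  matrix with \<open>q \<times> q\<close> blocks, the entry \<open>(i, j)\<close> is the entry \<open>(i mod q, j mod q)\<close> of the block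
  \<open>(i div q, j div q)\<close>.
\<close>

definition hankel :: "nat \<Rightarrow> (nat \<Rightarrow> complex mat) \<Rightarrow> nat \<Rightarrow> complex mat" where
  "hankel q s n = mat (Suc n * q) (Suc n * q)
     (\<lambda>(i, j). s (i div q + j div q) $$ (i mod q, j mod q))"

definition block_col :: "nat \<Rightarrow> (nat \<Rightarrow> complex mat) \<Rightarrow> nat \<Rightarrow> complex mat" where
  "block_col q s n = mat (n * q) q (\<lambda>(i, j). s (n + i div q) $$ (i mod q, j))"

definition block_row :: "nat \<Rightarrow> (nat \<Rightarrow> complex mat) \<Rightarrow> nat \<Rightarrow> complex mat" where
  "block_row q s n = mat q (n * q) (\<lambda>(i, j). s (n + j div q) $$ (i, j mod q))"

definition theta :: "nat \<Rightarrow> (nat \<Rightarrow> complex mat) \<Rightarrow> nat \<Rightarrow> complex mat" where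
  "theta q s n = (if n = 0 then 0\<^sub>m q q
     else block_row q s n * moore_penrose (hankel q s (n - 1)) * block_col q s n)"

definition shifted :: "real \<Rightarrow> (nat \<Rightarrow> complex mat) \<Rightarrow> nat \<Rightarrow> complex mat" where
  "shifted \<alpha> s j = complex_of_real (- \<alpha>) \<cdot>\<^sub>m s j + s (Suc j)"

text \<open>The sets \<open>\<K>\<^sup>\<ge>\<^sub>m\<close> and \<open>\<K>\<^sup>\<ge>\<^sup>,\<^sup>e\<^sub>m\<close>.\<close>

definition stieltjes_seqs :: "nat \<Rightarrow> real \<Rightarrow> nat \<Rightarrow> (nat \<Rightarrow> complex mat) set" where
  "stieltjes_seqs q \<alpha> m = {s \<in> {..m} \<rightarrow>\<^sub>E carrier_mat q q.
     nonneg_hermitian (hankel q s (m div 2)) \<and>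
     (if even m then m \<noteq> 0 \<longrightarrow> nonneg_hermitian (hankel q (shifted \<alpha> s) (m div 2 - 1))
      else nonneg_hermitian (hankel q (shifted \<alpha> s) (m div 2)))}"

definition stieltjes_ext_seqs :: "nat \<Rightarrow> real \<Rightarrow> nat \<Rightarrow> (nat \<Rightarrow> complex mat) set" where
  "stieltjes_ext_seqs q \<alpha> m = {s \<in> {..m} \<rightarrow>\<^sub>E carrier_mat q q.
     \<exists>x\<in>carrier_mat q q. s(Suc m := x) \<in> stieltjes_seqs q \<alpha> (Suc m)}"

text \<open>\<open>Q\<^sub>n\<close>, and \<open>\<aa>\<close> with its index, which starts at \<open>-1\<close>, shifted by one:
  \<open>lower_bd q \<alpha> s n\<close> is \<open>\<aa>\<^sub>n\<^sub>-\<^sub>1\<close>.\<close>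

definition Qmat :: "nat \<Rightarrow> real \<Rightarrow> (nat \<Rightarrow> complex mat) \<Rightarrow> nat \<Rightarrow> complex mat" where
  "Qmat q \<alpha> s n = (if even n then s n - theta q s (n div 2)
     else shifted \<alpha> s (n - 1) - theta q (shifted \<alpha> s) (n div 2))"

definition lower_bd :: "nat \<Rightarrow> real \<Rightarrow> (nat \<Rightarrow> complex mat) \<Rightarrow> nat \<Rightarrow> complex mat" where
  "lower_bd q \<alpha> s n = (if even n then theta q s (n div 2)
     else complex_of_real \<alpha> \<cdot>\<^sub>m s (n - 1) + theta q (shifted \<alpha> s) (n div 2))"

definition Gam :: "nat \<Rightarrow> real \<Rightarrow> (nat \<Rightarrow> complex mat) \<Rightarrow> nat \<Rightarrow> complex mat" where
  "Gam q \<alpha> s m = (if m = 0 then s 0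
     else lower_bd q \<alpha> s m +
       schur_short (Qmat q \<alpha> s m) (vec_space.col_space q (Qmat q \<alpha> s (m - 1))))"


section \<open>Integration with respect to complex measures\<close>

text \<open>
  A finite signed measure \<open>\<nu>\<close> is a real-valued function on the sets of \<open>M\<close>. Its positive variation
  is \<open>\<nu>\<^sup>+(B) = sup {\<nu>(C) | C \<subseteq> B}\<close>; that \<open>ennreal\<close> truncates negative values to \<open>0\<close> does not
  matter, because \<open>C = {}\<close> contributes \<open>0\<close>. The negative variation is the positive variation of \<open>-\<nu>\<close>. Integrals are taken
  along the Jordan decompositions of the real and the imaginary part.
\<close>

definition pos_variation :: "'a measure \<Rightarrow> ('a set \<Rightarrow> real) \<Rightarrow> 'a measure" where
  "pos_variation M \<nu> = measure_of (space M) (sets M)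
     (\<lambda>B. SUP C\<in>{C \<in> sets M. C \<subseteq> B}. ennreal (\<nu> C))"

definition signed_integrable :: "'a measure \<Rightarrow> ('a set \<Rightarrow> real) \<Rightarrow> ('a \<Rightarrow> real) \<Rightarrow> bool" where
  "signed_integrable M \<nu> f \<longleftrightarrow>
     integrable (pos_variation M \<nu>) f \<and> integrable (pos_variation M (\<lambda>B. - \<nu> B)) f"

definition signed_integral :: "'a measure \<Rightarrow> ('a set \<Rightarrow> real) \<Rightarrow> ('a \<Rightarrow> real) \<Rightarrow> real" where
  "signed_integral M \<nu> f =
     (\<integral>x. f x \<partial>pos_variation M \<nu>) - (\<integral>x. f x \<partial>pos_variation M (\<lambda>B. - \<nu> B))"

definition cmeasure_integrable :: "'a measure \<Rightarrow> ('a set \<Rightarrow> complex) \<Rightarrow> ('a \<Rightarrow> real) \<Rightarrow> bool" where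
  "cmeasure_integrable M \<nu> f \<longleftrightarrow>
     signed_integrable M (\<lambda>B. Re (\<nu> B)) f \<and> signed_integrable M (\<lambda>B. Im (\<nu> B)) f"

definition cmeasure_integral :: "'a measure \<Rightarrow> ('a set \<Rightarrow> complex) \<Rightarrow> ('a \<Rightarrow> real) \<Rightarrow> complex" where
  "cmeasure_integral M \<nu> f =
     Complex (signed_integral M (\<lambda>B. Re (\<nu> B)) f) (signed_integral M (\<lambda>B. Im (\<nu> B)) f)"


section \<open>Non-negative Hermitian measures and the truncated moment problem\<close>

abbreviation half_line :: "real \<Rightarrow> real measure" where
  "half_line \<alpha> \<equiv> restrict_space borel {\<alpha>..}"

definition nonneg_hermitian_measures :: "nat \<Rightarrow> real \<Rightarrow> (real set \<Rightarrow> complex mat) set" where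
  "nonneg_hermitian_measures q \<alpha> =
     {\<sigma> \<in> sets (half_line \<alpha>) \<rightarrow>\<^sub>E {A \<in> carrier_mat q q. nonneg_hermitian A}.
        \<forall>F :: nat \<Rightarrow> real set. range F \<subseteq> sets (half_line \<alpha>) \<longrightarrow> disjoint_family F \<longrightarrow>
          (\<forall>i<q. \<forall>j<q. (\<lambda>n. \<sigma> (F n) $$ (i, j)) sums (\<sigma> (\<Union>n. F n) $$ (i, j)))}"

definition moment_exists :: "nat \<Rightarrow> real \<Rightarrow> (real set \<Rightarrow> complex mat) \<Rightarrow> nat \<Rightarrow> bool" where
  "moment_exists q \<alpha> \<sigma> k \<longleftrightarrow>
     (\<forall>i<q. \<forall>j<q. cmeasure_integrable (half_line \<alpha>) (\<lambda>B. \<sigma> B $$ (i, j)) (\<lambda>x. x ^ k))"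

definition moment :: "nat \<Rightarrow> real \<Rightarrow> (real set \<Rightarrow> complex mat) \<Rightarrow> nat \<Rightarrow> complex mat" where
  "moment q \<alpha> \<sigma> k =
     mat q q (\<lambda>(i, j). cmeasure_integral (half_line \<alpha>) (\<lambda>B. \<sigma> B $$ (i, j)) (\<lambda>x. x ^ k))"

text \<open>\<open>\<M>\<^sub>\<le>[(s\<^sub>j)\<^sub>j\<^sub>=\<^sub>0\<^sup>m]\<close>, the induced equivalence of sequences, and \<open>\<langle>(s\<^sub>j)\<^sub>j\<^sub>=\<^sub>0\<^sup>m\<rangle>\<close>.\<close>

definition moment_solutions ::
  "nat \<Rightarrow> real \<Rightarrow> nat \<Rightarrow> (nat \<Rightarrow> complex mat) \<Rightarrow> (real set \<Rightarrow> complex mat) set" where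
  "moment_solutions q \<alpha> m s = {\<sigma> \<in> nonneg_hermitian_measures q \<alpha>.
     moment_exists q \<alpha> \<sigma> m \<and> nonneg_hermitian (s m - moment q \<alpha> \<sigma> m) \<and>
     (\<forall>j<m. moment q \<alpha> \<sigma> j = s j)}"

definition moment_equiv ::
  "nat \<Rightarrow> real \<Rightarrow> nat \<Rightarrow> (nat \<Rightarrow> complex mat) \<Rightarrow> (nat \<Rightarrow> complex mat) \<Rightarrow> bool" where
  "moment_equiv q \<alpha> m s t \<longleftrightarrow> moment_solutions q \<alpha> m s = moment_solutions q \<alpha> m t"

definition moment_class ::
  "nat \<Rightarrow> real \<Rightarrow> nat \<Rightarrow> (nat \<Rightarrow> complex mat) \<Rightarrow> (nat \<Rightarrow> complex mat) set" where
  "moment_class q \<alpha> m s = {t \<in> stieltjes_seqs q \<alpha> m. moment_equiv q \<alpha> m t s}"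

end

theory Submission
  imports Defs
begin

text \<open>
  A sequence in \<open>\<K>\<^sup>\<ge>\<^sup>,\<^sup>e\<^sub>m\<close> has an exact solution: after choosing the next matrix so that the new Schur
  complement vanishes, compressing multiplication by the variable to the quotient by the kernel of
  the block Hankel matrix gives a Hermitian matrix \<open>T \<ge> \<alpha>\<close>, and its spectral decomposition is a
  finitely atomic solution. Testing this solution against a second extendable sequence with the same
  solution set, and conversely, shows that the two agree; this is uniqueness.

  For existence, the moments \<open>t\<close> of any solution satisfy \<open>\<R>(Q\<^sub>m(t)) \<subseteq> \<R>(Q\<^sub>m\<^sub>-\<^sub>1(t))\<close>, because a vector
  polynomial that is null for \<open>\<sigma>\<close> (or for \<open>(x - \<alpha>) \<sigma>\<close>) stays null after multiplication by
  \<open>x - \<alpha>\<close>. Since \<open>Q\<^sub>m(t) \<le> Q\<^sub>m(s)\<close> and \<open>\<S>(Q\<^sub>m(s), \<R>(Q\<^sub>m\<^sub>-\<^sub>1))\<close> is the largest such matrix, \<open>t\<^sub>m \<le> \<Gamma>\<^sub>m\<close>.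
  The same range inclusion makes the modified sequence extendable.
\<close>

section \<open>Adjoints and the spectral theorem\<close>

text \<open>Range inclusions between Hermitian matrices are used in dual form: Q_{m-1} v = 0 forces
  Q_m v = 0. Kernels are the convenient side, because a kernel vector of a Schur complement is the
  leading coefficient of a null vector of the whole block matrix, and null vectors can be multiplied
  by X - \<alpha> like polynomials. Consecutive levels belong to different Hankel matrices, one of
  the sequence and one of its shift, so every such transfer has two parity cases. Non-negativity
  alone does not give an exact solution: for q = 1 and \<alpha> = 0 the sequence (0, 1) satisfies
  both conditions, but a measure of total mass 0 has no first moment 1. Such a loss concerns only
  the last moment. Hence the sequences of one class differ only in the last matrix, and the
  extendable one carries the largest last moment that a solution attains. Integrals are defined
  entrywise along Jordan decompositions, which do not see quadratic forms. Densities with respect to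
  one scalar measure restore them: the form of a moment matrix becomes the integral of a
  non-negative function.\<close>

lemma mat_assoc:
  fixes A :: "'a :: comm_ring_1 mat"
  shows "dim_col A = dim_row B \<Longrightarrow> dim_col B = dim_row C \<Longrightarrow> A * B * C = A * (B * C)"
  by (rule assoc_mult_mat) auto

lemma mat_vec_assoc:
  fixes A :: "'a :: comm_ring_1 mat"
  shows "dim_col A = dim_row B \<Longrightarrow> dim_col B = dim_vec v \<Longrightarrow> A * B *\<^sub>v v = A *\<^sub>v (B *\<^sub>v v)"
  by (rule assoc_mult_mat_vec) auto

lemma mat_mult_add_right:
  fixes A :: "'a :: comm_ring_1 mat"
  shows "dim_col A = dim_row B \<Longrightarrow> dim_row C = dim_row B \<Longrightarrow> dim_col C = dim_col B \<Longrightarrow>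
    A * (B + C) = A * B + A * C"
  by (rule mult_add_distrib_mat) auto

lemma mat_mult_add_left:
  fixes A :: "'a :: comm_ring_1 mat"
  shows "dim_row B = dim_row A \<Longrightarrow> dim_col B = dim_col A \<Longrightarrow> dim_col A = dim_row C \<Longrightarrow>
    (A + B) * C = A * C + B * C"
  by (rule add_mult_distrib_mat) auto

lemma mat_mult_minus_right:
  fixes A :: "'a :: comm_ring_1 mat"
  shows "dim_col A = dim_row B \<Longrightarrow> dim_row C = dim_row B \<Longrightarrow> dim_col C = dim_col B \<Longrightarrow>
    A * (B - C) = A * B - A * C"
  by (rule mult_minus_distrib_mat) auto

lemma mat_mult_minus_left:
  fixes A :: "'a :: comm_ring_1 mat"
  shows "dim_row B = dim_row A \<Longrightarrow> dim_col B = dim_col A \<Longrightarrow> dim_col A = dim_row C \<Longrightarrow>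
    (A - B) * C = A * C - B * C"
  by (rule minus_mult_distrib_mat) auto

lemma mat_one_mult:
  fixes A :: "'a :: comm_ring_1 mat"
  shows "dim_row A = n \<Longrightarrow> 1\<^sub>m n * A = A" "dim_col A = n \<Longrightarrow> A * 1\<^sub>m n = A"
  by auto

lemma mat_smult_mult:
  fixes A :: "'a :: comm_ring_1 mat"
  shows "dim_col A = dim_row B \<Longrightarrow> (c \<cdot>\<^sub>m A) * B = c \<cdot>\<^sub>m (A * B)"
    "dim_col A = dim_row B \<Longrightarrow> A * (c \<cdot>\<^sub>m B) = c \<cdot>\<^sub>m (A * B)"
  by (auto intro: mult_smult_assoc_mat mult_smult_distrib)

lemma mat_mult_zero:
  fixes A :: "'a :: comm_ring_1 mat"
  shows "dim_row A = n \<Longrightarrow> 0\<^sub>m k n * A = 0\<^sub>m k (dim_col A)"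
    "dim_col A = n \<Longrightarrow> A * 0\<^sub>m n k = 0\<^sub>m (dim_row A) k"
  by auto

lemma mat_minus_self:
  fixes A :: "'a :: comm_ring_1 mat"
  shows "A - A = 0\<^sub>m (dim_row A) (dim_col A)"
  by auto

text \<open>The premises are equations between dimensions instead of carrier memberships, so simp
  discharges them from the dimension rules. Products are normalised to right-nested form, which
  fixes the shape of later cancellation rules.\<close>

lemmas mat_ring = mat_assoc mat_mult_add_right mat_mult_add_left mat_mult_minus_right
  mat_mult_minus_left mat_one_mult mat_smult_mult mat_mult_zero

section \<open>Adjoints and the complex inner product\<close>

lemma dim_mat_adjoint [simp]:
  "dim_row (mat_adjoint A) = dim_col A" "dim_col (mat_adjoint A) = dim_row A"
  unfolding mat_adjoint_def by auto

lemma index_mat_adjoint [simp]: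
  "i < dim_col A \<Longrightarrow> j < dim_row A \<Longrightarrow> mat_adjoint A $$ (i, j) = conjugate (A $$ (j, i))"
  unfolding mat_adjoint_def by (auto simp: mat_of_rows_index)

lemma mat_adjoint_carrier [simp]: "A \<in> carrier_mat m n \<Longrightarrow> mat_adjoint A \<in> carrier_mat n m"
  by auto

lemma mat_adjoint_adjoint [simp]: "mat_adjoint (mat_adjoint A) = A"
  by (rule eq_matI) auto

lemma mat_adjoint_one [simp]: "mat_adjoint (1\<^sub>m n :: complex mat) = 1\<^sub>m n"
  by (rule eq_matI) auto

lemma mat_adjoint_zero [simp]: "mat_adjoint (0\<^sub>m m n :: complex mat) = 0\<^sub>m n m"
  by (rule eq_matI) auto

lemma mat_adjoint_mult:
  fixes A B :: "complex mat"
  assumes "dim_col A = dim_row B"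
  shows "mat_adjoint (A * B) = mat_adjoint B * mat_adjoint A"
  using assms by (intro eq_matI) (auto simp: scalar_prod_def mult.commute intro!: sum.cong)

lemma mat_adjoint_add:
  fixes A B :: "complex mat"
  assumes "dim_row A = dim_row B" "dim_col A = dim_col B"
  shows "mat_adjoint (A + B) = mat_adjoint A + mat_adjoint B"
  using assms by (intro eq_matI) auto

lemma mat_adjoint_minus:
  fixes A B :: "complex mat"
  assumes "dim_row A = dim_row B" "dim_col A = dim_col B"
  shows "mat_adjoint (A - B) = mat_adjoint A - mat_adjoint B"
  using assms by (intro eq_matI) auto

lemma mat_adjoint_smult:
  "mat_adjoint (c \<cdot>\<^sub>m A) = cnj c \<cdot>\<^sub>m mat_adjoint A"
  by (intro eq_matI) auto

lemmas mat_adj = mat_adjoint_mult mat_adjoint_add mat_adjoint_minus mat_adjoint_smult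

lemma cscalar_prod_sum: "dim_vec y = n \<Longrightarrow> x \<bullet>c y = (\<Sum>i<n. x $ i * cnj (y $ i))"
  by (auto simp: scalar_prod_def atLeast0LessThan intro!: sum.cong)

lemma mult_mat_vec_index: "i < dim_row A \<Longrightarrow> dim_vec v = dim_col A \<Longrightarrow> 
  (A *\<^sub>v v) $ i = (\<Sum>j<dim_col A. A $$ (i,j) * v $ j)"
  by (auto simp: scalar_prod_def atLeast0LessThan intro!: sum.cong)

lemma mat_adjoint_cscalar:
  fixes A :: "complex mat"
  assumes "dim_vec v = dim_col A" "dim_vec w = dim_row A"
  shows "(A *\<^sub>v v) \<bullet>c w = v \<bullet>c (mat_adjoint A *\<^sub>v w)"
proof -
  have "(A *\<^sub>v v) \<bullet>c w = (\<Sum>i<dim_row A. \<Sum>j<dim_col A. A $$ (i,j) * v $ j * cnj (w $ i))"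
    using assms by (simp add: cscalar_prod_sum mult_mat_vec_index sum_distrib_right del: index_mult_mat_vec)
  also have "\<dots> = (\<Sum>j<dim_col A. \<Sum>i<dim_row A. A $$ (i,j) * v $ j * cnj (w $ i))"
    by (rule sum.swap)
  also have "\<dots> = v \<bullet>c (mat_adjoint A *\<^sub>v w)"
    using assms by (simp add: cscalar_prod_sum mult_mat_vec_index sum_distrib_left mult_ac del: index_mult_mat_vec)
  finally show ?thesis .
qed

lemma add_mat_vec: 
  fixes A B :: "complex mat"
  assumes "dim_row A = dim_row B" "dim_col A = dim_col B" "dim_vec v = dim_col B"
  shows "(A + B) *\<^sub>v v = A *\<^sub>v v + B *\<^sub>v v"
  using assms by (intro eq_vecI) (auto simp: scalar_prod_def distrib_right sum.distrib)
lemma minus_mat_vec: 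
  fixes A B :: "complex mat"
  assumes "dim_row A = dim_row B" "dim_col A = dim_col B" "dim_vec v = dim_col B"
  shows "(A - B) *\<^sub>v v = A *\<^sub>v v - B *\<^sub>v v"
  using assms by (intro eq_vecI) (auto simp: scalar_prod_def left_diff_distrib sum_subtractf)
lemma uminus_mat_vec: "dim_vec v = dim_col A \<Longrightarrow> (- A :: complex mat) *\<^sub>v v = - (A *\<^sub>v v)"
  by (intro eq_vecI) (auto simp: scalar_prod_def sum_negf)

lemma cscalar_add_left:
  assumes "dim_vec x = dim_vec z" "dim_vec y = dim_vec z"
  shows "(x + y) \<bullet>c (z :: complex vec) = x \<bullet>c z + y \<bullet>c z"
  using assms by (simp add: cscalar_prod_sum distrib_right sum.distrib)
lemma cscalar_minus_left:
  assumes "dim_vec x = dim_vec z" "dim_vec y = dim_vec z"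
  shows "(x - y) \<bullet>c (z :: complex vec) = x \<bullet>c z - y \<bullet>c z"
  using assms by (simp add: cscalar_prod_sum left_diff_distrib sum_subtractf)
lemma cscalar_uminus_left:
  assumes "dim_vec x = dim_vec z"
  shows "(- x) \<bullet>c (z :: complex vec) = - (x \<bullet>c z)"
  using assms by (simp add: cscalar_prod_sum sum_negf)

lemma cscalar_self: "v \<bullet>c v = complex_of_real (\<Sum>i<dim_vec v. (cmod (v $ i))\<^sup>2)"
  by (simp add: cscalar_prod_sum complex_norm_square del: of_real_power)

lemma cscalar_self_nonneg: "0 \<le> (v :: complex vec) \<bullet>c v"
  by (simp add: cscalar_self sum_nonneg less_eq_complex_def)

lemma cscalar_self_zero: "(v :: complex vec) \<bullet>c v = 0 \<Longrightarrow> v = 0\<^sub>v (dim_vec v)"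
  using conjugate_square_eq_0_vec[of v "dim_vec v"] by auto

lemma mat_eqI_vec:
  fixes A B :: "complex mat"
  assumes "dim_row A = dim_row B" "dim_col A = dim_col B"
    "\<And>v. dim_vec v = dim_col A \<Longrightarrow> A *\<^sub>v v = B *\<^sub>v v"
  shows "A = B"
proof (rule eq_matI, goal_cases)
  case (1 i j)
  have "col A j = A *\<^sub>v unit_vec (dim_col A) j" "col B j = B *\<^sub>v unit_vec (dim_col A) j"
    using 1 assms(1,2) by (auto intro!: eq_vecI)
  with assms(3)[of "unit_vec (dim_col A) j"] have "col A j = col B j" by simp
  with 1 assms(1,2) show ?case by (metis index_col)
qed (use assms in auto)

lemma zero_mat_mult_vec [simp]: "dim_vec v = n \<Longrightarrow> 0\<^sub>m m n *\<^sub>v v = (0\<^sub>v m :: complex vec)"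
  by (intro eq_vecI) (auto simp: scalar_prod_def)

lemma mat_zeroI:
  fixes A :: "complex mat"
  assumes "\<And>v. dim_vec v = dim_col A \<Longrightarrow> A *\<^sub>v v = 0\<^sub>v (dim_row A)"
  shows "A = 0\<^sub>m (dim_row A) (dim_col A)"
  using assms by (intro mat_eqI_vec) auto

text \<open>The form of M^* M at v is the squared length of M v.\<close>

lemma adjoint_mult_self_zero:
  fixes M :: "complex mat"
  assumes "mat_adjoint M * M = 0\<^sub>m (dim_col M) (dim_col M)"
  shows "M = 0\<^sub>m (dim_row M) (dim_col M)"
proof (rule mat_zeroI)
  fix v :: "complex vec" assume v: "dim_vec v = dim_col M"
  have "(M *\<^sub>v v) \<bullet>c (M *\<^sub>v v) = v \<bullet>c ((mat_adjoint M * M) *\<^sub>v v)"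
    using v by (simp add: mat_adjoint_cscalar mat_vec_assoc)
  also have "\<dots> = 0" unfolding assms using v by (simp add: scalar_prod_def)
  finally show "M *\<^sub>v v = 0\<^sub>v (dim_row M)" using cscalar_self_zero by fastforce
qed


lemma mat_adjoint_four_block:
  assumes "A \<in> carrier_mat m n" "B \<in> carrier_mat m n'" "C \<in> carrier_mat m' n" "D \<in> carrier_mat m' n'"
  shows "mat_adjoint (four_block_mat A B C D) =
    four_block_mat (mat_adjoint A) (mat_adjoint C) (mat_adjoint B) (mat_adjoint D)"
  using assms by (intro eq_matI) auto

section \<open>Diagonalisation by unitary matrices\<close>

text \<open>Eigenvalues are real by type, and as a function they can be changed pointwise to square
  roots, inverses and products.\<close>

definition real_diag :: "nat \<Rightarrow> (nat \<Rightarrow> real) \<Rightarrow> complex mat" where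
  "real_diag n d = mat n n (\<lambda>(i, j). if i = j then complex_of_real (d i) else 0)"

lemma dim_real_diag [simp]: "dim_row (real_diag n d) = n" "dim_col (real_diag n d) = n"
  by (auto simp: real_diag_def)

lemma mat_adjoint_real_diag [simp]: "mat_adjoint (real_diag n d) = real_diag n d"
  by (intro eq_matI) (auto simp: real_diag_def)

lemma index_mult_real_diag:
  "i < dim_row A \<Longrightarrow> j < n \<Longrightarrow> dim_col A = n \<Longrightarrow> (A * real_diag n d) $$ (i, j) = A $$ (i, j) * d j"
  "i < n \<Longrightarrow> j < dim_col A \<Longrightarrow> dim_row A = n \<Longrightarrow> (real_diag n d * A) $$ (i, j) = d i * A $$ (i, j)"
  by (auto simp: real_diag_def scalar_prod_def if_distrib[of "\<lambda>x. _ * x"] if_distrib[of "\<lambda>x. x * _"] cong: if_cong)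

lemma real_diag_mult: "real_diag n d * real_diag n e = real_diag n (\<lambda>i. d i * e i)"
  by (intro eq_matI) (auto simp: index_mult_real_diag simp del: index_mult_mat(1), auto simp: real_diag_def)

text \<open>Gram-Schmidt leaves the head of the list unchanged, so completing v to a basis,
  orthogonalising and normalising keeps the direction of v in the first column.\<close>

lemma unitary_extension:
  fixes v :: "complex vec"
  assumes v: "v \<in> carrier_vec n" "v \<noteq> 0\<^sub>v n"
  obtains W c where "W \<in> carrier_mat n n" "mat_adjoint W * W = 1\<^sub>m n" "col W 0 = c \<cdot>\<^sub>v v" "c \<noteq> 0"
proof -
  interpret cof_vec_space n "TYPE(complex)" .
  define b where "b = basis_completion v"
  define ws where "ws = gram_schmidt n b"
  have n: "n \<noteq> 0" using v by (auto intro!: eq_vecI)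
  from basis_completion[OF v, folded b_def]
  have dist_b: "distinct b" and indep: "\<not> lin_dep (set b)" and b: "set b \<subseteq> carrier_vec n"
    and hdb: "hd b = v" and len_b: "length b = n" by auto
  from hdb len_b n obtain vs where bv: "b = v # vs" by (cases b, auto)
  from gram_schmidt_result[OF b dist_b indep refl, folded ws_def]
  have ws: "set ws \<subseteq> carrier_vec n" "corthogonal ws" "length ws = n" by (auto simp: len_b)
  from gram_schmidt_hd[OF v(1), of vs, folded bv] have hdws: "hd ws = v" unfolding ws_def .
  have dimw: "dim_vec (ws ! j) = n" if "j < n" for j using ws that by (metis carrier_vecD nth_mem subset_iff)
  define r where "r j = sqrt (\<Sum>i<n. (cmod (ws ! j $ i))\<^sup>2)" for j
  have r2: "ws ! j \<bullet>c ws ! j = complex_of_real ((r j)\<^sup>2)" if "j < n" for j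
    using dimw[OF that] by (simp add: cscalar_self r_def sum_nonneg)
  have r0: "r j \<noteq> 0" if "j < n" for j
    using corthogonalD[OF ws(2), of j j] r2[OF that] that ws(3) by auto
  define W where "W = mat n n (\<lambda>(i, j). ws ! j $ i / r j)"
  have W: "W \<in> carrier_mat n n" by (simp add: W_def)
  have "mat_adjoint W * W = 1\<^sub>m n"
  proof (rule eq_matI, goal_cases)
    case (1 i j)
    hence ij: "i < n" "j < n" by auto
    have "(mat_adjoint W * W) $$ (i, j) = (\<Sum>k<n. cnj (ws ! i $ k / r i) * (ws ! j $ k / r j))"
      using ij W by (auto simp: scalar_prod_def W_def atLeast0LessThan intro!: sum.cong)
    also have "\<dots> = (ws ! j \<bullet>c ws ! i) / (r i * r j)"
      using ij dimw by (simp add: cscalar_prod_sum sum_divide_distrib mult_ac)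
    also have "\<dots> = 1\<^sub>m n $$ (i, j)"
    proof (cases "i = j")
      case True thus ?thesis using ij r2 r0 by (simp add: power2_eq_square)
    next
      case False
      hence "ws ! j \<bullet>c ws ! i = 0" using corthogonalD[OF ws(2)] ij ws(3) by auto
      thus ?thesis using ij False by simp
    qed
    finally show ?case .
  qed (use W in auto)
  moreover have "col W 0 = complex_of_real (1 / r 0) \<cdot>\<^sub>v v"
  proof (rule eq_vecI)
    fix i assume "i < dim_vec (complex_of_real (1 / r 0) \<cdot>\<^sub>v v)"
    moreover have "ws ! 0 = v" using hdws n ws(3) by (metis hd_conv_nth length_0_conv)
    ultimately show "col W 0 $ i = (complex_of_real (1 / r 0) \<cdot>\<^sub>v v) $ i"
      using n v by (simp add: W_def)
  qed (use v W in auto)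
  ultimately show ?thesis using that[OF W] r0[of 0] n by simp
qed

lemma mat_left_inverse_imp_right:
  fixes U :: "complex mat"
  assumes "U \<in> carrier_mat n n" "V \<in> carrier_mat n n" "V * U = 1\<^sub>m n"
  shows "U * V = 1\<^sub>m n"
  using mat_mult_left_right_inverse[OF assms(2,1,3)] .

lemma complex_eigenvector_exists:
  fixes A :: "complex mat"
  assumes "A \<in> carrier_mat n n" "n \<noteq> 0"
  obtains v e where "v \<in> carrier_vec n" "v \<noteq> 0\<^sub>v n" "A *\<^sub>v v = e \<cdot>\<^sub>v v"
proof -
  have "degree (char_poly A) = n" using degree_monic_char_poly[OF assms(1)] by simp
  hence "\<not> constant (poly (char_poly A))" using assms(2) by (simp add: constant_degree)
  then obtain e where "poly (char_poly A) e = 0" using fundamental_theorem_of_algebra by blast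
  hence "eigenvalue A e" using eigenvalue_root_char_poly[OF assms(1)] by simp
  thus ?thesis using that assms unfolding eigenvalue_def eigenvector_def by auto
qed

text \<open>Deflation: in a unitary basis that starts with an eigenvector, the first column is a
  multiple of the first unit vector. Hermitian symmetry then clears the first row too, which leaves
  a Hermitian block of size k for the induction.\<close>

theorem hermitian_spectral:
  fixes A :: "complex mat"
  assumes "A \<in> carrier_mat n n" "mat_adjoint A = A"
  shows "\<exists>U d. U \<in> carrier_mat n n \<and> mat_adjoint U * U = 1\<^sub>m n \<and> A = U * real_diag n d * mat_adjoint U"
  using assms
proof (induction n arbitrary: A)
  case 0
  thus ?case by (intro exI[of _ "1\<^sub>m 0"] exI[of _ "\<lambda>_. 0"]) auto
next
  case (Suc k)
  obtain v e where v: "v \<in> carrier_vec (Suc k)" "v \<noteq> 0\<^sub>v (Suc k)" "A *\<^sub>v v = e \<cdot>\<^sub>v v"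
    using complex_eigenvector_exists[OF Suc.prems(1)] by auto
  obtain W c where W: "W \<in> carrier_mat (Suc k) (Suc k)" "mat_adjoint W * W = 1\<^sub>m (Suc k)"
    "col W 0 = c \<cdot>\<^sub>v v" "c \<noteq> 0" using unitary_extension[OF v(1,2)] .
  note [simp] = carrier_matD[OF W(1)] carrier_matD[OF Suc.prems(1)]
  have WW: "W * mat_adjoint W = 1\<^sub>m (Suc k)"
    using mat_left_inverse_imp_right[OF W(1) _ W(2)] W(1) by simp
  define B where "B = mat_adjoint W * (A * W)"
  have [simp]: "dim_row B = Suc k" "dim_col B = Suc k" by (auto simp: B_def)
  have hB: "mat_adjoint B = B" using Suc.prems by (simp add: B_def mat_adj mat_ring)
  have A: "A = W * B * mat_adjoint W"
  proof -
    have "W * B * mat_adjoint W = (W * mat_adjoint W) * A * (W * mat_adjoint W)"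
      by (simp add: B_def mat_ring)
    thus ?thesis by (simp add: WW)
  qed
  have B0: "B $$ (i, 0) = (if i = 0 then e else 0)" if "i < Suc k" for i
  proof -
    have "col (A * W) 0 = e \<cdot>\<^sub>v col W 0"
      using v W(3) by (subst col_mult2) (auto simp: mult_mat_vec[OF Suc.prems(1) v(1)] smult_smult_assoc mult.commute)
    hence "B $$ (i, 0) = e * (row (mat_adjoint W) i \<bullet> col W 0)"
      using that by (simp add: B_def)
    also have "row (mat_adjoint W) i \<bullet> col W 0 = (mat_adjoint W * W) $$ (i, 0)" using that by simp
    also have "\<dots> = (if i = 0 then 1 else 0)" using W(2) that by simp
    finally show ?thesis by simp
  qed
  have herm: "cnj (B $$ (j, i)) = B $$ (i, j)" if "i < Suc k" "j < Suc k" for i j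
    using arg_cong[OF hB, of "\<lambda>M. M $$ (i, j)"] that by simp
  \<comment> \<open>The eigenvalue is a diagonal entry of the Hermitian matrix \<open>B\<close>,
    hence real.\<close>
  have e: "e = complex_of_real (Re e)" using herm[of 0 0] B0[of 0] by (simp add: complex_eq_iff)
  define A3 where "A3 = mat k k (\<lambda>(i, j). B $$ (Suc i, Suc j))"
  have A3: "A3 \<in> carrier_mat k k" "mat_adjoint A3 = A3"
    by (auto simp: A3_def herm)
  obtain U d where U: "U \<in> carrier_mat k k" "mat_adjoint U * U = 1\<^sub>m k" "A3 = U * real_diag k d * mat_adjoint U"
    using Suc.IH[OF A3] by blast
  define V where "V = four_block_mat (1\<^sub>m 1) (0\<^sub>m 1 k) (0\<^sub>m k 1) U"
  define d' where "d' = case_nat (Re e) d"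
  have V: "V \<in> carrier_mat (Suc k) (Suc k)" using U by (auto simp: V_def)
  note [simp] = carrier_matD[OF V] carrier_matD[OF U(1)]
  have aV: "mat_adjoint V = four_block_mat (1\<^sub>m 1) (0\<^sub>m 1 k) (0\<^sub>m k 1) (mat_adjoint U)"
    using U(1) unfolding V_def by (subst mat_adjoint_four_block) auto
  have D: "real_diag (Suc k) d' = four_block_mat (real_diag 1 d') (0\<^sub>m 1 k) (0\<^sub>m k 1) (real_diag k d)"
    by (intro eq_matI) (auto simp: real_diag_def d'_def split: nat.split)
  have Bb: "B = four_block_mat (real_diag 1 d') (0\<^sub>m 1 k) (0\<^sub>m k 1) A3"
  proof (rule eq_matI, goal_cases)
    case (1 i j)
    hence ij: "i < Suc k" "j < Suc k" by (auto simp: A3_def)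
    have "B $$ (0, j) = (if j = 0 then e else 0)" if "j < Suc k" for j
      using herm[of 0 j] B0[of j] B0[of 0] that by (cases "j = 0") auto
    with ij B0[of i] e show ?case
      by (auto simp: A3_def real_diag_def d'_def split: nat.split)
  qed (auto simp: A3_def)
  have VV: "mat_adjoint V * V = 1\<^sub>m (Suc k)"
    unfolding aV unfolding V_def using U
    by (subst mult_four_block_mat[of _ 1 1 _ k _ k _ _ 1 _ k]) (auto simp: mat_ring)
  have BV: "B = V * real_diag (Suc k) d' * mat_adjoint V"
    unfolding aV D Bb U(3) unfolding V_def using U(1)
    by (subst mult_four_block_mat[of _ 1 1 _ k _ k _ _ 1 _ k], auto simp: mat_ring)
       (subst mult_four_block_mat[of _ 1 1 _ k _ k _ _ 1 _ k], auto simp: mat_ring)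
  show ?case
  proof (intro exI conjI)
    show "W * V \<in> carrier_mat (Suc k) (Suc k)" using W(1) V by simp
    have "mat_adjoint (W * V) * (W * V) = mat_adjoint V * (mat_adjoint W * W) * V"
      by (simp add: mat_adj mat_ring)
    thus "mat_adjoint (W * V) * (W * V) = 1\<^sub>m (Suc k)" by (simp add: W(2) VV)
    have "A = W * (V * real_diag (Suc k) d' * mat_adjoint V) * mat_adjoint W"
      using A BV by simp
    thus "A = W * V * real_diag (Suc k) d' * mat_adjoint (W * V)"
      by (simp add: mat_adj mat_ring)
  qed
qed

section \<open>Square roots and the Moore-Penrose inverse\<close>

lemma nonneg_hermitianD:
  assumes "nonneg_hermitian A"
  shows "dim_col A = dim_row A" "mat_adjoint A = A"
    "dim_vec v = dim_row A \<Longrightarrow> 0 \<le> (A *\<^sub>v v) \<bullet>c v"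
  using assms unfolding nonneg_hermitian_def by (auto intro: carrier_vecI)

lemma nonneg_hermitianI:
  assumes "dim_col A = dim_row A" "mat_adjoint A = A"
    "\<And>v. dim_vec v = dim_row A \<Longrightarrow> 0 \<le> (A *\<^sub>v v) \<bullet>c v"
  shows "nonneg_hermitian A"
  using assms unfolding nonneg_hermitian_def by auto

lemma nonneg_hermitian_congruence:
  assumes "nonneg_hermitian A" "dim_row M = dim_row A"
  shows "nonneg_hermitian (mat_adjoint M * A * M)"
proof (rule nonneg_hermitianI)
  note [simp] = nonneg_hermitianD(1,2)[OF assms(1)] assms(2)
  show "mat_adjoint (mat_adjoint M * A * M) = mat_adjoint M * A * M"
    by (simp add: mat_adj mat_ring)
  fix v :: "complex vec" assume "dim_vec v = dim_row (mat_adjoint M * A * M)"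
  hence v: "dim_vec v = dim_col M" by simp
  have "(mat_adjoint M * A * M *\<^sub>v v) \<bullet>c v = (A *\<^sub>v (M *\<^sub>v v)) \<bullet>c (M *\<^sub>v v)"
    using v by (simp add: mat_vec_assoc mat_adjoint_cscalar)
  thus "0 \<le> (mat_adjoint M * A * M *\<^sub>v v) \<bullet>c v"
    using nonneg_hermitianD(3)[OF assms(1)] by simp
qed auto

lemma nonneg_hermitian_one [simp]: "nonneg_hermitian (1\<^sub>m n)"
  by (rule nonneg_hermitianI) (auto simp: cscalar_self_nonneg)

lemma nonneg_hermitian_gram: "nonneg_hermitian (mat_adjoint M * M)"
  using nonneg_hermitian_congruence[of "1\<^sub>m (dim_row M)" M] by (simp add: mat_ring)

lemma nonneg_hermitian_zero [simp]: "nonneg_hermitian (0\<^sub>m n n)"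
  by (rule nonneg_hermitianI) (auto simp: scalar_prod_def)

lemma nonneg_hermitian_add:
  assumes "nonneg_hermitian A" "nonneg_hermitian B" "dim_row A = dim_row B"
  shows "nonneg_hermitian (A + B)"
proof (rule nonneg_hermitianI)
  note [simp] = nonneg_hermitianD(1,2)[OF assms(1)] nonneg_hermitianD(1,2)[OF assms(2)] assms(3)
  show "mat_adjoint (A + B) = A + B" by (simp add: mat_adj)
  fix v :: "complex vec" assume "dim_vec v = dim_row (A + B)"
  hence v: "dim_vec v = dim_row B" by simp
  have "((A + B) *\<^sub>v v) \<bullet>c v = (A *\<^sub>v v) \<bullet>c v + (B *\<^sub>v v) \<bullet>c v"
    using v by (simp add: add_mat_vec cscalar_add_left)
  thus "0 \<le> ((A + B) *\<^sub>v v) \<bullet>c v"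
    using nonneg_hermitianD(3)[OF assms(1)] nonneg_hermitianD(3)[OF assms(2)] v by simp
qed (use assms nonneg_hermitianD(1) in auto)

text \<open>After right-nesting by \<open>mat_ring\<close>, two adjacent diagonal factors no longer
  form a subterm; this variant still merges them.\<close>

lemma real_diag_mult_left:
  assumes "dim_row A = n"
  shows "real_diag n d * (real_diag n e * A) = real_diag n (\<lambda>i. d i * e i) * A"
  using assms mat_assoc[of "real_diag n d" "real_diag n e" A] by (simp add: real_diag_mult)

lemma real_diag_cong: "(\<And>i. i < n \<Longrightarrow> d i = e i) \<Longrightarrow> real_diag n d = real_diag n e"
  by (intro eq_matI) (auto simp: real_diag_def)

lemma minus_mat_eq_zeroD:
  fixes A B :: "complex mat"
  assumes "A - B = 0\<^sub>m m n" "dim_row A = m" "dim_col A = n" "dim_row B = m" "dim_col B = n"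
  shows "A = B"
proof (rule eq_matI)
  fix i j assume "i < dim_row B" "j < dim_col B"
  with assms have ij: "i < m" "j < n" and "i < dim_row B" "j < dim_col B" by auto
  have "A $$ (i, j) - B $$ (i, j) = (A - B) $$ (i, j)"
    using \<open>i < dim_row B\<close> \<open>j < dim_col B\<close> by (rule index_minus_mat(1)[symmetric])
  also have "\<dots> = 0" unfolding assms(1) using ij by simp
  finally show "A $$ (i, j) = B $$ (i, j)" by simp
qed (simp_all add: assms(2-))

lemma nonneg_hermitian_real_diag:
  assumes "nonneg_hermitian (real_diag n d)" "i < n"
  shows "0 \<le> d i"
proof -
  have "(real_diag n d *\<^sub>v unit_vec n i) = complex_of_real (d i) \<cdot>\<^sub>v unit_vec n i"
    using assms(2) by (intro eq_vecI) (auto simp: real_diag_def)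
  hence a: "(real_diag n d *\<^sub>v unit_vec n i) \<bullet>c unit_vec n i = d i"
    using assms(2) by (simp add: cscalar_prod_sum if_distrib[of "\<lambda>x. _ * x"] if_distrib[of "\<lambda>x. x * _"] if_distrib[of cnj] cong: if_cong)
  from nonneg_hermitianD(3)[OF assms(1), of "unit_vec n i"] show ?thesis
    unfolding a by (auto simp: less_eq_complex_def)
qed

lemma unitary_cancel:
  fixes U A :: "complex mat"
  assumes "mat_adjoint U * U = 1\<^sub>m n" "U \<in> carrier_mat n n" "dim_row A = n"
  shows "mat_adjoint U * (U * A) = A" "U * (mat_adjoint U * A) = A"
proof -
  have "U * mat_adjoint U = 1\<^sub>m n"
    using mat_left_inverse_imp_right[OF assms(2) _ assms(1)] assms(2) by simp
  thus "mat_adjoint U * (U * A) = A" "U * (mat_adjoint U * A) = A"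
    using assms mat_assoc[of "mat_adjoint U" U A] mat_assoc[of U "mat_adjoint U" A] by auto
qed

lemma nonneg_hermitian_spectral:
  assumes "nonneg_hermitian A" "dim_row A = n"
  obtains U d where "U \<in> carrier_mat n n" "mat_adjoint U * U = 1\<^sub>m n"
    "A = U * real_diag n d * mat_adjoint U" "\<And>i. i < n \<Longrightarrow> 0 \<le> d i"
proof -
  note A = nonneg_hermitianD(1,2)[OF assms(1)]
  obtain U d where U: "U \<in> carrier_mat n n" "mat_adjoint U * U = 1\<^sub>m n" "A = U * real_diag n d * mat_adjoint U"
    using hermitian_spectral[of A n] A assms(2) by auto
  note [simp] = carrier_matD[OF U(1)] unitary_cancel[OF U(2,1)]
  have "real_diag n d = mat_adjoint U * A * U"
    unfolding U(3) by (simp add: mat_ring U(2))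
  hence "nonneg_hermitian (real_diag n d)"
    using nonneg_hermitian_congruence[OF assms(1), of U] assms(2) by simp
  thus ?thesis using that[OF U] nonneg_hermitian_real_diag by blast
qed

lemma mat_sqrt_exists:
  assumes "nonneg_hermitian A" "dim_row A = n"
  shows "\<exists>B. B \<in> carrier_mat n n \<and> nonneg_hermitian B \<and> B * B = A"
proof -
  obtain U d where U: "U \<in> carrier_mat n n" "mat_adjoint U * U = 1\<^sub>m n"
    "A = U * real_diag n d * mat_adjoint U" "\<And>i. i < n \<Longrightarrow> 0 \<le> d i"
    using nonneg_hermitian_spectral[OF assms] by blast
  note [simp] = carrier_matD[OF U(1)] unitary_cancel[OF U(2,1)]
  define B where "B = U * real_diag n (\<lambda>i. sqrt (d i)) * mat_adjoint U"
  have "real_diag n (\<lambda>i. sqrt (d i) * sqrt (d i)) = real_diag n d"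
    using U(4) by (intro real_diag_cong) simp
  hence "B * B = A" unfolding B_def U(3) by (simp add: mat_ring real_diag_mult_left)
  \<comment> \<open>Fourth roots exhibit the diagonal of square roots as a Gram matrix, which gives
    its non-negativity.\<close>
  moreover have "real_diag n (\<lambda>i. sqrt (d i)) =
      mat_adjoint (real_diag n (\<lambda>i. sqrt (sqrt (d i)))) * real_diag n (\<lambda>i. sqrt (sqrt (d i)))"
    unfolding mat_adjoint_real_diag real_diag_mult using U(4) by (intro real_diag_cong) simp
  hence "nonneg_hermitian (real_diag n (\<lambda>i. sqrt (d i)))"
    using nonneg_hermitian_gram[of "real_diag n (\<lambda>i. sqrt (sqrt (d i)))"] by simp
  hence "nonneg_hermitian B"
    unfolding B_def using nonneg_hermitian_congruence[of "real_diag n (\<lambda>i. sqrt (d i))" "mat_adjoint U"] by simp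
  moreover have "B \<in> carrier_mat n n" by (auto simp: B_def)
  ultimately show ?thesis by blast
qed

text \<open>The change of basis M between the two eigenbases intertwines the squared eigenvalues, so
  M vanishes at (i, j) unless d_i^2 = e_j^2. For non-negative numbers this means d_i = e_j, so M
  intertwines the eigenvalues themselves.\<close>

lemma nonneg_hermitian_sqrt_unique:
  assumes "nonneg_hermitian B" "nonneg_hermitian C" "dim_row B = n" "dim_row C = n" "B * B = C * C"
  shows "B = C"
proof -
  obtain U d where U: "U \<in> carrier_mat n n" "mat_adjoint U * U = 1\<^sub>m n"
    "B = U * real_diag n d * mat_adjoint U" "\<And>i. i < n \<Longrightarrow> 0 \<le> d i"
    using nonneg_hermitian_spectral[OF assms(1,3)] by blast
  obtain V e where V: "V \<in> carrier_mat n n" "mat_adjoint V * V = 1\<^sub>m n"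
    "C = V * real_diag n e * mat_adjoint V" "\<And>i. i < n \<Longrightarrow> 0 \<le> e i"
    using nonneg_hermitian_spectral[OF assms(2,4)] by blast
  note [simp] = carrier_matD[OF U(1)] unitary_cancel[OF U(2,1)] carrier_matD[OF V(1)] unitary_cancel[OF V(2,1)]
  define M where "M = mat_adjoint U * V"
  have [simp]: "dim_row M = n" "dim_col M = n" by (auto simp: M_def)
  have "mat_adjoint U * (B * B) * V = real_diag n d * (real_diag n d * M)"
    unfolding U(3) M_def by (simp add: mat_ring)
  moreover have "mat_adjoint U * (C * C) * V = (M * real_diag n e) * real_diag n e"
    unfolding V(3) M_def by (simp add: mat_ring V(2))
  ultimately have eq: "real_diag n d * (real_diag n d * M) = (M * real_diag n e) * real_diag n e"
    using assms(5) by simp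
  have "real_diag n d * M = M * real_diag n e"
  proof (rule eq_matI, goal_cases)
    case (1 i j)
    hence ij: "i < n" "j < n" by auto
    have "d i * (d i * M $$ (i, j)) = M $$ (i, j) * e j * e j"
      using arg_cong[OF eq, of "\<lambda>X. X $$ (i, j)"] ij
      by (simp add: index_mult_real_diag del: index_mult_mat(1))
    hence "M $$ (i, j) = 0 \<or> complex_of_real (d i * d i) = complex_of_real (e j * e j)"
      by (auto simp: algebra_simps)
    hence "M $$ (i, j) = 0 \<or> d i * d i = e j * e j" using of_real_eq_iff by blast
    hence "M $$ (i, j) = 0 \<or> d i = e j"
      using U(4)[of i] V(4)[of j] ij by (metis real_sqrt_abs2 abs_of_nonneg)
    thus ?case using ij by (auto simp: index_mult_real_diag simp del: index_mult_mat(1))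
  qed auto
  hence "U * (real_diag n d * M) * mat_adjoint V = U * (M * real_diag n e) * mat_adjoint V" by simp
  thus "B = C"
    unfolding M_def U(3) V(3) using mat_left_inverse_imp_right[OF V(1) mat_adjoint_carrier[OF V(1)] V(2)] 
    by (simp add: mat_ring)
qed

lemma mat_sqrt:
  assumes "nonneg_hermitian A"
  shows "dim_row (mat_sqrt A) = dim_row A" "dim_col (mat_sqrt A) = dim_row A"
    "mat_adjoint (mat_sqrt A) = mat_sqrt A" "mat_sqrt A * mat_sqrt A = A"
proof -
  have "\<exists>!B. B \<in> carrier_mat (dim_row A) (dim_row A) \<and> nonneg_hermitian B \<and> B * B = A"
    using mat_sqrt_exists[OF assms refl] nonneg_hermitian_sqrt_unique by (metis carrier_matD(1))
  from theI'[OF this] show "dim_row (mat_sqrt A) = dim_row A" "dim_col (mat_sqrt A) = dim_row A"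
    "mat_adjoint (mat_sqrt A) = mat_sqrt A" "mat_sqrt A * mat_sqrt A = A"
    unfolding mat_sqrt_def by (auto dest: nonneg_hermitianD)
qed

text \<open>The form at v is the squared length of \<open>mat_sqrt A *\<^sub>v v\<close>. This turns
  vanishing integrals into kernel equations later on.\<close>

lemma nonneg_hermitian_form_zero:
  assumes "nonneg_hermitian A" "dim_vec v = dim_row A" "(A *\<^sub>v v) \<bullet>c v = 0"
  shows "A *\<^sub>v v = 0\<^sub>v (dim_row A)"
proof -
  note [simp] = mat_sqrt(1-3)[OF assms(1)] assms(2)
  have A: "A *\<^sub>v v = mat_sqrt A *\<^sub>v (mat_sqrt A *\<^sub>v v)"
    by (subst mat_sqrt(4)[OF assms(1), symmetric]) (simp add: mat_vec_assoc)
  have "(mat_sqrt A *\<^sub>v v) \<bullet>c (mat_sqrt A *\<^sub>v v) = 0"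
    using assms(3) unfolding A by (simp add: mat_adjoint_cscalar)
  from cscalar_self_zero[OF this] show ?thesis
    unfolding A by (auto simp: scalar_prod_def)
qed

lemma nonneg_hermitian_antisym:
  assumes "nonneg_hermitian (A - B)" "nonneg_hermitian (B - A)"
    "A \<in> carrier_mat n n" "B \<in> carrier_mat n n"
  shows "A = B"
proof -
  define D where "D = A - B"
  have dD: "dim_row D = n" "dim_col D = n" and mD: "B - A = - D" using assms by (auto simp: D_def)
  have D: "nonneg_hermitian D" "nonneg_hermitian (- D)"
    using assms(1,2) unfolding D_def[symmetric] mD by auto
  have "D *\<^sub>v v = 0\<^sub>v n" if "dim_vec v = n" for v
  proof -
    have "0 \<le> (D *\<^sub>v v) \<bullet>c v" "0 \<le> - ((D *\<^sub>v v) \<bullet>c v)"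
      using nonneg_hermitianD(3)[OF D(1), of v] nonneg_hermitianD(3)[OF D(2), of v] that dD
      by (auto simp: uminus_mat_vec cscalar_uminus_left)
    hence "(D *\<^sub>v v) \<bullet>c v = 0" by (simp add: less_eq_complex_def complex_eq_iff)
    thus ?thesis using nonneg_hermitian_form_zero[of D v] D(1) that dD by simp
  qed
  hence "D = 0\<^sub>m n n" using mat_zeroI[of D] dD by simp
  thus ?thesis using minus_mat_eq_zeroD[of A B n n] assms(3,4) unfolding D_def by auto
qed

section \<open>The Moore-Penrose inverse\<close>

definition is_moore_penrose :: "complex mat \<Rightarrow> complex mat \<Rightarrow> bool" where
  "is_moore_penrose A X \<longleftrightarrow> X \<in> carrier_mat (dim_col A) (dim_row A) \<and>
     A * X * A = A \<and> X * A * X = X \<and>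
     mat_adjoint (A * X) = A * X \<and> mat_adjoint (X * A) = X * A"

text \<open>The products A X and X A are the orthogonal projections belonging to the ranges of A and
  of its adjoint, hence determined by A. Then X = X (A Y) = (X A) Y = Y.\<close>

lemma is_moore_penrose_unique:
  assumes X: "is_moore_penrose A X" and Y: "is_moore_penrose A Y"
  shows "X = Y"
proof -
  have [simp]: "dim_row X = dim_col A" "dim_col X = dim_row A" "dim_row Y = dim_col A" "dim_col Y = dim_row A"
    using X Y by (auto simp: is_moore_penrose_def)
  have x: "A * (X * A) = A" "X * (A * X) = X" "mat_adjoint X * mat_adjoint A = A * X"
     "mat_adjoint A * mat_adjoint X = X * A"
    using X by (auto simp: is_moore_penrose_def mat_ring mat_adj)
  have y: "A * (Y * A) = A" "Y * (A * Y) = Y" "mat_adjoint Y * mat_adjoint A = A * Y"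
     "mat_adjoint A * mat_adjoint Y = Y * A"
    using Y by (auto simp: is_moore_penrose_def mat_ring mat_adj)
  have "A * X = mat_adjoint X * mat_adjoint (A * (Y * A))" by (simp add: x y)
  also have "\<dots> = (mat_adjoint X * mat_adjoint A) * (mat_adjoint Y * mat_adjoint A)"
    by (simp add: mat_adj mat_ring)
  also have "\<dots> = (A * (X * A)) * Y" unfolding x(3) y(3) by (simp add: mat_ring)
  finally have 1: "A * X = A * Y" by (simp add: x)
  have "Y * A = mat_adjoint (A * (X * A)) * mat_adjoint Y" by (simp add: x y)
  also have "\<dots> = (mat_adjoint A * mat_adjoint X) * (mat_adjoint A * mat_adjoint Y)"
    by (simp add: mat_adj mat_ring)
  also have "\<dots> = X * (A * (Y * A))" unfolding x(4) y(4) by (simp add: mat_ring)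
  finally have 2: "Y * A = X * A" by (simp add: y)
  have "X = X * (A * Y)" using x(2) 1 by simp
  also have "\<dots> = (X * A) * Y" by (simp add: mat_ring)
  also have "\<dots> = Y" unfolding 2[symmetric] using y(2) by (simp add: mat_ring)
  finally show ?thesis .
qed

text \<open>The Hermitian matrix A^* A can be diagonalised even when A is not square; with
  \<open>G\<close> its Moore-Penrose inverse, the candidate is
  \<open>G * mat_adjoint A\<close>.\<close>

lemma is_moore_penrose_exists:
  fixes A :: "complex mat"
  shows "\<exists>X. is_moore_penrose A X"
proof -
  define n where "n = dim_col A"
  have [simp]: "dim_col A = n" by (simp add: n_def)
  define B where "B = mat_adjoint A * A"
  have [simp]: "dim_row B = n" "dim_col B = n" by (auto simp: B_def)
  have "mat_adjoint B = B" by (simp add: B_def mat_adj)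
  then obtain U d where U: "U \<in> carrier_mat n n" "mat_adjoint U * U = 1\<^sub>m n"
    "B = U * real_diag n d * mat_adjoint U"
    using hermitian_spectral[of B n] carrier_matI[of B n n] by auto
  note [simp] = carrier_matD[OF U(1)] unitary_cancel[OF U(2,1)]
  \<comment> \<open>Since \<open>inverse 0 = 0\<close>, the kernel of \<open>B\<close> is left at
    zero and no case distinction on the eigenvalues is needed.\<close>
  define G where "G = U * real_diag n (\<lambda>i. inverse (d i)) * mat_adjoint U"
  have [simp]: "dim_row G = n" "dim_col G = n" by (auto simp: G_def)
  have hG: "mat_adjoint G = G" by (simp add: G_def mat_adj mat_ring)
  define P where "P = G * B"
  have [simp]: "dim_row P = n" "dim_col P = n" by (auto simp: P_def)
  have P: "P = U * real_diag n (\<lambda>i. inverse (d i) * d i) * mat_adjoint U"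
    unfolding P_def G_def U(3) by (simp add: mat_ring real_diag_mult_left)
  have hP: "mat_adjoint P = P" unfolding P by (simp add: mat_adj mat_ring)
  have "B * P = U * real_diag n (\<lambda>i. d i * (inverse (d i) * d i)) * mat_adjoint U"
    unfolding P U(3) by (simp add: mat_ring real_diag_mult_left)
  also have "real_diag n (\<lambda>i. d i * (inverse (d i) * d i)) = real_diag n d"
    by (intro real_diag_cong) (simp add: field_simps)
  finally have BP: "B * P = B" by (simp add: U(3))
  have "G * (B * G) = U * real_diag n (\<lambda>i. inverse (d i) * (d i * inverse (d i))) * mat_adjoint U"
    unfolding G_def U(3) by (simp add: mat_ring real_diag_mult_left)
  also have "real_diag n (\<lambda>i. inverse (d i) * (d i * inverse (d i))) = real_diag n (\<lambda>i. inverse (d i))"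
    by (intro real_diag_cong) (simp add: field_simps)
  finally have GBG: "G * (B * G) = G" by (simp add: G_def)
  \<comment> \<open>The equation \<open>BP\<close> only says that the adjoint of \<open>A\<close>
    kills \<open>A - A * P\<close>. That suffices for the Gram matrix of this difference to
    vanish.\<close>
  have "mat_adjoint A * (A * P) = mat_adjoint A * A" using BP by (simp add: B_def mat_ring)
  hence "mat_adjoint (A - A * P) * (A - A * P) = 0\<^sub>m n n"
    by (simp add: mat_adj mat_ring hP mat_minus_self)
  hence "A - A * P = 0\<^sub>m (dim_row A) n"
    using adjoint_mult_self_zero[of "A - A * P"] by simp
  hence AP: "A * P = A" using minus_mat_eq_zeroD[of A "A * P" "dim_row A" n] by simp
  have "is_moore_penrose A (G * mat_adjoint A)"
    unfolding is_moore_penrose_def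
  proof (intro conjI)
    have "A * (G * mat_adjoint A) * A = A * P" by (simp add: P_def B_def mat_ring)
    thus "A * (G * mat_adjoint A) * A = A" by (simp add: AP)
    have "G * mat_adjoint A * A * (G * mat_adjoint A) = (G * (B * G)) * mat_adjoint A"
      by (simp add: B_def mat_ring)
    thus "G * mat_adjoint A * A * (G * mat_adjoint A) = G * mat_adjoint A" by (simp add: GBG)
    show "mat_adjoint (A * (G * mat_adjoint A)) = A * (G * mat_adjoint A)"
      by (simp add: mat_adj mat_ring hG)
    have "G * mat_adjoint A * A = P" by (simp add: P_def B_def mat_ring)
    thus "mat_adjoint (G * mat_adjoint A * A) = G * mat_adjoint A * A" by (simp add: hP)
  qed auto
  thus ?thesis by blast
qed

lemma is_moore_penrose_moore_penrose: "is_moore_penrose A (moore_penrose A)"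
proof -
  have "\<exists>!X. is_moore_penrose A X"
    using is_moore_penrose_exists is_moore_penrose_unique by blast
  from theI'[OF this] show ?thesis unfolding moore_penrose_def is_moore_penrose_def .
qed

lemma dim_moore_penrose [simp]:
  "dim_row (moore_penrose A) = dim_col A" "dim_col (moore_penrose A) = dim_row A"
  using is_moore_penrose_moore_penrose[of A] by (auto simp: is_moore_penrose_def)

lemma moore_penrose:
  "A * (moore_penrose A * A) = A" "moore_penrose A * (A * moore_penrose A) = moore_penrose A"
  "mat_adjoint (moore_penrose A) * mat_adjoint A = A * moore_penrose A"
  "mat_adjoint A * mat_adjoint (moore_penrose A) = moore_penrose A * A"
  using is_moore_penrose_moore_penrose[of A] by (auto simp: is_moore_penrose_def mat_ring mat_adj)

text \<open>Taking adjoints permutes the Penrose equations of a Hermitian matrix, so uniqueness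
  applies.\<close>

lemma moore_penrose_hermitian:
  assumes "mat_adjoint A = A"
  shows "mat_adjoint (moore_penrose A) = moore_penrose A"
    "moore_penrose A * A = A * moore_penrose A"
proof -
  have d: "dim_row A = dim_col A" using assms by (metis dim_mat_adjoint(1))
  let ?X = "moore_penrose A"
  have e1: "mat_adjoint ?X * A = A * ?X" "A * mat_adjoint ?X = ?X * A"
    using moore_penrose(3,4)[of A] by (simp_all add: assms)
  have "is_moore_penrose A (mat_adjoint ?X)"
    unfolding is_moore_penrose_def
  proof (intro conjI)
    show "A * mat_adjoint ?X * A = A"
      using arg_cong[OF moore_penrose(1)[of A], of mat_adjoint] d by (simp add: mat_ring mat_adj assms)
    have "mat_adjoint (?X * (A * ?X)) = mat_adjoint ?X" by (simp add: moore_penrose)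
    thus "mat_adjoint ?X * A * mat_adjoint ?X = mat_adjoint ?X"
      using d by (simp add: mat_adj mat_ring assms)
  qed (use d in \<open>auto simp: mat_adj assms e1\<close>)
  from is_moore_penrose_unique[OF this is_moore_penrose_moore_penrose]
  show *: "mat_adjoint ?X = ?X" .
  show "?X * A = A * ?X" using e1 unfolding * by simp
qed

section \<open>Schur complements\<close>

definition block_schur :: "complex mat \<Rightarrow> complex mat \<Rightarrow> complex mat \<Rightarrow> complex mat" where
  "block_schur A Y D = D - mat_adjoint Y * moore_penrose A * Y"

text \<open>The linear algebra of adding one block row and column. The range condition is the
  equation \<open>A * W = Y\<close>: it is derived when \<open>M\<close> is known to be
  non-negative, and it is a premise when non-negativity of \<open>M\<close> is the goal.\<close>

locale hermitian_block =
  fixes n q :: nat and A Y D M :: "complex mat"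
  assumes A: "A \<in> carrier_mat n n" "mat_adjoint A = A"
    and Y: "Y \<in> carrier_mat n q"
    and D: "D \<in> carrier_mat q q" "mat_adjoint D = D"
    and M: "M = four_block_mat A Y (mat_adjoint Y) D"
begin

lemma dims [simp]:
  "dim_row A = n" "dim_col A = n" "dim_row Y = n" "dim_col Y = q" "dim_row D = q" "dim_col D = q"
  "dim_row M = n + q" "dim_col M = n + q"
  using A Y D by (auto simp: M)

definition "S = block_schur A Y D"
definition "W = moore_penrose A * Y"

lemma dims2 [simp]: "dim_row S = q" "dim_col S = q" "dim_row W = n" "dim_col W = q"
  by (auto simp: S_def block_schur_def W_def)

lemma adjoint_S: "mat_adjoint S = S"
  by (simp add: S_def block_schur_def mat_adj mat_ring moore_penrose_hermitian A D)

lemma adjoint_M: "mat_adjoint M = M"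
  unfolding M using A Y D by (subst mat_adjoint_four_block[of _ n n _ q _ q]) auto

lemma M_mult_append:
  assumes "dim_vec u = n" "dim_vec v = q"
  shows "M *\<^sub>v (u @\<^sub>v v) = (A *\<^sub>v u + Y *\<^sub>v v) @\<^sub>v (mat_adjoint Y *\<^sub>v u + D *\<^sub>v v)"
  unfolding M using A Y D assms by (intro four_block_mat_mult_vec) (auto intro: carrier_vecI)

lemma M_mult_append_eq_zero:
  assumes "dim_vec u = n" "dim_vec v = q"
  shows "M *\<^sub>v (u @\<^sub>v v) = 0\<^sub>v (n + q) \<longleftrightarrow>
    A *\<^sub>v u + Y *\<^sub>v v = 0\<^sub>v n \<and> mat_adjoint Y *\<^sub>v u + D *\<^sub>v v = 0\<^sub>v q"
proof -
  have "0\<^sub>v (n + q) = 0\<^sub>v n @\<^sub>v (0\<^sub>v q :: complex vec)" by (intro eq_vecI) auto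
  thus ?thesis unfolding M_mult_append[OF assms]
    by (simp add: append_vec_eq[of _ n] carrier_dim_vec del: carrier_vecD)
qed

lemma append_cscalar:
  assumes "dim_vec u = dim_vec u'" "dim_vec v = dim_vec v'"
  shows "(u @\<^sub>v v) \<bullet>c (u' @\<^sub>v v') = u \<bullet>c u' + v \<bullet>c (v' :: complex vec)"
proof -
  have "conjugate (u' @\<^sub>v v') = conjugate u' @\<^sub>v conjugate v'" by (intro eq_vecI) auto
  thus ?thesis using assms
    by (simp add: scalar_prod_append[of _ "dim_vec u'" _ "dim_vec v'"] carrier_dim_vec del: carrier_vecD)
qed

text \<open>Block elimination: the adjoint of \<open>Y\<close> factors through \<open>A\<close>, so
  the first equation expresses its value at u through v alone.\<close>

lemma last_block:
  assumes r: "A * W = Y" and uv: "dim_vec u = n" "dim_vec v = q" "A *\<^sub>v u + Y *\<^sub>v v = 0\<^sub>v n"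
  shows "mat_adjoint Y *\<^sub>v u + D *\<^sub>v v = S *\<^sub>v v"
proof -
  have "mat_adjoint Y = mat_adjoint W * A" using arg_cong[OF r, of mat_adjoint] by (simp add: mat_adj A)
  hence "mat_adjoint Y *\<^sub>v u = mat_adjoint W *\<^sub>v (A *\<^sub>v u)" using uv by (simp add: mat_vec_assoc)
  also have "A *\<^sub>v u = - (Y *\<^sub>v v)"
  proof (rule eq_vecI)
    fix i assume "i < dim_vec (- (Y *\<^sub>v v))"
    thus "(A *\<^sub>v u) $ i = (- (Y *\<^sub>v v)) $ i"
      using arg_cong[OF uv(3), of "\<lambda>x. x $ i"] by (simp add: eq_neg_iff_add_eq_0 del: index_mult_mat_vec)
  qed auto
  also have "mat_adjoint W *\<^sub>v - (Y *\<^sub>v v) = - (mat_adjoint W *\<^sub>v (Y *\<^sub>v v))"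
    by (intro eq_vecI) (auto simp: mult_mat_vec_index sum_negf simp del: index_mult_mat_vec)
  also have "mat_adjoint W *\<^sub>v (Y *\<^sub>v v) = mat_adjoint Y * moore_penrose A * Y *\<^sub>v v"
    using uv by (simp add: W_def mat_vec_assoc mat_adj moore_penrose_hermitian A)
  finally show ?thesis
    unfolding S_def block_schur_def using uv
    by (intro eq_vecI) (auto simp: minus_mat_vec simp del: index_mult_mat_vec)
qed

text \<open>Completing the square with the substitution u + W v.\<close>

lemma form_M:
  assumes r: "A * W = Y" and uv: "dim_vec u = n" "dim_vec v = q"
  shows "(M *\<^sub>v (u @\<^sub>v v)) \<bullet>c (u @\<^sub>v v) =
    (A *\<^sub>v (u + W *\<^sub>v v)) \<bullet>c (u + W *\<^sub>v v) + (S *\<^sub>v v) \<bullet>c v"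
proof -
  have Yv: "Y *\<^sub>v v = A *\<^sub>v (W *\<^sub>v v)" using uv by (simp add: r flip: mat_vec_assoc)
  have aY: "mat_adjoint Y = mat_adjoint W * A" using arg_cong[OF r, of mat_adjoint] by (simp add: mat_adj A)
  have Dv: "D *\<^sub>v v = S *\<^sub>v v + mat_adjoint Y *\<^sub>v (W *\<^sub>v v)"
    unfolding S_def block_schur_def W_def using uv
    by (intro eq_vecI) (auto simp: minus_mat_vec mat_vec_assoc mat_ring simp del: index_mult_mat_vec)
  define w where "w = W *\<^sub>v v"
  have [simp]: "dim_vec w = n" by (simp add: w_def)
  define x where "x = u + w"
  have [simp]: "dim_vec x = n" by (simp add: x_def)
  have Ax: "A *\<^sub>v x = A *\<^sub>v u + A *\<^sub>v w"
    unfolding x_def using uv A by (intro mult_add_distrib_mat_vec[of _ n n]) (auto intro: carrier_vecI)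
  have Wx: "mat_adjoint Y *\<^sub>v x = mat_adjoint Y *\<^sub>v u + mat_adjoint Y *\<^sub>v w"
    unfolding x_def using uv Y by (intro mult_add_distrib_mat_vec[of _ q n]) (auto intro: carrier_vecI)
  have "mat_adjoint Y *\<^sub>v u + D *\<^sub>v v = mat_adjoint Y *\<^sub>v x + S *\<^sub>v v"
    unfolding Wx Dv w_def[symmetric] by (intro eq_vecI) (auto simp del: index_mult_mat_vec)
  hence "(M *\<^sub>v (u @\<^sub>v v)) \<bullet>c (u @\<^sub>v v) = (A *\<^sub>v x) \<bullet>c u + ((mat_adjoint Y *\<^sub>v x) \<bullet>c v + (S *\<^sub>v v) \<bullet>c v)"
    unfolding M_mult_append[OF uv] Yv w_def[symmetric] Ax[symmetric]
    using uv by (simp add: append_cscalar cscalar_add_left)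
  also have "(mat_adjoint Y *\<^sub>v x) \<bullet>c v = (A *\<^sub>v x) \<bullet>c w"
    unfolding aY w_def using uv by (simp add: mat_vec_assoc mat_adjoint_cscalar[of _ "mat_adjoint W"])
  finally show ?thesis
    using uv unfolding w_def[symmetric] x_def[symmetric]
    by (simp add: x_def cscalar_prod_sum distrib_left sum.distrib del: index_mult_mat_vec)
qed

text \<open>The matrix 1 - A^+ A maps into the kernel of A and is therefore annihilated by the
  adjoint of Y. The adjoint of this equation is the range condition.\<close>

lemma range_if_kernel:
  assumes ker: "\<And>u. dim_vec u = n \<Longrightarrow> A *\<^sub>v u = 0\<^sub>v n \<Longrightarrow> mat_adjoint Y *\<^sub>v u = 0\<^sub>v q"
  shows "A * W = Y"
proof -
  have "mat_adjoint Y - mat_adjoint Y * (moore_penrose A * A) = 0\<^sub>m q n"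
  proof -
    let ?N = "1\<^sub>m n - moore_penrose A * A"
    have AN: "A * ?N = 0\<^sub>m n n" by (simp add: mat_ring moore_penrose mat_minus_self)
    have "mat_adjoint Y * ?N = 0\<^sub>m q n"
    proof (rule mat_eqI_vec)
      fix v :: "complex vec" assume "dim_vec v = dim_col (mat_adjoint Y * ?N)"
      hence v: "dim_vec v = n" by simp
      have "A *\<^sub>v (?N *\<^sub>v v) = A * ?N *\<^sub>v v" using v by (simp add: mat_vec_assoc)
      hence "A *\<^sub>v (?N *\<^sub>v v) = 0\<^sub>v n" unfolding AN using v by simp
      from ker[OF _ this] have "mat_adjoint Y *\<^sub>v (?N *\<^sub>v v) = 0\<^sub>v q" by simp
      moreover have "mat_adjoint Y * ?N *\<^sub>v v = mat_adjoint Y *\<^sub>v (?N *\<^sub>v v)"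
        using v by (intro mat_vec_assoc) auto
      ultimately show "mat_adjoint Y * ?N *\<^sub>v v = 0\<^sub>m q n *\<^sub>v v" using v by simp
    qed auto
    thus ?thesis by (simp add: mat_ring)
  qed
  hence "mat_adjoint Y = mat_adjoint Y * (moore_penrose A * A)"
    by (rule minus_mat_eq_zeroD) auto
  hence "mat_adjoint (mat_adjoint Y) = mat_adjoint (mat_adjoint Y * (moore_penrose A * A))" by (rule arg_cong)
  thus ?thesis
    by (simp add: mat_adj mat_ring moore_penrose_hermitian A W_def)
qed

text \<open>Two test vectors carry the proof. A zero last block isolates \<open>A\<close>; the upper
  block \<open>- (W *\<^sub>v v)\<close> kills the first square in \<open>form_M\<close> and
  isolates \<open>S\<close>. A vanishing form then gives a null vector of \<open>M\<close>.\<close>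

lemma nonneg_M_imp:
  assumes "nonneg_hermitian M"
  shows "nonneg_hermitian A" "A * W = Y" "nonneg_hermitian S"
    and "\<And>u. dim_vec u = n \<Longrightarrow> A *\<^sub>v u = 0\<^sub>v n \<Longrightarrow> mat_adjoint Y *\<^sub>v u = 0\<^sub>v q"
    and "\<And>v. dim_vec v = q \<Longrightarrow> S *\<^sub>v v = 0\<^sub>v q \<longleftrightarrow> (\<exists>u. dim_vec u = n \<and> M *\<^sub>v (u @\<^sub>v v) = 0\<^sub>v (n + q))"
proof -
  have z0: "(x :: complex vec) \<bullet>c 0\<^sub>v q = 0" for x by (simp add: scalar_prod_def)
  have Y0: "Y *\<^sub>v 0\<^sub>v q = 0\<^sub>v n" "D *\<^sub>v 0\<^sub>v q = 0\<^sub>v q" by (auto intro!: eq_vecI simp: scalar_prod_def)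
  have form_A: "(M *\<^sub>v (u @\<^sub>v 0\<^sub>v q)) \<bullet>c (u @\<^sub>v 0\<^sub>v q) = (A *\<^sub>v u) \<bullet>c u" if "dim_vec u = n" for u
    using that by (simp add: M_mult_append append_cscalar Y0 z0 cscalar_add_left)
      (simp add: scalar_prod_def)
  show nA: "nonneg_hermitian A"
  proof (rule nonneg_hermitianI)
    fix u :: "complex vec" assume "dim_vec u = dim_row A"
    thus "0 \<le> (A *\<^sub>v u) \<bullet>c u"
      using nonneg_hermitianD(3)[OF assms, of "u @\<^sub>v 0\<^sub>v q"] form_A[of u] by simp
  qed (simp_all add: A)
  show ker: "mat_adjoint Y *\<^sub>v u = 0\<^sub>v q" if "dim_vec u = n" "A *\<^sub>v u = 0\<^sub>v n" for u
  proof -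
    have "(M *\<^sub>v (u @\<^sub>v 0\<^sub>v q)) \<bullet>c (u @\<^sub>v 0\<^sub>v q) = 0"
      using form_A[OF that(1)] that by (simp add: scalar_prod_def)
    from nonneg_hermitian_form_zero[OF assms _ this]
    have "M *\<^sub>v (u @\<^sub>v 0\<^sub>v q) = 0\<^sub>v (n + q)" using that by simp
    hence "mat_adjoint Y *\<^sub>v u + D *\<^sub>v 0\<^sub>v q = 0\<^sub>v q"
      using M_mult_append_eq_zero[of u "0\<^sub>v q"] that by simp
    thus ?thesis by (simp add: Y0 left_zero_vec[of _ q] carrier_dim_vec del: carrier_vecD)
  qed
  show r: "A * W = Y" by (rule range_if_kernel) (rule ker)
  have form_S: "(M *\<^sub>v (- (W *\<^sub>v v) @\<^sub>v v)) \<bullet>c (- (W *\<^sub>v v) @\<^sub>v v) = (S *\<^sub>v v) \<bullet>c v" if "dim_vec v = q" for v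
  proof -
    have "- (W *\<^sub>v v) + W *\<^sub>v v = 0\<^sub>v n" by (intro eq_vecI) (auto simp del: index_mult_mat_vec)
    thus ?thesis using form_M[OF r, of "- (W *\<^sub>v v)" v] that by (simp add: scalar_prod_def)
  qed
  show nS: "nonneg_hermitian S"
  proof (rule nonneg_hermitianI)
    fix v :: "complex vec" assume "dim_vec v = dim_row S"
    thus "0 \<le> (S *\<^sub>v v) \<bullet>c v"
      using nonneg_hermitianD(3)[OF assms, of "- (W *\<^sub>v v) @\<^sub>v v"] form_S[of v] by simp
  qed (simp_all add: adjoint_S)
  show "S *\<^sub>v v = 0\<^sub>v q \<longleftrightarrow> (\<exists>u. dim_vec u = n \<and> M *\<^sub>v (u @\<^sub>v v) = 0\<^sub>v (n + q))" if v: "dim_vec v = q" for v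
  proof
    assume "S *\<^sub>v v = 0\<^sub>v q"
    hence "(M *\<^sub>v (- (W *\<^sub>v v) @\<^sub>v v)) \<bullet>c (- (W *\<^sub>v v) @\<^sub>v v) = 0"
      using form_S[OF v] v by (simp add: scalar_prod_def)
    from nonneg_hermitian_form_zero[OF assms _ this]
    show "\<exists>u. dim_vec u = n \<and> M *\<^sub>v (u @\<^sub>v v) = 0\<^sub>v (n + q)" using v by (intro exI[of _ "- (W *\<^sub>v v)"]) simp
  next
    assume "\<exists>u. dim_vec u = n \<and> M *\<^sub>v (u @\<^sub>v v) = 0\<^sub>v (n + q)"
    then obtain u where u: "dim_vec u = n" "A *\<^sub>v u + Y *\<^sub>v v = 0\<^sub>v n" "mat_adjoint Y *\<^sub>v u + D *\<^sub>v v = 0\<^sub>v q"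
      using M_mult_append_eq_zero v by blast
    show "S *\<^sub>v v = 0\<^sub>v q" using last_block[OF r u(1) v u(2)] u(3) by simp
  qed
qed

lemma nonneg_M:
  assumes "nonneg_hermitian A" "A * W = Y" "nonneg_hermitian S"
  shows "nonneg_hermitian M"
proof (rule nonneg_hermitianI)
  fix x :: "complex vec" assume "dim_vec x = dim_row M"
  hence "x \<in> carrier_vec (n + q)" by (simp add: carrier_dim_vec del: carrier_vecD)
  hence x: "vec_first x n @\<^sub>v vec_last x q = x" by simp
  have "0 \<le> (M *\<^sub>v (vec_first x n @\<^sub>v vec_last x q)) \<bullet>c (vec_first x n @\<^sub>v vec_last x q)"
    by (subst form_M[OF assms(2)]) (auto intro!: add_nonneg_nonneg nonneg_hermitianD(3)[OF assms(1)] nonneg_hermitianD(3)[OF assms(3)])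
  thus "0 \<le> (M *\<^sub>v x) \<bullet>c x" by (simp add: x)
qed (simp_all add: adjoint_M)

end

section \<open>The shorted matrix\<close>

lemma zero_vec_cscalar [simp]: "0\<^sub>v n \<bullet>c v = 0" if "dim_vec v = n" for v :: "complex vec"
  using that by (simp add: scalar_prod_def)

lemma one_mat_vec: "dim_vec v = n \<Longrightarrow> 1\<^sub>m n *\<^sub>v v = (v :: complex vec)"
  by (rule one_mult_mat_vec) (rule carrier_vecI)

lemma mult_zero_vec: "dim_col A = n \<Longrightarrow> A *\<^sub>v 0\<^sub>v n = (0\<^sub>v (dim_row A) :: complex vec)"
  by (intro eq_vecI) (auto simp: scalar_prod_def)

lemma orth_proj_kernel:
  assumes Z: "Z \<in> carrier_mat n q"
  shows "orth_proj q {x \<in> carrier_vec q. Z *\<^sub>v x = 0\<^sub>v n} = 1\<^sub>m q - moore_penrose Z * Z" (is "orth_proj q ?W = ?P")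
  unfolding orth_proj_def
proof (rule the_equality)
  note [simp] = carrier_matD[OF Z]
  have ZP: "Z * ?P = 0\<^sub>m n q" by (simp add: mat_ring moore_penrose mat_minus_self)
  have hZ: "mat_adjoint (moore_penrose Z * Z) = moore_penrose Z * Z"
    by (simp add: mat_adj moore_penrose)
  have 1: "?P *\<^sub>v x \<in> ?W" if "x \<in> carrier_vec q" for x
  proof -
    have "Z *\<^sub>v (?P *\<^sub>v x) = Z * ?P *\<^sub>v x" using that by (intro mat_vec_assoc[symmetric]) auto
    thus ?thesis unfolding ZP using that by (auto intro!: carrier_vecI)
  qed
  have 2: "(x - ?P *\<^sub>v x) \<bullet>c w = 0" if "x \<in> carrier_vec q" "w \<in> ?W" for x w
  proof -
    have "x - ?P *\<^sub>v x = (moore_penrose Z * Z) *\<^sub>v x"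
      using that by (intro eq_vecI) (auto simp: minus_mat_vec one_mat_vec simp del: index_mult_mat_vec)
    hence "(x - ?P *\<^sub>v x) \<bullet>c w = ((moore_penrose Z * Z) *\<^sub>v x) \<bullet>c w" by simp
    also have "\<dots> = x \<bullet>c ((moore_penrose Z * Z) *\<^sub>v w)"
      using that by (subst mat_adjoint_cscalar) (auto simp: hZ)
    also have "(moore_penrose Z * Z) *\<^sub>v w = 0\<^sub>v q"
      using that by (subst mat_vec_assoc) (auto simp: mult_zero_vec)
    finally show ?thesis using that by (simp add: scalar_prod_def)
  qed
  show "?P \<in> carrier_mat q q \<and> (\<forall>x\<in>carrier_vec q. ?P *\<^sub>v x \<in> ?W \<and> (\<forall>w\<in>?W. (x - ?P *\<^sub>v x) \<bullet>c w = 0))"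
    using 1 2 by auto
  fix P assume P: "P \<in> carrier_mat q q \<and> (\<forall>x\<in>carrier_vec q. P *\<^sub>v x \<in> ?W \<and> (\<forall>w\<in>?W. (x - P *\<^sub>v x) \<bullet>c w = 0))"
  show "P = ?P"
  proof (rule mat_eqI_vec)
    fix v :: "complex vec" assume "dim_vec v = dim_col P"
    hence v: "v \<in> carrier_vec q" using P by (auto intro!: carrier_vecI)
    define a b where "a = P *\<^sub>v v" and "b = ?P *\<^sub>v v"
    have ab: "a \<in> ?W" "b \<in> ?W" unfolding a_def b_def using P 1 v by blast+
    hence [simp]: "dim_vec a = q" "dim_vec b = q" by auto
    \<comment> \<open>Two candidates differ by a vector of \<open>?W\<close> which is also the
      difference of their residuals. Residuals are orthogonal to \<open>?W\<close>, so this vector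
      is orthogonal to itself.\<close>
    have "b - a \<in> ?W"
    proof -
      have "Z *\<^sub>v (b - a) = Z *\<^sub>v b - Z *\<^sub>v a" using ab Z by (intro mult_minus_distrib_mat_vec) auto
      thus ?thesis using ab by auto
    qed
    hence "(v - a) \<bullet>c (b - a) = 0" "(v - b) \<bullet>c (b - a) = 0"
      unfolding a_def b_def using P 2 v by blast+
    moreover have "b - a = (v - a) - (v - b)" using v by (intro eq_vecI) auto
    hence "(b - a) \<bullet>c (b - a) = (v - a) \<bullet>c (b - a) - (v - b) \<bullet>c (b - a)"
      using v cscalar_minus_left[of "v - a" "b - a" "v - b"] by simp
    ultimately have "b - a = 0\<^sub>v q" using cscalar_self_zero[of "b - a"] by simp
    hence "(b - a) $ i = 0" if "i < q" for i using that by simp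
    thus "P *\<^sub>v v = ?P *\<^sub>v v" unfolding a_def[symmetric] b_def[symmetric] by (intro eq_vecI) auto
  qed (use P in auto)
qed

text \<open>T T^+ is the projection onto the range of T. Membership becomes a linear equation, so
  the subspace in the definition of the shorted matrix is a kernel and
  \<open>orth_proj_kernel\<close> applies.\<close>

lemma mem_col_space_iff:
  assumes "T \<in> carrier_mat q q" "y \<in> carrier_vec q"
  shows "y \<in> vec_space.col_space q T \<longleftrightarrow> (1\<^sub>m q - T * moore_penrose T) *\<^sub>v y = 0\<^sub>v q" (is "_ \<longleftrightarrow> ?N *\<^sub>v y = _")
proof
  note [simp] = carrier_matD[OF assms(1)] carrier_vecD[OF assms(2)]
  interpret vec_space "TYPE(complex)" q .
  have N: "?N *\<^sub>v y = y - T *\<^sub>v (moore_penrose T *\<^sub>v y)"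
    by (simp add: minus_mat_vec mat_vec_assoc one_mat_vec)
  show "y \<in> col_space T" if "?N *\<^sub>v y = 0\<^sub>v q"
  proof -
    have "T *\<^sub>v (moore_penrose T *\<^sub>v y) = y"
    proof (rule eq_vecI)
      fix i assume "i < dim_vec y"
      thus "(T *\<^sub>v (moore_penrose T *\<^sub>v y)) $ i = y $ i"
        using arg_cong[OF that[unfolded N], of "\<lambda>v. v $ i"] by (simp del: index_mult_mat_vec)
    qed auto
    thus ?thesis unfolding col_space_eq[OF assms(1)] using assms(2) by (force intro!: carrier_vecI)
  qed
  assume "y \<in> col_space T"
  then obtain x where x: "x \<in> carrier_vec q" "T *\<^sub>v x = y"
    unfolding col_space_eq[OF assms(1)] by auto
  have "?N * T = 0\<^sub>m q q" by (simp add: mat_ring moore_penrose mat_minus_self)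
  moreover have "?N *\<^sub>v y = ?N * T *\<^sub>v x" using x(1) unfolding x(2)[symmetric]
    by (intro mat_vec_assoc[symmetric]) auto
  ultimately show "?N *\<^sub>v y = 0\<^sub>v q" using x(1) by simp
qed

text \<open>With \<open>N\<close> the projection onto the kernel of \<open>T\<close> and \<open>Z = N \<surd>A\<close>, the matrix
  \<open>1 - C\<close> below is the congruence that removes from \<open>A\<close> exactly the part invisible to \<open>\<S>(A, \<R>(T))\<close>
  and fixes every \<open>X\<close> with range in \<open>\<R>(T)\<close>.\<close>

lemma schur_short_col_space:
  assumes A: "nonneg_hermitian A" "A \<in> carrier_mat q q"
    and T: "T \<in> carrier_mat q q" "mat_adjoint T = T"
  defines "S \<equiv> schur_short A (vec_space.col_space q T)"
  shows "S \<in> carrier_mat q q" "nonneg_hermitian S" "nonneg_hermitian (A - S)"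
    and "\<And>v. dim_vec v = q \<Longrightarrow> T *\<^sub>v v = 0\<^sub>v q \<Longrightarrow> S *\<^sub>v v = 0\<^sub>v q"
    and "\<And>X. nonneg_hermitian X \<Longrightarrow> X \<in> carrier_mat q q \<Longrightarrow> nonneg_hermitian (A - X) \<Longrightarrow>
      (\<And>v. dim_vec v = q \<Longrightarrow> T *\<^sub>v v = 0\<^sub>v q \<Longrightarrow> X *\<^sub>v v = 0\<^sub>v q) \<Longrightarrow> nonneg_hermitian (S - X)"
proof -
  note [simp] = carrier_matD[OF A(2)] carrier_matD[OF T(1)]
  define R where "R = mat_sqrt A"
  have R [simp]: "dim_row R = q" "dim_col R = q" "mat_adjoint R = R" and RR: "R * R = A"
    using mat_sqrt[OF A(1)] by (auto simp: R_def)
  define N where "N = 1\<^sub>m q - T * moore_penrose T"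
  have N [simp]: "dim_row N = q" "dim_col N = q" by (auto simp: N_def)
  have hN [simp]: "mat_adjoint N = N"
    by (simp add: N_def mat_adj T moore_penrose_hermitian)
  have TN: "T * N = 0\<^sub>m q q"
    by (simp add: N_def mat_ring mat_minus_self flip: moore_penrose_hermitian(2)[OF T(2)])
       (simp add: moore_penrose mat_minus_self)
  define Z where "Z = N * R"
  have Z [simp]: "dim_row Z = q" "dim_col Z = q" by (auto simp: Z_def)
  have aZ: "mat_adjoint Z = R * N" by (simp add: Z_def mat_adj)
  define K where "K = moore_penrose Z * Z"
  have K [simp]: "dim_row K = q" "dim_col K = q" by (auto simp: K_def)
  have hK [simp]: "mat_adjoint K = K" by (simp add: K_def mat_adj moore_penrose)
  have KK: "K * K = K" by (simp add: K_def mat_ring moore_penrose)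
  have ZK: "Z * K = Z" by (simp add: K_def mat_ring moore_penrose)
  define P where "P = 1\<^sub>m q - K"
  have P [simp]: "dim_row P = q" "dim_col P = q" "mat_adjoint P = P" by (auto simp: P_def mat_adj)
  have PP: "P * P = P" by (simp add: P_def mat_ring KK mat_minus_self) (intro eq_matI, auto)
  have ZP: "Z * P = 0\<^sub>m q q" by (simp add: P_def mat_ring ZK mat_minus_self)
  have set_eq: "{x \<in> carrier_vec q. R *\<^sub>v x \<in> vec_space.col_space q T} =
    {x \<in> carrier_vec q. Z *\<^sub>v x = 0\<^sub>v q}"
  proof -
    have "R *\<^sub>v x \<in> vec_space.col_space q T \<longleftrightarrow> Z *\<^sub>v x = 0\<^sub>v q" if "x \<in> carrier_vec q" for x
      using mem_col_space_iff[OF T(1), of "R *\<^sub>v x"] that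
      by (simp add: Z_def mat_vec_assoc carrier_dim_vec del: carrier_vecD flip: N_def)
    thus ?thesis by blast
  qed
  have S: "S = R * P * R"
    unfolding S_def schur_short_def P_def K_def using set_eq
    by (simp add: orth_proj_kernel[of Z q] carrier_matI flip: R_def)
  show "S \<in> carrier_mat q q" by (auto simp: S)
  have SPR: "S = mat_adjoint (P * R) * (P * R)"
    unfolding S using mat_assoc[of P P R] by (simp add: mat_adj mat_ring PP)
  thus "nonneg_hermitian S" using nonneg_hermitian_gram by simp
  have SA: "S = A - R * K * R"
    unfolding S P_def by (simp add: mat_ring RR)
  have "A - S = R * K * R"
    unfolding SA by (intro eq_matI) auto
  also have "\<dots> = mat_adjoint (K * R) * (K * R)"
    using mat_assoc[of K K R] by (simp add: mat_adj mat_ring KK)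
  finally show "nonneg_hermitian (A - S)" using nonneg_hermitian_gram by simp
  have "N * S = (Z * P) * R" unfolding S Z_def by (simp add: mat_ring)
  hence NS: "N * S = 0\<^sub>m q q" by (simp add: ZP mat_ring)
  have hS: "mat_adjoint S = S" unfolding S by (simp add: mat_adj mat_ring)
  have [simp]: "dim_row S = q" "dim_col S = q" by (auto simp: S)
  have SN: "S * N = 0\<^sub>m q q" using arg_cong[OF NS, of mat_adjoint] by (simp add: mat_adj hS)
  show "S *\<^sub>v v = 0\<^sub>v q" if v: "dim_vec v = q" "T *\<^sub>v v = 0\<^sub>v q" for v
  proof -
    have "N *\<^sub>v v = v - moore_penrose T *\<^sub>v (T *\<^sub>v v)"
      unfolding N_def moore_penrose_hermitian(2)[OF T(2), symmetric]
      using v(1) by (simp add: minus_mat_vec mat_vec_assoc one_mat_vec)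
    hence "N *\<^sub>v v = v" using v by (auto intro!: eq_vecI simp: mult_zero_vec)
    hence "S *\<^sub>v v = S * N *\<^sub>v v" using v by (simp add: mat_vec_assoc)
    thus ?thesis using v by (simp add: SN)
  qed
  show "nonneg_hermitian (S - X)" if X: "nonneg_hermitian X" "X \<in> carrier_mat q q" "nonneg_hermitian (A - X)"
    and ker: "\<And>v. dim_vec v = q \<Longrightarrow> T *\<^sub>v v = 0\<^sub>v q \<Longrightarrow> X *\<^sub>v v = 0\<^sub>v q" for X
  proof -
    note [simp] = carrier_matD[OF X(2)] nonneg_hermitianD(2)[OF X(1)] nonneg_hermitianD(2)[OF A(1)]
    have XN: "X * N = 0\<^sub>m q q"
    proof (rule mat_eqI_vec)
      fix v :: "complex vec" assume "dim_vec v = dim_col (X * N)"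
      hence v: "dim_vec v = q" by simp
      have "T *\<^sub>v (N *\<^sub>v v) = T * N *\<^sub>v v" using v by (simp add: mat_vec_assoc)
      hence "T *\<^sub>v (N *\<^sub>v v) = 0\<^sub>v q" unfolding TN using v by simp
      from ker[OF _ this] v show "X * N *\<^sub>v v = 0\<^sub>m q q *\<^sub>v v" by (simp add: mat_vec_assoc)
    qed auto
    \<comment> \<open>The left factor \<open>N\<close> makes \<open>X * C\<close> vanish. Since
      \<open>R * N\<close> is the adjoint of \<open>Z\<close>, the product \<open>R * C\<close>
      collapses to \<open>K * R\<close> by a Penrose equation.\<close>
    define C where "C = N * mat_adjoint (moore_penrose Z) * R"
    have C [simp]: "dim_row C = q" "dim_col C = q" by (auto simp: C_def)
    have "X * C = (X * N) * (mat_adjoint (moore_penrose Z) * R)" by (simp add: C_def mat_ring)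
    hence XC: "X * C = 0\<^sub>m q q" by (simp add: XN mat_ring)
    have "R * C = (mat_adjoint Z * mat_adjoint (moore_penrose Z)) * R" by (simp add: C_def aZ mat_ring)
    hence RC: "R * C = K * R" by (simp add: moore_penrose K_def)
    define L where "L = 1\<^sub>m q - C"
    have L [simp]: "dim_row L = q" "dim_col L = q" by (auto simp: L_def)
    have "R * L = P * R" by (simp add: L_def P_def mat_ring RC)
    moreover have "mat_adjoint L * A * L = mat_adjoint (R * L) * (R * L)"
      using RR by (simp add: mat_adj mat_ring) (simp add: mat_assoc flip: RR)
    ultimately have LA: "mat_adjoint L * A * L = S" using SPR by simp
    have "X * L = X - 0\<^sub>m q q" by (simp add: L_def mat_ring XC)
    also have "\<dots> = X" by (intro eq_matI) auto
    finally have XL: "X * L = X" .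
    have "mat_adjoint L * X = X" using arg_cong[OF XL, of mat_adjoint] by (simp add: mat_adj)
    hence "mat_adjoint L * (A - X) * L = S - X"
      using LA by (simp add: mat_ring XL)
    moreover have "nonneg_hermitian (mat_adjoint L * (A - X) * L)"
      by (rule nonneg_hermitian_congruence[OF X(3)]) auto
    ultimately show ?thesis by simp
  qed
qed

section \<open>Block Hankel matrices\<close>

text \<open>The argument counts blocks instead of naming the last index, so the empty matrix at
  \<open>n = 0\<close> is available as the head of the levels 0 and 1.\<close>

definition block_hankel :: "nat \<Rightarrow> (nat \<Rightarrow> complex mat) \<Rightarrow> nat \<Rightarrow> complex mat" where
  "block_hankel q x n = mat (n * q) (n * q) (\<lambda>(i, j). x (i div q + j div q) $$ (i mod q, j mod q))"

lemma hankel_eq_block_hankel: "hankel q x n = block_hankel q x (Suc n)"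
  by (simp add: hankel_def block_hankel_def)

lemma dim_block_hankel [simp]: "dim_row (block_hankel q x n) = n * q" "dim_col (block_hankel q x n) = n * q"
  by (auto simp: block_hankel_def)

lemma dim_block_col [simp]: "dim_row (block_col q x n) = n * q" "dim_col (block_col q x n) = q"
  by (auto simp: block_col_def)

lemma dim_block_row [simp]: "dim_row (block_row q x n) = q" "dim_col (block_row q x n) = n * q"
  by (auto simp: block_row_def)

text \<open>For \<open>n = 0\<close> the product runs over an empty index set and is zero, in
  agreement with the case distinction in \<open>theta_def\<close>.\<close>

lemma theta_eq: "theta q x n = block_row q x n * moore_penrose (block_hankel q x n) * block_col q x n"
proof (cases n)
  case 0
  thus ?thesis by (intro eq_matI) (auto simp: theta_def scalar_prod_def)
next
  case (Suc k)
  thus ?thesis by (simp add: theta_def hankel_eq_block_hankel)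
qed

lemma dim_theta [simp]: "dim_row (theta q x n) = q" "dim_col (theta q x n) = q"
  by (auto simp: theta_eq)

lemma block_index_less:
  fixes i a n q :: nat
  assumes "i < n" "a < q" shows "i * q + a < n * q"
proof -
  have "i * q + a < Suc i * q" using assms by simp
  also have "\<dots> \<le> n * q" using assms by (intro mult_right_mono) auto
  finally show ?thesis .
qed

lemma sum_lessThan_add: "sum f {..<n + m} = sum f {..<n} + (\<Sum>b<m. f (n + b))" for f :: "nat \<Rightarrow> 'a :: comm_monoid_add"
  by (induction m) (auto simp: add.assoc)

lemma sum_lessThan_blocks:
  "sum f {..<n * q} = (\<Sum>k<n. \<Sum>b<q. f (k * q + b))" for f :: "nat \<Rightarrow> 'a :: comm_monoid_add"
  by (induction n) (auto simp: sum_lessThan_add add.commute[of q])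

text \<open>Row \<open>a\<close> of block row \<open>i\<close> of the infinite block Hankel matrix of \<open>x\<close>, applied to the vector
  \<open>u\<close> with \<open>n\<close> blocks; \<open>i\<close> may exceed \<open>n\<close>.\<close>

definition hankel_act :: "nat \<Rightarrow> (nat \<Rightarrow> complex mat) \<Rightarrow> nat \<Rightarrow> complex vec \<Rightarrow> nat \<Rightarrow> nat \<Rightarrow> complex" where
  "hankel_act q x n u i a = (\<Sum>k<n. \<Sum>b<q. x (i + k) $$ (a, b) * u $ (k * q + b))"

lemma block_hankel_mult_index:
  assumes "dim_vec u = n * q" "i < n" "a < q"
  shows "(block_hankel q x n *\<^sub>v u) $ (i * q + a) = hankel_act q x n u i a"
  using assms block_index_less[of i n a q]
  by (auto simp: mult_mat_vec_index sum_lessThan_blocks hankel_act_def block_hankel_def block_index_less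
      simp del: index_mult_mat_vec intro!: sum.cong)

lemma block_row_mult_index:
  assumes "dim_vec u = n * q" "a < q"
  shows "(block_row q x n *\<^sub>v u) $ a = hankel_act q x n u n a"
  using assms
  by (auto simp: mult_mat_vec_index sum_lessThan_blocks hankel_act_def block_row_def block_index_less
      simp del: index_mult_mat_vec intro!: sum.cong)

lemma block_hankel_form:
  assumes "dim_vec u = n * q"
  shows "(block_hankel q x n *\<^sub>v u) \<bullet>c u = (\<Sum>i<n. \<Sum>a<q. hankel_act q x n u i a * cnj (u $ (i * q + a)))"
  using assms
  by (simp add: cscalar_prod_sum sum_lessThan_blocks block_hankel_mult_index del: index_mult_mat_vec)

lemma vec_block_eqI:
  fixes n q :: nat
  assumes "dim_vec u = n * q" "dim_vec v = n * q"
    "\<And>i a. i < n \<Longrightarrow> a < q \<Longrightarrow> u $ (i * q + a) = v $ (i * q + a)"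
  shows "u = v"
proof (rule eq_vecI)
  fix c assume "c < dim_vec v"
  hence c: "c < n * q" using assms by simp
  hence "q > 0" by (cases q) auto
  with c have "c div q < n" "c mod q < q" "c div q * q + c mod q = c"
    by (auto simp: less_mult_imp_div_less)
  with assms(3)[of "c div q" "c mod q"] show "u $ c = v $ c" by simp
qed (use assms in auto)

lemma block_hankel_kernel_iff:
  assumes "dim_vec u = n * q"
  shows "block_hankel q x n *\<^sub>v u = 0\<^sub>v (n * q) \<longleftrightarrow> (\<forall>i<n. \<forall>a<q. hankel_act q x n u i a = 0)"
proof
  assume *: "block_hankel q x n *\<^sub>v u = 0\<^sub>v (n * q)"
  show "\<forall>i<n. \<forall>a<q. hankel_act q x n u i a = 0"
  proof (intro allI impI)
    fix i a assume "i < n" "a < q"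
    thus "hankel_act q x n u i a = 0"
      using block_hankel_mult_index[OF assms, of i a x] block_index_less[of i n a q] by (simp add: *)
  qed
next
  assume *: "\<forall>i<n. \<forall>a<q. hankel_act q x n u i a = 0"
  show "block_hankel q x n *\<^sub>v u = 0\<^sub>v (n * q)"
  proof (rule vec_block_eqI[of _ n q])
    fix i a assume "i < n" "a < q"
    thus "(block_hankel q x n *\<^sub>v u) $ (i * q + a) = 0\<^sub>v (n * q) $ (i * q + a)"
      using block_hankel_mult_index[OF assms, of i a x] block_index_less[of i n a q] *
      by (simp del: index_mult_mat_vec)
  qed auto
qed

lemma hankel_act_shifted:
  assumes "\<And>j. j \<le> i + n \<Longrightarrow> x j \<in> carrier_mat q q" "a < q"
  shows "hankel_act q (shifted \<alpha> x) n u i a = hankel_act q x n u (Suc i) a - \<alpha> * hankel_act q x n u i a"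
proof -
  have "shifted \<alpha> x (i + k) $$ (a, b) = x (Suc i + k) $$ (a, b) - \<alpha> * x (i + k) $$ (a, b)" if "k < n" "b < q" for k b
    using assms(1)[of "Suc (i + k)"] assms(1)[of "i + k"] that assms(2) by (simp add: shifted_def)
  hence "hankel_act q (shifted \<alpha> x) n u i a =
      (\<Sum>k<n. \<Sum>b<q. (x (Suc i + k) $$ (a, b) - \<alpha> * x (i + k) $$ (a, b)) * u $ (k * q + b))"
    unfolding hankel_act_def by (intro sum.cong) auto
  thus ?thesis
    by (simp add: hankel_act_def sum_distrib_left left_diff_distrib sum_subtractf mult.assoc)
qed

text \<open>Multiplication of the vector polynomial with coefficient blocks \<open>u\<close> by \<open>X - \<alpha>\<close>.\<close>

definition lin_mult :: "nat \<Rightarrow> real \<Rightarrow> nat \<Rightarrow> complex vec \<Rightarrow> complex vec" where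
  "lin_mult q \<alpha> n u = vec (Suc n * q)
     (\<lambda>c. (if c < q then 0 else u $ (c - q)) - \<alpha> * (if c < n * q then u $ c else 0))"

lemma dim_lin_mult [simp]: "dim_vec (lin_mult q \<alpha> n u) = Suc n * q"
  by (simp add: lin_mult_def)

lemma lin_mult_index:
  assumes "k < Suc n" "b < q"
  shows "lin_mult q \<alpha> n u $ (k * q + b) =
    (case k of 0 \<Rightarrow> 0 | Suc l \<Rightarrow> u $ (l * q + b)) - \<alpha> * (if k < n then u $ (k * q + b) else 0)"
proof -
  have "k * q + b < n * q \<longleftrightarrow> k < n"
  proof
    assume "k * q + b < n * q"
    hence "k * q < n * q" by linarith
    thus "k < n" by simp
  qed (rule block_index_less[OF _ assms(2)])
  thus ?thesis using assms block_index_less[OF assms] by (auto simp: lin_mult_def split: nat.split)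
qed

text \<open>The coefficients \<open>g\<close> are arbitrary because the identity serves twice: for
  rows of a Hankel matrix and for the evaluation of polynomials.\<close>

lemma sum_lin_mult:
  "(\<Sum>k<Suc n. \<Sum>b<q. g k b * lin_mult q \<alpha> n u $ (k * q + b)) =
   (\<Sum>k<n. \<Sum>b<q. g (Suc k) b * u $ (k * q + b)) - \<alpha> * (\<Sum>k<n. \<Sum>b<q. g k b * u $ (k * q + b))"
proof -
  have "(\<Sum>k<Suc n. \<Sum>b<q. g k b * lin_mult q \<alpha> n u $ (k * q + b)) =
    (\<Sum>k<Suc n. \<Sum>b<q. g k b * (case k of 0 \<Rightarrow> 0 | Suc l \<Rightarrow> u $ (l * q + b))) -
    (\<Sum>k<Suc n. \<Sum>b<q. g k b * (\<alpha> * (if k < n then u $ (k * q + b) else 0)))"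
    by (simp add: lin_mult_index right_diff_distrib sum_subtractf del: sum.lessThan_Suc)
  also have "(\<Sum>k<Suc n. \<Sum>b<q. g k b * (case k of 0 \<Rightarrow> 0 | Suc l \<Rightarrow> u $ (l * q + b))) =
    (\<Sum>k<n. \<Sum>b<q. g (Suc k) b * u $ (k * q + b))"
    by (subst sum.lessThan_Suc_shift) simp
  also have "(\<Sum>k<Suc n. \<Sum>b<q. g k b * (\<alpha> * (if k < n then u $ (k * q + b) else 0))) =
    \<alpha> * (\<Sum>k<n. \<Sum>b<q. g k b * u $ (k * q + b))"
    by (simp add: sum_distrib_left mult_ac)
  finally show ?thesis .
qed

text \<open>The bridge between the two kinds of levels: multiplication by X - \<alpha> trades the
  shifted sequence for the plain one at the cost of one more block.\<close>

lemma hankel_act_lin_mult: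
  assumes "\<And>j. j \<le> i + n \<Longrightarrow> x j \<in> carrier_mat q q" "a < q"
  shows "hankel_act q x (Suc n) (lin_mult q \<alpha> n u) i a = hankel_act q (shifted \<alpha> x) n u i a"
proof -
  have "hankel_act q (shifted \<alpha> x) n u i a = hankel_act q x n u (Suc i) a - \<alpha> * hankel_act q x n u i a"
    by (rule hankel_act_shifted) (use assms in auto)
  thus ?thesis unfolding hankel_act_def[of q x] sum_lin_mult by simp
qed

text \<open>\<open>Q\<^sub>m\<close> is the Schur complement of the upper left \<open>m div 2\<close> blocks in \<open>level_mat\<close>.\<close>

definition level_seq :: "real \<Rightarrow> nat \<Rightarrow> (nat \<Rightarrow> complex mat) \<Rightarrow> nat \<Rightarrow> complex mat" where
  "level_seq \<alpha> m s = (if even m then s else shifted \<alpha> s)"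

definition level_mat :: "nat \<Rightarrow> real \<Rightarrow> nat \<Rightarrow> (nat \<Rightarrow> complex mat) \<Rightarrow> complex mat" where
  "level_mat q \<alpha> m s = block_hankel q (level_seq \<alpha> m s) (Suc (m div 2))"

abbreviation level_head :: "nat \<Rightarrow> real \<Rightarrow> nat \<Rightarrow> (nat \<Rightarrow> complex mat) \<Rightarrow> complex mat" where
  "level_head q \<alpha> m s \<equiv> block_hankel q (level_seq \<alpha> m s) (m div 2)"

abbreviation level_col :: "nat \<Rightarrow> real \<Rightarrow> nat \<Rightarrow> (nat \<Rightarrow> complex mat) \<Rightarrow> complex mat" where
  "level_col q \<alpha> m s \<equiv> block_col q (level_seq \<alpha> m s) (m div 2)"

lemma dim_level_mat [simp]:
  "dim_row (level_mat q \<alpha> m s) = Suc (m div 2) * q" "dim_col (level_mat q \<alpha> m s) = Suc (m div 2) * q"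
  by (auto simp: level_mat_def)

text \<open>The two conditions of the definition concern the levels m and m - 1; the parity of m
  decides which of them is the shifted Hankel matrix.\<close>

lemma stieltjes_seqs_iff:
  "s \<in> stieltjes_seqs q \<alpha> m \<longleftrightarrow> s \<in> {..m} \<rightarrow>\<^sub>E carrier_mat q q \<and>
     nonneg_hermitian (level_mat q \<alpha> m s) \<and> (m > 0 \<longrightarrow> nonneg_hermitian (level_mat q \<alpha> (m - 1) s))"
proof (cases "even m")
  case True
  then obtain n where "m = 2 * n" by auto
  thus ?thesis by (cases n) (auto simp: stieltjes_seqs_def level_mat_def level_seq_def hankel_eq_block_hankel)
next
  case False
  then obtain n where "m = 2 * n + 1" by (auto elim: oddE)
  thus ?thesis by (auto simp: stieltjes_seqs_def level_mat_def level_seq_def hankel_eq_block_hankel)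
qed

section \<open>Hermitian sequences and the entries on which each matrix depends\<close>

text \<open>Weaker than membership in \<open>stieltjes_seqs\<close>, so that modified sequences can
  be handled before their levels are known to be non-negative.\<close>

definition mat_seq :: "nat \<Rightarrow> nat \<Rightarrow> (nat \<Rightarrow> complex mat) \<Rightarrow> bool" where
  "mat_seq q m s \<longleftrightarrow> (\<forall>j\<le>m. s j \<in> carrier_mat q q \<and> mat_adjoint (s j) = s j)"

lemma level_seq_mat_seq:
  assumes "mat_seq q m s" "j \<le> 2 * (m div 2)"
  shows "level_seq \<alpha> m s j \<in> carrier_mat q q" "mat_adjoint (level_seq \<alpha> m s j) = level_seq \<alpha> m s j"
proof -
  have *: "level_seq \<alpha> m s j \<in> carrier_mat q q \<and> mat_adjoint (level_seq \<alpha> m s j) = level_seq \<alpha> m s j"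
  proof (cases "even m")
    case True
    thus ?thesis using assms by (auto simp: mat_seq_def level_seq_def)
  next
    case False
    hence "Suc j \<le> m" "j \<le> m" using assms(2) by presburger+
    hence "s (Suc j) \<in> carrier_mat q q" "s j \<in> carrier_mat q q" "mat_adjoint (s (Suc j)) = s (Suc j)" "mat_adjoint (s j) = s j"
      using assms(1) by (auto simp: mat_seq_def)
    thus ?thesis using False by (auto simp: level_seq_def shifted_def mat_adj)
  qed
  thus "level_seq \<alpha> m s j \<in> carrier_mat q q" "mat_adjoint (level_seq \<alpha> m s j) = level_seq \<alpha> m s j" by auto
qed

lemma block_hankel_Suc:
  assumes "x (2 * n) \<in> carrier_mat q q"
  shows "block_hankel q x (Suc n) = four_block_mat (block_hankel q x n) (block_col q x n) (block_row q x n) (x (2 * n))"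
proof (rule eq_matI, goal_cases)
  case (1 i j)
  hence ij: "i < n * q + q" "j < n * q + q" using assms by auto
  have hi: "i div q = n" "i mod q = i - n * q" if "\<not> i < n * q" "i < n * q + q" for i
  proof -
    from that obtain a where a: "i = n * q + a" "a < q" by (metis add_less_cancel_left le_Suc_ex not_less)
    thus "i div q = n" "i mod q = i - n * q" by auto
  qed
  show ?case using ij assms hi[of i] hi[of j]
    by (auto simp: block_hankel_def block_col_def block_row_def mult_2 add.commute)
qed (use assms in auto)

lemma adjoint_block_col:
  assumes "\<And>j. j < 2 * n \<Longrightarrow> x j \<in> carrier_mat q q \<and> mat_adjoint (x j) = x j"
  shows "mat_adjoint (block_col q x n) = block_row q x n"
proof (rule eq_matI, goal_cases)
  case (1 i j)
  hence ij: "i < q" "j < n * q" by auto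
  hence "n + j div q < 2 * n" by (simp add: less_mult_imp_div_less mult_2)
  with assms have c: "x (n + j div q) \<in> carrier_mat q q" "mat_adjoint (x (n + j div q)) = x (n + j div q)" by auto
  have "j mod q < q" using ij by simp
  with c(1) ij have "cnj (x (n + j div q) $$ (j mod q, i)) = mat_adjoint (x (n + j div q)) $$ (i, j mod q)" by simp
  thus ?case using ij c(2) by (simp add: block_col_def block_row_def)
qed auto

lemma adjoint_block_hankel:
  assumes "\<And>j. j + 2 \<le> 2 * n \<Longrightarrow> x j \<in> carrier_mat q q \<and> mat_adjoint (x j) = x j"
  shows "mat_adjoint (block_hankel q x n) = block_hankel q x n"
proof (rule eq_matI, goal_cases)
  case (1 i j)
  hence ij: "i < n * q" "j < n * q" by auto
  hence q: "q > 0" by (cases q) auto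
  have "i div q < n" "j div q < n" using ij by (auto simp: less_mult_imp_div_less)
  hence "i div q + j div q + 2 \<le> 2 * n" by simp
  with assms have c: "x (i div q + j div q) \<in> carrier_mat q q" "mat_adjoint (x (i div q + j div q)) = x (i div q + j div q)" by auto
  have "cnj (x (i div q + j div q) $$ (j mod q, i mod q)) = mat_adjoint (x (i div q + j div q)) $$ (i mod q, j mod q)"
    using c(1) q by simp
  thus ?case using ij c(2) by (simp add: block_hankel_def add.commute)
qed auto

lemma level_block:
  assumes "mat_seq q m s"
  shows "hermitian_block (m div 2 * q) q (level_head q \<alpha> m s)
    (level_col q \<alpha> m s) (level_seq \<alpha> m s (2 * (m div 2))) (level_mat q \<alpha> m s)"
proof
  note L = level_seq_mat_seq[OF assms]
  show "mat_adjoint (level_head q \<alpha> m s) = level_head q \<alpha> m s"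
    by (rule adjoint_block_hankel) (use L in auto)
  have "mat_adjoint (level_col q \<alpha> m s) = block_row q (level_seq \<alpha> m s) (m div 2)"
    by (rule adjoint_block_col) (use L in auto)
  thus "level_mat q \<alpha> m s = four_block_mat (level_head q \<alpha> m s) (level_col q \<alpha> m s)
      (mat_adjoint (level_col q \<alpha> m s)) (level_seq \<alpha> m s (2 * (m div 2)))"
    unfolding level_mat_def using block_hankel_Suc[OF L(1)] by simp
qed (use level_seq_mat_seq[OF assms] in auto)

text \<open>The first form gives access to the block algebra. The second shows that the last entry
  enters only as a summand, since \<open>lower_bd\<close> uses earlier entries alone.\<close>

lemma Qmat_eq:
  assumes "mat_seq q m s"
  shows "Qmat q \<alpha> s m = block_schur (level_head q \<alpha> m s)
    (level_col q \<alpha> m s) (level_seq \<alpha> m s (2 * (m div 2)))"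
    "Qmat q \<alpha> s m = s m - lower_bd q \<alpha> s m"
proof -
  have "mat_adjoint (level_col q \<alpha> m s) = block_row q (level_seq \<alpha> m s) (m div 2)"
    by (rule adjoint_block_col) (use level_seq_mat_seq[OF assms] in auto)
  thus "Qmat q \<alpha> s m = block_schur (level_head q \<alpha> m s)
    (level_col q \<alpha> m s) (level_seq \<alpha> m s (2 * (m div 2)))"
    unfolding block_schur_def Qmat_def theta_eq level_seq_def
    by (cases "even m") (simp_all flip: div_mult_mod_eq)
  have "s m \<in> carrier_mat q q" "s (m - 1) \<in> carrier_mat q q" using assms by (auto simp: mat_seq_def)
  thus "Qmat q \<alpha> s m = s m - lower_bd q \<alpha> s m"
    unfolding Qmat_def lower_bd_def
    by (cases "even m") (auto intro!: eq_matI simp: shifted_def odd_pos)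
qed

lemma block_hankel_index:
  "i < n \<Longrightarrow> k < n \<Longrightarrow> a < q \<Longrightarrow> b < q \<Longrightarrow> block_hankel q x n $$ (i * q + a, k * q + b) = x (i + k) $$ (a, b)"
  by (simp add: block_hankel_def block_index_less)

text \<open>Every index up to 2 n is a sum i + k of two block indices, and the transposed positions
  (i, k) and (k, i) hold the same block.\<close>

lemma block_hankel_hermitian_imp:
  assumes "mat_adjoint (block_hankel q x (Suc n)) = block_hankel q x (Suc n)" "j \<le> 2 * n" "x j \<in> carrier_mat q q"
  shows "mat_adjoint (x j) = x j"
proof (rule eq_matI, goal_cases)
  case (1 a b)
  note [simp] = carrier_matD[OF assms(3)]
  have ab: "a < q" "b < q" using 1 by auto
  define i where "i = min j n"
  define k where "k = j - i"
  have ik: "i < Suc n" "k < Suc n" "i + k = j" "k + i = j" using assms(2) by (auto simp: i_def k_def)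
  have "block_hankel q x (Suc n) $$ (i * q + a, k * q + b) = cnj (block_hankel q x (Suc n) $$ (k * q + b, i * q + a))"
    using block_index_less[OF ik(1) ab(1)] block_index_less[OF ik(2) ab(2)]
    by (subst assms(1)[symmetric]) (simp del: mult_Suc)
  hence "x j $$ (a, b) = cnj (x j $$ (b, a))"
    using block_hankel_index[OF ik(1,2) ab, of x] block_hankel_index[OF ik(2,1) ab(2,1), of x] ik by simp
  thus ?case using ab by simp
qed (use assms in auto)

lemma block_hankel_cong:
  assumes "\<And>j. j + 2 \<le> 2 * n \<Longrightarrow> x j = y j"
  shows "block_hankel q x n = block_hankel q y n"
proof (rule eq_matI, goal_cases)
  case (1 i j)
  hence ij: "i < n * q" "j < n * q" by auto
  hence "i div q < n" "j div q < n" by (auto simp: less_mult_imp_div_less)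
  hence "x (i div q + j div q) = y (i div q + j div q)" by (intro assms) simp
  thus ?case using ij by (simp add: block_hankel_def)
qed auto

lemma theta_cong:
  assumes "\<And>j. j < 2 * n \<Longrightarrow> x j = y j"
  shows "theta q x n = theta q y n"
proof -
  have *: "n + j div q < 2 * n" if "j < n * q" for j using that by (simp add: less_mult_imp_div_less mult_2)
  have "block_row q x n = block_row q y n"
    by (rule eq_matI) (auto simp: block_row_def assms *)
  moreover have "block_col q x n = block_col q y n"
    by (rule eq_matI) (auto simp: block_col_def assms *)
  moreover have "block_hankel q x n = block_hankel q y n" by (rule block_hankel_cong) (use assms in auto)
  ultimately show ?thesis by (simp add: theta_eq)
qed

lemma adjoint_theta:
  assumes "\<And>j. j < 2 * n \<Longrightarrow> x j \<in> carrier_mat q q \<and> mat_adjoint (x j) = x j"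
  shows "mat_adjoint (theta q x n) = theta q x n"
proof -
  have h: "mat_adjoint (block_hankel q x n) = block_hankel q x n" by (rule adjoint_block_hankel) (use assms in auto)
  have "block_row q x n = mat_adjoint (block_col q x n)" by (rule adjoint_block_col[symmetric]) (use assms in auto)
  thus ?thesis by (simp add: theta_eq mat_adj mat_ring moore_penrose_hermitian[OF h])
qed

lemma level_seq_cong:
  assumes "\<And>i. i \<le> m \<Longrightarrow> s i = t i" "j \<le> 2 * (m div 2)"
  shows "level_seq \<alpha> m s j = level_seq \<alpha> m t j"
proof -
  have "odd m \<Longrightarrow> Suc j \<le> m" "j \<le> m" using assms(2) by presburger+
  thus ?thesis using assms(1) by (auto simp: level_seq_def shifted_def)
qed

lemma level_mat_cong:
  assumes "\<And>i. i \<le> m \<Longrightarrow> s i = t i"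
  shows "level_mat q \<alpha> m s = level_mat q \<alpha> m t"
  unfolding level_mat_def by (rule block_hankel_cong) (use level_seq_cong[OF assms] in auto)

lemma lower_bd_cong:
  assumes "\<And>i. i < m \<Longrightarrow> s i = t i"
  shows "lower_bd q \<alpha> s m = lower_bd q \<alpha> t m"
proof (cases "even m")
  case True
  hence "theta q s (m div 2) = theta q t (m div 2)" by (intro theta_cong assms) auto
  thus ?thesis using True by (simp add: lower_bd_def)
next
  case False
  hence "theta q (shifted \<alpha> s) (m div 2) = theta q (shifted \<alpha> t) (m div 2)"
    by (intro theta_cong) (auto simp: shifted_def assms elim!: oddE)
  thus ?thesis using False assms[of "m - 1"] by (simp add: lower_bd_def odd_pos)
qed

lemma lower_bd_mat_seq:
  assumes "mat_seq q m t"
  shows "lower_bd q \<alpha> t (Suc m) \<in> carrier_mat q q" "mat_adjoint (lower_bd q \<alpha> t (Suc m)) = lower_bd q \<alpha> t (Suc m)"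
proof -
  have t: "t j \<in> carrier_mat q q" "mat_adjoint (t j) = t j" if "j \<le> m" for j
    using assms that by (auto simp: mat_seq_def)
  show "lower_bd q \<alpha> t (Suc m) \<in> carrier_mat q q" using t(1)[of m] by (auto simp: lower_bd_def)
  show "mat_adjoint (lower_bd q \<alpha> t (Suc m)) = lower_bd q \<alpha> t (Suc m)"
  proof (cases "even (Suc m)")
    case True
    hence "mat_adjoint (theta q t (Suc m div 2)) = theta q t (Suc m div 2)"
      by (intro adjoint_theta) (auto intro!: t)
    thus ?thesis using True by (simp add: lower_bd_def)
  next
    case False
    have "mat_adjoint (theta q (shifted \<alpha> t) (Suc m div 2)) = theta q (shifted \<alpha> t) (Suc m div 2)"
    proof (rule adjoint_theta)
      fix j assume "j < 2 * (Suc m div 2)"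
      hence "Suc j \<le> m" "j \<le> m" using False by presburger+
      from t[OF this(1)] t[OF this(2)]
      show "shifted \<alpha> t j \<in> carrier_mat q q \<and> mat_adjoint (shifted \<alpha> t j) = shifted \<alpha> t j"
        by (auto simp: shifted_def mat_adj)
    qed
    thus ?thesis using False t[of m] by (simp add: lower_bd_def mat_adj)
  qed
qed

text \<open>For odd m the last entry occurs only in the shifted Hankel matrix; its symmetry follows
  after adding back \<alpha> times the previous entry, which is already known to be
  Hermitian.\<close>

lemma mat_seq_stieltjes:
  assumes "s \<in> stieltjes_seqs q \<alpha> m"
  shows "mat_seq q m s"
proof -
  have s: "s j \<in> carrier_mat q q" if "j \<le> m" for j
    using assms that by (auto simp: stieltjes_seqs_iff)
  have even_case: "mat_adjoint (s j) = s j" if "nonneg_hermitian (block_hankel q s (Suc n))" "j \<le> 2 * n" "j \<le> m" for n j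
    using block_hankel_hermitian_imp[OF nonneg_hermitianD(2)[OF that(1)] that(2) s[OF that(3)]] .
  have "mat_adjoint (s j) = s j" if j: "j \<le> m" for j
  proof (cases "even m")
    case True
    have "nonneg_hermitian (block_hankel q s (Suc (m div 2)))"
      using assms True by (simp add: stieltjes_seqs_iff level_mat_def level_seq_def)
    from even_case[OF this _ j] show ?thesis using True j by simp
  next
    case False
    hence m0: "m > 0" by (simp add: odd_pos)
    hence n: "nonneg_hermitian (level_mat q \<alpha> (m - 1) s)" "nonneg_hermitian (level_mat q \<alpha> m s)"
      using assms by (auto simp: stieltjes_seqs_iff)
    have n1: "nonneg_hermitian (block_hankel q s (Suc ((m - 1) div 2)))"
      using n(1) False by (simp add: level_mat_def level_seq_def)
    have low: "mat_adjoint (s j) = s j" if "j < m" for j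
      using even_case[OF n1, of j] that False by auto
    show ?thesis
    proof (cases "j = m")
      case True
      have "nonneg_hermitian (block_hankel q (shifted \<alpha> s) (Suc (m div 2)))"
        using n(2) False by (simp add: level_mat_def level_seq_def)
      moreover have "shifted \<alpha> s (m - 1) \<in> carrier_mat q q"
        using s[of m] s[of "m - 1"] m0 by (auto simp: shifted_def)
      moreover have "m - 1 \<le> 2 * (m div 2)" using False by presburger
      ultimately have "mat_adjoint (shifted \<alpha> s (m - 1)) = shifted \<alpha> s (m - 1)"
        using block_hankel_hermitian_imp nonneg_hermitianD(2) by blast
      hence "mat_adjoint (shifted \<alpha> s (m - 1)) + \<alpha> \<cdot>\<^sub>m s (m - 1) = shifted \<alpha> s (m - 1) + \<alpha> \<cdot>\<^sub>m s (m - 1)" by simp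
      moreover have "shifted \<alpha> s (m - 1) + \<alpha> \<cdot>\<^sub>m s (m - 1) = s m"
        using s[of m] s[of "m - 1"] m0 by (intro eq_matI) (auto simp: shifted_def)
      moreover have "mat_adjoint (shifted \<alpha> s (m - 1)) + \<alpha> \<cdot>\<^sub>m s (m - 1) = mat_adjoint (s m)"
      proof -
        have c: "s (m - 1) \<in> carrier_mat q q" "s m \<in> carrier_mat q q" using s by auto
        have "mat_adjoint (shifted \<alpha> s (m - 1)) = - \<alpha> \<cdot>\<^sub>m s (m - 1) + mat_adjoint (s m)"
          using c m0 low[of "m - 1"] by (simp add: shifted_def mat_adj)
        thus ?thesis using c by (intro eq_matI) auto
      qed
      ultimately show ?thesis using True by simp
    qed (use low j in auto)
  qed
  thus ?thesis using s by (auto simp: mat_seq_def)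
qed

section \<open>Null vectors of a level and their leading coefficients\<close>

lemma vec_last_append [simp]: "dim_vec v = q \<Longrightarrow> vec_last (u @\<^sub>v v) q = v"
  by (intro eq_vecI) (auto simp: vec_last_def)

lemma split_last_block:
  fixes u :: "complex vec"
  assumes "dim_vec u = Suc n * q"
  shows "vec_first u (n * q) @\<^sub>v vec_last u q = u"
  using assms by (intro vec_first_last_append carrier_vecI) auto

context
  fixes q m :: nat and \<alpha> :: real and t :: "nat \<Rightarrow> complex mat"
  assumes ms: "mat_seq q m t"
begin

interpretation B: hermitian_block "m div 2 * q" q "level_head q \<alpha> m t"
  "level_col q \<alpha> m t" "level_seq \<alpha> m t (2 * (m div 2))" "level_mat q \<alpha> m t"
  by (rule level_block[OF ms])

lemma Qmat_B: "Qmat q \<alpha> t m = B.S"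
  unfolding B.S_def using Qmat_eq(1)[OF ms] by simp

lemma Qmat_carrier: "Qmat q \<alpha> t m \<in> carrier_mat q q" "mat_adjoint (Qmat q \<alpha> t m) = Qmat q \<alpha> t m"
  unfolding Qmat_B by (auto simp: B.adjoint_S)

lemma Qmat_nonneg: "nonneg_hermitian (level_mat q \<alpha> m t) \<Longrightarrow> nonneg_hermitian (Qmat q \<alpha> t m)"
  unfolding Qmat_B by (rule B.nonneg_M_imp(3))

text \<open>With \<open>u\<close> read as the coefficients of a vector polynomial,
  \<open>vec_last u q\<close> is the leading one. In this form kernels are moved from one level to
  the next.\<close>

lemma Qmat_kernel:
  assumes "nonneg_hermitian (level_mat q \<alpha> m t)" "dim_vec v = q"
  shows "Qmat q \<alpha> t m *\<^sub>v v = 0\<^sub>v q \<longleftrightarrow>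
    (\<exists>u. dim_vec u = Suc (m div 2) * q \<and> vec_last u q = v \<and> level_mat q \<alpha> m t *\<^sub>v u = 0\<^sub>v (Suc (m div 2) * q))"
proof
  assume "Qmat q \<alpha> t m *\<^sub>v v = 0\<^sub>v q"
  then obtain u where "dim_vec u = m div 2 * q" "level_mat q \<alpha> m t *\<^sub>v (u @\<^sub>v v) = 0\<^sub>v (m div 2 * q + q)"
    using B.nonneg_M_imp(5)[OF assms(1), of v] assms(2) unfolding Qmat_B by auto
  thus "\<exists>u. dim_vec u = Suc (m div 2) * q \<and> vec_last u q = v \<and> level_mat q \<alpha> m t *\<^sub>v u = 0\<^sub>v (Suc (m div 2) * q)"
    using assms(2) by (intro exI[of _ "u @\<^sub>v v"]) (auto simp: add.commute)
next
  assume "\<exists>u. dim_vec u = Suc (m div 2) * q \<and> vec_last u q = v \<and> level_mat q \<alpha> m t *\<^sub>v u = 0\<^sub>v (Suc (m div 2) * q)"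
  then obtain u where u: "dim_vec u = Suc (m div 2) * q" "vec_last u q = v"
    "level_mat q \<alpha> m t *\<^sub>v u = 0\<^sub>v (Suc (m div 2) * q)" by blast
  have "level_mat q \<alpha> m t *\<^sub>v (vec_first u (m div 2 * q) @\<^sub>v v) = 0\<^sub>v (m div 2 * q + q)"
    using split_last_block[OF u(1)] u(2,3) by (simp add: add.commute)
  thus "Qmat q \<alpha> t m *\<^sub>v v = 0\<^sub>v q"
    using B.nonneg_M_imp(5)[OF assms] unfolding Qmat_B by auto
qed

text \<open>The vanishing upper block rows eliminate the lower coefficients, as in
  \<open>last_block\<close>, so the last block row sees only the leading one.\<close>

lemma hankel_act_last:
  assumes r: "level_head q \<alpha> m t * B.W = level_col q \<alpha> m t"
    and u: "dim_vec u = Suc (m div 2) * q"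
    and z: "\<And>i a. i < m div 2 \<Longrightarrow> a < q \<Longrightarrow> hankel_act q (level_seq \<alpha> m t) (Suc (m div 2)) u i a = 0"
    and a: "a < q"
  shows "hankel_act q (level_seq \<alpha> m t) (Suc (m div 2)) u (m div 2) a = (Qmat q \<alpha> t m *\<^sub>v vec_last u q) $ a"
proof -
  define n where "n = m div 2"
  define x where "x = level_seq \<alpha> m t"
  define u1 u2 where "u1 = vec_first u (n * q)" and "u2 = vec_last u q"
  have [simp]: "dim_vec u1 = n * q" "dim_vec u2 = q" by (auto simp: u1_def u2_def)
  have uu: "u = u1 @\<^sub>v u2" using split_last_block[OF u] by (simp add: u1_def u2_def n_def)
  let ?top = "block_hankel q x n *\<^sub>v u1 + block_col q x n *\<^sub>v u2"
  let ?bot = "mat_adjoint (block_col q x n) *\<^sub>v u1 + x (2 * n) *\<^sub>v u2"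
  have dims: "dim_row (x (2 * n)) = q" using B.dims(5) by (simp add: x_def n_def)
  have Mu: "level_mat q \<alpha> m t *\<^sub>v u = ?top @\<^sub>v ?bot"
    unfolding uu x_def n_def by (rule B.M_mult_append) (auto simp: n_def[symmetric])
  have lev: "level_mat q \<alpha> m t = block_hankel q x (Suc n)" by (simp add: level_mat_def x_def n_def)
  have idx: "(?top @\<^sub>v ?bot) $ (i * q + b) = hankel_act q x (Suc n) u i b" if "i < Suc n" "b < q" for i b
    using block_hankel_mult_index[of u "Suc n" q i b x] that u Mu lev by (simp add: n_def)
  have "?top = 0\<^sub>v (n * q)"
  proof (rule vec_block_eqI[of _ n q])
    fix i b assume ib: "i < n" "b < q"
    have "hankel_act q x (Suc n) u i b = 0" using z[of i b] ib by (simp add: x_def n_def)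
    thus "?top $ (i * q + b) = 0\<^sub>v (n * q) $ (i * q + b)"
      using idx[of i b] ib block_index_less[OF ib] by (simp add: dims del: index_mult_mat_vec)
  qed auto
  hence "?bot = B.S *\<^sub>v u2"
    unfolding x_def n_def by (intro B.last_block[OF r]) (auto simp: n_def[symmetric])
  moreover have "(?top @\<^sub>v ?bot) $ (n * q + a) = ?bot $ a" using a dims by simp
  ultimately show ?thesis using idx[of n a] a unfolding Qmat_B by (simp add: x_def n_def u2_def)
qed

lemma level_range: "nonneg_hermitian (level_mat q \<alpha> m t) \<Longrightarrow>
    level_head q \<alpha> m t * B.W = level_col q \<alpha> m t"
  by (rule B.nonneg_M_imp(2))

end

section \<open>Extension of sequences\<close>

text \<open>Levels at distance two have the same parity, hence use the same sequence, and the upper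
  one has exactly one block more.\<close>

lemma block_hankel_level_seq_Suc:
  assumes "m > 0"
  shows "level_head q \<alpha> (Suc m) t = level_mat q \<alpha> (m - 1) t" "Suc m div 2 = Suc ((m - 1) div 2)"
proof -
  show *: "Suc m div 2 = Suc ((m - 1) div 2)" using assms by presburger
  have "level_seq \<alpha> (Suc m) t = level_seq \<alpha> (m - 1) t" using assms by (auto simp: level_seq_def)
  thus "level_head q \<alpha> (Suc m) t = level_mat q \<alpha> (m - 1) t"
    by (simp add: level_mat_def *)
qed

text \<open>The factor X - \<alpha> is monic.\<close>

lemma vec_last_lin_mult:
  assumes "n > 0" "dim_vec u = n * q"
  shows "vec_last (lin_mult q \<alpha> n u) q = vec_last u q"
proof (rule eq_vecI)
  fix b assume "b < dim_vec (vec_last u q)"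
  hence b: "b < q" by simp
  obtain k where k: "n = Suc k" using assms(1) gr0_implies_Suc by blast
  have "vec_last (lin_mult q \<alpha> n u) q $ b = lin_mult q \<alpha> n u $ (n * q + b)" using b by (simp add: vec_last_def)
  also have "\<dots> = u $ (k * q + b)" using b k by (simp add: lin_mult_index del: mult_Suc)
  also have "\<dots> = vec_last u q $ b" using b k assms(2) by (simp add: vec_last_def)
  finally show "vec_last (lin_mult q \<alpha> n u) q $ b = vec_last u q $ b" .
qed simp

lemma mat_seq_mono: "mat_seq q m t \<Longrightarrow> k \<le> m \<Longrightarrow> mat_seq q k t"
  by (auto simp: mat_seq_def)

text \<open>If a vector polynomial \<open>u\<close> is in the kernel at level \<open>m - 1\<close>, then its leading
  coefficient is in the kernel of \<open>Q\<^sub>m\<^sub>-\<^sub>1\<close>, hence of \<open>Q\<^sub>m\<close>; so \<open>u\<close> (respectively \<open>(X - \<alpha>) u\<close>) is in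
  the kernel at level \<open>m\<close>, which supplies the missing equation at level \<open>m + 1\<close>.\<close>

lemma kernel_propagation:
  assumes ms: "mat_seq q m t" and m: "m > 0"
    and psd: "nonneg_hermitian (level_mat q \<alpha> m t)" "nonneg_hermitian (level_mat q \<alpha> (m - 1) t)"
    and ker: "\<And>v. dim_vec v = q \<Longrightarrow> Qmat q \<alpha> t (m - 1) *\<^sub>v v = 0\<^sub>v q \<Longrightarrow> Qmat q \<alpha> t m *\<^sub>v v = 0\<^sub>v q"
    and u: "dim_vec u = Suc m div 2 * q" "level_mat q \<alpha> (m - 1) t *\<^sub>v u = 0\<^sub>v (Suc m div 2 * q)"
    and a: "a < q"
  shows "hankel_act q (level_seq \<alpha> (Suc m) t) (Suc m div 2) u (Suc m div 2) a = 0"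
proof -
  define v where "v = vec_last u q"
  have v: "dim_vec v = q" by (simp add: v_def)
  note eq = block_hankel_level_seq_Suc[OF m]
  have "Qmat q \<alpha> t (m - 1) *\<^sub>v v = 0\<^sub>v q"
    using Qmat_kernel[OF mat_seq_mono[OF ms] psd(2) v] u unfolding eq(2) v_def by auto
  from ker[OF v this] have Qv: "Qmat q \<alpha> t m *\<^sub>v v = 0\<^sub>v q" .
  have zero: "hankel_act q (level_seq \<alpha> (Suc m) t) (Suc m div 2) u i b = 0" if "i < Suc m div 2" "b < q" for i b
    using u(2) block_hankel_kernel_iff[OF u(1), of "level_seq \<alpha> (Suc m) t"] that by (simp only: eq(1)) blast
  have t: "t j \<in> carrier_mat q q" if "j \<le> m" for j using ms that by (auto simp: mat_seq_def)
  note last = hankel_act_last[OF ms level_range[OF ms psd(1)]]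
  show ?thesis
  proof (cases "even m")
    case True
    define n where "n = m div 2"
    have mn: "m = 2 * n" "n > 0" "Suc m div 2 = n" "m div 2 = n" using True m by (auto simp: n_def)
    have du: "dim_vec u = n * q" using u(1) mn by simp
    have ls: "level_seq \<alpha> (Suc m) t = shifted \<alpha> t" "level_seq \<alpha> m t = t" using True by (auto simp: level_seq_def)
    define r where "r = lin_mult q \<alpha> n u"
    have act_r: "hankel_act q t (Suc n) r i b = hankel_act q (shifted \<alpha> t) n u i b" if "i \<le> n" "b < q" for i b
      unfolding r_def by (rule hankel_act_lin_mult) (use that t mn in auto)
    have "vec_last r q = v"
      unfolding r_def v_def by (rule vec_last_lin_mult[OF mn(2) du])
    moreover have "hankel_act q (level_seq \<alpha> m t) (Suc (m div 2)) r (m div 2) a = (Qmat q \<alpha> t m *\<^sub>v vec_last r q) $ a"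
    proof (rule last[OF _ _ a])
      show "dim_vec r = Suc (m div 2) * q" by (simp add: r_def mn(4))
      show "hankel_act q (level_seq \<alpha> m t) (Suc (m div 2)) r i b = 0" if "i < m div 2" "b < q" for i b
        using zero[of i b] that act_r[of i b] by (simp add: ls mn(3,4))
    qed
    ultimately show ?thesis using act_r[of n a] a Qv by (simp add: ls mn(3,4))
  next
    case False
    define n where "n = m div 2"
    have mn: "m = 2 * n + 1" "Suc m div 2 = Suc n" "m div 2 = n" using False by (auto simp: n_def elim!: oddE)
    have du: "dim_vec u = Suc n * q" using u(1) mn by simp
    have ls: "level_seq \<alpha> (Suc m) t = t" "level_seq \<alpha> m t = shifted \<alpha> t" using False by (auto simp: level_seq_def)
    \<comment> \<open>Rows of the shifted matrix combine consecutive rows for \<open>t\<close>. The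
      shifted row \<open>n\<close> contains the wanted row \<open>Suc n\<close>, and its other term
      vanishes by \<open>zero\<close>.\<close>
    have act_s: "hankel_act q (shifted \<alpha> t) (Suc n) u i b = hankel_act q t (Suc n) u (Suc i) b - \<alpha> * hankel_act q t (Suc n) u i b"
      if "i \<le> n" "b < q" for i b
      by (rule hankel_act_shifted) (use that t mn in auto)
    have "hankel_act q (level_seq \<alpha> m t) (Suc (m div 2)) u (m div 2) a = (Qmat q \<alpha> t m *\<^sub>v vec_last u q) $ a"
    proof (rule last[OF _ _ a])
      show "dim_vec u = Suc (m div 2) * q" by (simp add: du mn)
      show "hankel_act q (level_seq \<alpha> m t) (Suc (m div 2)) u i b = 0" if "i < m div 2" "b < q" for i b
        using zero[of i b] zero[of "Suc i" b] that act_s[of i b] by (simp add: ls mn(2,3))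
    qed
    hence "hankel_act q (shifted \<alpha> t) (Suc n) u n a = 0" using Qv a by (simp add: ls mn(2,3) v_def)
    thus ?thesis using act_s[of n a] zero[of n a] a by (simp add: ls mn(2,3))
  qed
qed

lemma lower_bd_extension:
  fixes \<alpha> :: real
  assumes ms: "mat_seq q m t"
  defines "t' \<equiv> t(Suc m := lower_bd q \<alpha> t (Suc m))"
  shows "mat_seq q (Suc m) t'" "Qmat q \<alpha> t' (Suc m) = 0\<^sub>m q q"
proof -
  show ms': "mat_seq q (Suc m) t'"
    using ms lower_bd_mat_seq[OF ms] by (auto simp: mat_seq_def t'_def le_Suc_eq)
  have "lower_bd q \<alpha> t' (Suc m) = lower_bd q \<alpha> t (Suc m)" by (rule lower_bd_cong) (auto simp: t'_def)
  thus "Qmat q \<alpha> t' (Suc m) = 0\<^sub>m q q"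
    using Qmat_eq(2)[OF ms'] carrier_matD[OF lower_bd_mat_seq(1)[OF ms]] by (simp add: t'_def mat_minus_self)
qed

text \<open>The Schur complement of the new level is zero, so only the range condition remains: null
  vectors of the head must be killed by one further block row.\<close>

lemma level_mat_lower_bd_extension:
  fixes \<alpha> :: real
  assumes ms: "mat_seq q m t"
  defines "t' \<equiv> t(Suc m := lower_bd q \<alpha> t (Suc m))"
  assumes A: "nonneg_hermitian (level_head q \<alpha> (Suc m) t')"
    and ker: "\<And>u a. dim_vec u = Suc m div 2 * q \<Longrightarrow>
      level_head q \<alpha> (Suc m) t' *\<^sub>v u = 0\<^sub>v (Suc m div 2 * q) \<Longrightarrow> a < q \<Longrightarrow>
      hankel_act q (level_seq \<alpha> (Suc m) t') (Suc m div 2) u (Suc m div 2) a = 0"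
  shows "nonneg_hermitian (level_mat q \<alpha> (Suc m) t')"
proof -
  have ms': "mat_seq q (Suc m) t'" and Q0: "Qmat q \<alpha> t' (Suc m) = 0\<^sub>m q q"
    unfolding t'_def by (rule lower_bd_extension[OF ms])+
  interpret B: hermitian_block "Suc m div 2 * q" q "level_head q \<alpha> (Suc m) t'"
    "level_col q \<alpha> (Suc m) t'" "level_seq \<alpha> (Suc m) t' (2 * (Suc m div 2))" "level_mat q \<alpha> (Suc m) t'"
    by (rule level_block[OF ms'])
  show ?thesis
  proof (rule B.nonneg_M[OF A B.range_if_kernel])
    show "nonneg_hermitian B.S" using Qmat_B[OF ms', of \<alpha>] Q0 by (metis nonneg_hermitian_zero)
    fix u :: "complex vec" assume u: "dim_vec u = Suc m div 2 * q"
      "level_head q \<alpha> (Suc m) t' *\<^sub>v u = 0\<^sub>v (Suc m div 2 * q)"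
    have br: "mat_adjoint (level_col q \<alpha> (Suc m) t') = block_row q (level_seq \<alpha> (Suc m) t') (Suc m div 2)"
      by (rule adjoint_block_col) (use level_seq_mat_seq[OF ms'] in auto)
    show "mat_adjoint (level_col q \<alpha> (Suc m) t') *\<^sub>v u = 0\<^sub>v q"
      unfolding br
    proof (rule eq_vecI)
      fix a assume "a < dim_vec (0\<^sub>v q :: complex vec)"
      thus "(block_row q (level_seq \<alpha> (Suc m) t') (Suc m div 2) *\<^sub>v u) $ a = 0\<^sub>v q $ a"
        using block_row_mult_index[OF u(1), of a] ker[OF u, of a] by (simp del: index_mult_mat_vec)
    qed simp
  qed
qed

text \<open>The next entry is put at its lower bound, and \<open>kernel_propagation\<close> provides
  the range condition of the new level. For \<open>m = 0\<close> the head has no blocks and there is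
  nothing to propagate.\<close>

lemma extendable_if_kernel:
  assumes t: "t \<in> stieltjes_seqs q \<alpha> m"
    and ker: "\<And>v. m > 0 \<Longrightarrow> dim_vec v = q \<Longrightarrow> Qmat q \<alpha> t (m - 1) *\<^sub>v v = 0\<^sub>v q \<Longrightarrow> Qmat q \<alpha> t m *\<^sub>v v = 0\<^sub>v q"
  shows "t \<in> stieltjes_ext_seqs q \<alpha> m"
proof -
  note ms = mat_seq_stieltjes[OF t]
  define x where "x = lower_bd q \<alpha> t (Suc m)"
  define t' where "t' = t(Suc m := x)"
  have x: "x \<in> carrier_mat q q" unfolding x_def by (rule lower_bd_mat_seq[OF ms])
  have lc: "level_mat q \<alpha> k t' = level_mat q \<alpha> k t" if "k \<le> m" for k
    by (rule level_mat_cong) (use that in \<open>auto simp: t'_def\<close>)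
  have psd: "nonneg_hermitian (level_mat q \<alpha> m t)" "m > 0 \<Longrightarrow> nonneg_hermitian (level_mat q \<alpha> (m - 1) t)"
    and tc: "t \<in> {..m} \<rightarrow>\<^sub>E carrier_mat q q"
    using t by (auto simp: stieltjes_seqs_iff)
  have "nonneg_hermitian (level_mat q \<alpha> (Suc m) t')"
    unfolding t'_def x_def
  proof (rule level_mat_lower_bd_extension[OF ms], unfold x_def[symmetric], unfold t'_def[symmetric])
    show "nonneg_hermitian (level_head q \<alpha> (Suc m) t')"
    proof (cases "m = 0")
      case True
      thus ?thesis by (intro nonneg_hermitianI) (auto intro!: eq_matI simp: scalar_prod_def)
    qed (use psd lc[of "m - 1"] in \<open>simp add: block_hankel_level_seq_Suc(1)\<close>)
    fix u :: "complex vec" and a assume u: "dim_vec u = Suc m div 2 * q"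
      "level_head q \<alpha> (Suc m) t' *\<^sub>v u = 0\<^sub>v (Suc m div 2 * q)" "a < q"
    show "hankel_act q (level_seq \<alpha> (Suc m) t') (Suc m div 2) u (Suc m div 2) a = 0"
    proof (cases "m = 0")
      case True
      thus ?thesis by (simp add: hankel_act_def)
    next
      case False
      have "hankel_act q (level_seq \<alpha> (Suc m) t) (Suc m div 2) u (Suc m div 2) a = 0"
        using False u lc[of "m - 1"]
        by (intro kernel_propagation[OF ms _ psd ker]) (auto simp: block_hankel_level_seq_Suc(1))
      \<comment> \<open>The border row stops before the corner, so the new entry of index
        \<open>Suc m\<close> does not occur in it.\<close>
      moreover have "level_seq \<alpha> (Suc m) t' (Suc m div 2 + k) = level_seq \<alpha> (Suc m) t (Suc m div 2 + k)"
        if "k < Suc m div 2" for k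
      proof -
        have "Suc m div 2 + k < Suc m" "odd (Suc m) \<Longrightarrow> Suc (Suc m div 2 + k) < Suc m" using that by presburger+
        thus ?thesis by (auto simp: level_seq_def shifted_def t'_def)
      qed
      ultimately show ?thesis by (simp add: hankel_act_def)
    qed
  qed
  moreover have "t' \<in> {..Suc m} \<rightarrow>\<^sub>E carrier_mat q q"
    using tc x by (auto simp: t'_def PiE_iff extensional_def le_Suc_eq)
  ultimately have "t' \<in> stieltjes_seqs q \<alpha> (Suc m)"
    using psd lc[of m] by (simp add: stieltjes_seqs_iff)
  thus ?thesis using tc x by (auto simp: stieltjes_ext_seqs_def t'_def)
qed

text \<open>The operator construction needs both Hankel matrices of equal size and an inclusion of
  their kernels. For odd m the entry after the last one yields the inclusion. For even m the given
  next entry may violate it, as 0, 1 does for q = 1, \<alpha> = 0, m = 0; it is replaced by its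
  lower bound.\<close>

lemma ext_seq_full_data:
  assumes "t \<in> stieltjes_ext_seqs q \<alpha> m"
  obtains t' n where "\<And>j. j \<le> m \<Longrightarrow> t' j = t j" "m \<le> 2 * n + 1" "mat_seq q (2 * n + 1) t'"
    "nonneg_hermitian (block_hankel q t' (Suc n))" "nonneg_hermitian (block_hankel q (shifted \<alpha> t') (Suc n))"
    "\<And>u. dim_vec u = Suc n * q \<Longrightarrow> block_hankel q t' (Suc n) *\<^sub>v u = 0\<^sub>v (Suc n * q) \<Longrightarrow>
      block_hankel q (shifted \<alpha> t') (Suc n) *\<^sub>v u = 0\<^sub>v (Suc n * q)"
proof -
  obtain y where y: "t(Suc m := y) \<in> stieltjes_seqs q \<alpha> (Suc m)"
    using assms by (auto simp: stieltjes_ext_seqs_def)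
  define w where "w = t(Suc m := y)"
  have msw: "mat_seq q (Suc m) w" using mat_seq_stieltjes[OF y] by (simp add: w_def)
  have psd: "nonneg_hermitian (level_mat q \<alpha> (Suc m) w)" "nonneg_hermitian (level_mat q \<alpha> m w)"
    using y by (auto simp: stieltjes_seqs_iff w_def)
  have ms: "mat_seq q m t"
  proof -
    have "t j = w j" if "j \<le> m" for j using that by (simp add: w_def)
    thus ?thesis using msw by (simp add: mat_seq_def)
  qed
  interpret W: hermitian_block "Suc m div 2 * q" q "level_head q \<alpha> (Suc m) w"
    "level_col q \<alpha> (Suc m) w" "level_seq \<alpha> (Suc m) w (2 * (Suc m div 2))" "level_mat q \<alpha> (Suc m) w"
    by (rule level_block[OF msw])
  have br: "mat_adjoint (level_col q \<alpha> (Suc m) w) = block_row q (level_seq \<alpha> (Suc m) w) (Suc m div 2)"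
    by (rule adjoint_block_col) (use level_seq_mat_seq[OF msw] in auto)
  \<comment> \<open>Non-negativity of the extended level enters through its range condition: the
    border row kills the kernel of the head.\<close>
  have kerW: "hankel_act q (level_seq \<alpha> (Suc m) w) (Suc m div 2) u (Suc m div 2) a = 0"
    if "dim_vec u = Suc m div 2 * q" "level_head q \<alpha> (Suc m) w *\<^sub>v u = 0\<^sub>v (Suc m div 2 * q)" "a < q" for u a
    using W.nonneg_M_imp(4)[OF psd(1) that(1,2)] block_row_mult_index[OF that(1,3), of "level_seq \<alpha> (Suc m) w"] that(3)
    unfolding br by simp
  show ?thesis
  proof (cases "even m")
    case False
    then obtain n where m: "m = 2 * n + 1" by (elim oddE)
    have d: "Suc m div 2 = Suc n" "m div 2 = n" by (auto simp: m)
    have ls: "level_seq \<alpha> (Suc m) w = w" "level_seq \<alpha> m w = shifted \<alpha> w" using False by (auto simp: level_seq_def)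
    show ?thesis
    proof (rule that[of w n])
      show "mat_seq q (2 * n + 1) w" using msw by (rule mat_seq_mono) (simp add: m)
      show "nonneg_hermitian (block_hankel q w (Suc n))" using W.nonneg_M_imp(1)[OF psd(1)] by (simp add: ls d)
      show "nonneg_hermitian (block_hankel q (shifted \<alpha> w) (Suc n))" using psd(2) by (simp add: level_mat_def ls d)
      fix u :: "complex vec" assume u: "dim_vec u = Suc n * q" "block_hankel q w (Suc n) *\<^sub>v u = 0\<^sub>v (Suc n * q)"
      have z: "hankel_act q w (Suc n) u i a = 0" if "i \<le> Suc n" "a < q" for i a
      proof (cases "i = Suc n")
        case True
        thus ?thesis using kerW[of u a] u that by (simp add: ls d)
      qed (use block_hankel_kernel_iff[OF u(1), of w] u(2) that in auto)
      show "block_hankel q (shifted \<alpha> w) (Suc n) *\<^sub>v u = 0\<^sub>v (Suc n * q)"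
        unfolding block_hankel_kernel_iff[OF u(1)]
      proof (intro allI impI)
        fix i a assume ia: "i < Suc n" "a < q"
        have "hankel_act q (shifted \<alpha> w) (Suc n) u i a = hankel_act q w (Suc n) u (Suc i) a - \<alpha> * hankel_act q w (Suc n) u i a"
          by (rule hankel_act_shifted) (use ia msw m in \<open>auto simp: mat_seq_def\<close>)
        thus "hankel_act q (shifted \<alpha> w) (Suc n) u i a = 0" using z ia by simp
      qed
    qed (auto simp: w_def m)
  next
    case True
    then obtain n where m: "m = 2 * n" by (elim evenE)
    define t' where "t' = t(Suc m := lower_bd q \<alpha> t (Suc m))"
    have d: "Suc m div 2 = n" "m div 2 = n" by (auto simp: m)
    have ls: "level_seq \<alpha> (Suc m) x = shifted \<alpha> x" "level_seq \<alpha> m x = x" for x using True by (auto simp: level_seq_def)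
    \<comment> \<open>The replaced entry has index 2 n + 1 and enters the shifted sequence only from
      index 2 n on.\<close>
    have sh: "shifted \<alpha> t' j = shifted \<alpha> w j" if "j < 2 * n" for j
      using that by (simp add: shifted_def t'_def w_def m)
    have block_hankel_eq: "block_hankel q (shifted \<alpha> t') n = block_hankel q (shifted \<alpha> w) n" by (rule block_hankel_cong) (use sh in auto)
    have ms': "mat_seq q (Suc m) t'" and Q0: "Qmat q \<alpha> t' (Suc m) = 0\<^sub>m q q"
      unfolding t'_def by (rule lower_bd_extension[OF ms])+
    have N: "nonneg_hermitian (level_mat q \<alpha> (Suc m) t')"
      unfolding t'_def
    proof (rule level_mat_lower_bd_extension[OF ms], unfold t'_def[symmetric])
      show "nonneg_hermitian (level_head q \<alpha> (Suc m) t')"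
        using W.nonneg_M_imp(1)[OF psd(1)] by (simp add: ls d block_hankel_eq)
      fix u :: "complex vec" and a assume u: "dim_vec u = Suc m div 2 * q"
        "level_head q \<alpha> (Suc m) t' *\<^sub>v u = 0\<^sub>v (Suc m div 2 * q)" "a < q"
      have "hankel_act q (shifted \<alpha> w) n u n a = 0" using kerW[of u a] u by (simp add: ls d block_hankel_eq)
      thus "hankel_act q (level_seq \<alpha> (Suc m) t') (Suc m div 2) u (Suc m div 2) a = 0"
        by (simp add: ls d hankel_act_def sh)
    qed
    have lw: "level_mat q \<alpha> m w = level_mat q \<alpha> m t'"
      by (rule level_mat_cong) (auto simp: w_def t'_def)
    show ?thesis
    proof (rule that[of t' n])
      show "mat_seq q (2 * n + 1) t'" using ms' by (simp add: m)
      show "nonneg_hermitian (block_hankel q t' (Suc n))" using psd(2) lw by (simp add: level_mat_def ls d)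
      show "nonneg_hermitian (block_hankel q (shifted \<alpha> t') (Suc n))" using N by (simp add: level_mat_def ls d)
      fix u :: "complex vec" assume u: "dim_vec u = Suc n * q" "block_hankel q t' (Suc n) *\<^sub>v u = 0\<^sub>v (Suc n * q)"
      have z: "hankel_act q t' (Suc n) u i a = 0" if "i \<le> n" "a < q" for i a
        using block_hankel_kernel_iff[OF u(1), of t'] u(2) that by auto
      have low: "hankel_act q (shifted \<alpha> t') (Suc n) u i a = 0" if "i < n" "a < q" for i a
      proof -
        have "hankel_act q (shifted \<alpha> t') (Suc n) u i a = hankel_act q t' (Suc n) u (Suc i) a - \<alpha> * hankel_act q t' (Suc n) u i a"
          by (rule hankel_act_shifted) (use that ms' m in \<open>auto simp: mat_seq_def\<close>)
        thus ?thesis using z that by simp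
      qed
      \<comment> \<open>The last block row is the Schur complement applied to the leading
        coefficient, and this complement was made zero.\<close>
      have top: "hankel_act q (shifted \<alpha> t') (Suc n) u n a = 0" if "a < q" for a
        using hankel_act_last[OF ms' level_range[OF ms' N], of u a] u low that by (simp add: ls d Q0)
      show "block_hankel q (shifted \<alpha> t') (Suc n) *\<^sub>v u = 0\<^sub>v (Suc n * q)"
        unfolding block_hankel_kernel_iff[OF u(1)] using low top by (auto simp: less_Suc_eq)
    qed (auto simp: t'_def m)
  qed
qed

section \<open>Atomic representation\<close>

definition row_block :: "nat \<Rightarrow> nat \<Rightarrow> complex mat \<Rightarrow> complex mat" where
  "row_block q j M = mat q (dim_col M) (\<lambda>(a, c). M $$ (j * q + a, c))"

lemma dim_row_block [simp]: "dim_row (row_block q j M) = q" "dim_col (row_block q j M) = dim_col M"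
  by (auto simp: row_block_def)

lemma row_block_mult:
  assumes "dim_row M = n * q" "j < n" "dim_col M = dim_row X"
  shows "row_block q j (M * X) = row_block q j M * X"
proof (rule eq_matI, goal_cases)
  case (1 a c)
  hence a: "a < q" "c < dim_col X" by auto
  from block_index_less[OF assms(2) a(1)] a assms
  show ?case by (auto simp: row_block_def scalar_prod_def intro!: sum.cong)
qed auto

text \<open>Finite-dimensional version of the multiplication operator: with \<open>R = \<surd>H\<close>, the Hermitian
  matrix \<open>T = R\<^sup>+ B R\<^sup>+ + \<alpha>\<close> represents the form \<open>B + \<alpha> H\<close> with respect to \<open>H\<close>,
  and the Hankel structure says that \<open>T\<close> moves each block row of \<open>R\<close> to the next one.
  The atoms are the eigenvalues of \<open>T\<close>.\<close>

lemma atomic_representation: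
  fixes \<alpha> :: real
  assumes ms: "mat_seq q (2 * n + 1) t"
    and nH: "nonneg_hermitian (block_hankel q t (Suc n))" and nB: "nonneg_hermitian (block_hankel q (shifted \<alpha> t) (Suc n))"
    and ker: "\<And>u. dim_vec u = Suc n * q \<Longrightarrow> block_hankel q t (Suc n) *\<^sub>v u = 0\<^sub>v (Suc n * q) \<Longrightarrow>
      block_hankel q (shifted \<alpha> t) (Suc n) *\<^sub>v u = 0\<^sub>v (Suc n * q)"
  obtains N :: nat and l :: "nat \<Rightarrow> real" and C :: "nat \<Rightarrow> nat \<Rightarrow> complex"
  where "\<And>i. i < N \<Longrightarrow> \<alpha> \<le> l i"
    "\<And>k a b. k \<le> 2 * n + 1 \<Longrightarrow> a < q \<Longrightarrow> b < q \<Longrightarrow>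
       t k $$ (a, b) = (\<Sum>i<N. complex_of_real (l i) ^ k * (C a i * cnj (C b i)))"
proof -
  define N where "N = Suc n * q"
  define H where "H = block_hankel q t (Suc n)"
  define B where "B = block_hankel q (shifted \<alpha> t) (Suc n)"
  have [simp]: "dim_row H = N" "dim_col H = N" "dim_row B = N" "dim_col B = N"
    by (auto simp: H_def B_def N_def)
  note nH = nH[folded H_def] and nB = nB[folded B_def]
  have hB: "mat_adjoint B = B" by (rule nonneg_hermitianD(2)[OF nB])
  define R where "R = mat_sqrt H"
  have R [simp]: "dim_row R = N" "dim_col R = N" and hR: "mat_adjoint R = R" and RR: "R * R = H"
    using mat_sqrt[OF nH] by (auto simp: R_def)
  define X where "X = moore_penrose R"
  have X [simp]: "dim_row X = N" "dim_col X = N" by (auto simp: X_def)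
  have hX: "mat_adjoint X = X" and comm: "X * R = R * X"
    using moore_penrose_hermitian[OF hR] by (auto simp: X_def)
  define P where "P = R * X"
  have P [simp]: "dim_row P = N" "dim_col P = N" by (auto simp: P_def)
  have hP: "mat_adjoint P = P" by (simp add: P_def mat_adj hX hR comm)
  have RP: "R * P = R" and XP: "X * P = X" and PR: "P * R = R"
    using moore_penrose(1,2)[of R] comm by (auto simp: P_def X_def mat_ring)
  have HP: "H * P = H" unfolding RR[symmetric] by (simp add: mat_ring RP)
  \<comment> \<open>\<open>1 - P\<close> maps into the kernel of \<open>H\<close>, and the kernel
    hypothesis carries this over to \<open>B\<close>. This is what makes the compression to the
    quotient lose nothing of \<open>B\<close>.\<close>
  have BP: "B * P = B"
  proof -
    have "B * (1\<^sub>m N - P) = 0\<^sub>m N N"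
    proof (rule mat_eqI_vec)
      fix v :: "complex vec" assume "dim_vec v = dim_col (B * (1\<^sub>m N - P))"
      hence v: "dim_vec v = N" by simp
      have "H *\<^sub>v ((1\<^sub>m N - P) *\<^sub>v v) = H * (1\<^sub>m N - P) *\<^sub>v v" using v by (intro mat_vec_assoc[symmetric]) auto
      also have "H * (1\<^sub>m N - P) = 0\<^sub>m N N" by (simp add: mat_ring HP mat_minus_self)
      finally have "H *\<^sub>v ((1\<^sub>m N - P) *\<^sub>v v) = 0\<^sub>v N" using v by simp
      hence "B *\<^sub>v ((1\<^sub>m N - P) *\<^sub>v v) = 0\<^sub>v N"
        using ker[of "(1\<^sub>m N - P) *\<^sub>v v", folded H_def B_def N_def] by simp
      moreover have "B * (1\<^sub>m N - P) *\<^sub>v v = B *\<^sub>v ((1\<^sub>m N - P) *\<^sub>v v)" using v by (intro mat_vec_assoc) auto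
      ultimately show "B * (1\<^sub>m N - P) *\<^sub>v v = 0\<^sub>m N N *\<^sub>v v" using v by simp
    qed auto
    hence "B - B * P = 0\<^sub>m N N" by (simp add: mat_ring)
    from minus_mat_eq_zeroD[OF this] show ?thesis by simp
  qed
  have PB: "P * B = B" using arg_cong[OF BP, of mat_adjoint] by (simp add: mat_adj hP hB)
  define M where "M = X * B * X"
  have M [simp]: "dim_row M = N" "dim_col M = N" by (auto simp: M_def)
  have "nonneg_hermitian M"
    using nonneg_hermitian_congruence[OF nB, of X] by (simp add: M_def hX)
  from nonneg_hermitian_spectral[OF this, of N] obtain U d where
    U: "U \<in> carrier_mat N N" "mat_adjoint U * U = 1\<^sub>m N" "M = U * real_diag N d * mat_adjoint U"
    and d: "\<And>i. i < N \<Longrightarrow> 0 \<le> d i" by auto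
  note [simp] = carrier_matD[OF U(1)] unitary_cancel[OF U(2,1)]
  define T where "T = M + \<alpha> \<cdot>\<^sub>m 1\<^sub>m N"
  have T [simp]: "dim_row T = N" "dim_col T = N" by (auto simp: T_def)
  have RM: "R * M = B * X"
  proof -
    have "R * M = P * B * X" by (simp add: M_def P_def mat_ring)
    thus ?thesis by (simp add: PB)
  qed
  have RT: "R * T = B * X + \<alpha> \<cdot>\<^sub>m R" by (simp add: T_def mat_ring RM)
  have RTP: "R * T * P = R * T" unfolding RT by (simp add: mat_ring XP RP)
  have RTR: "R * T * R = B + \<alpha> \<cdot>\<^sub>m H" unfolding RT by (simp add: mat_ring RR comm BP flip: P_def)
  have t: "t j \<in> carrier_mat q q" if "j \<le> 2 * n + 1" for j using ms that by (auto simp: mat_seq_def)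
  \<comment> \<open>Adding \<alpha> H undoes the shift by \<alpha>: \<open>B + \<alpha> H\<close> is
    the Hankel matrix of the sequence started one index later.\<close>
  have K: "(B + \<alpha> \<cdot>\<^sub>m H) $$ (j * q + a, k * q + b) = t (Suc (j + k)) $$ (a, b)"
    if "j < Suc n" "k < Suc n" "a < q" "b < q" for j k a b
    using block_hankel_index[OF that] block_index_less[OF that(1,3)] block_index_less[OF that(2,4)] that
      carrier_matD[OF t[of "j + k"]] carrier_matD[OF t[of "Suc (j + k)"]]
    by (simp add: B_def H_def shifted_def)
  have Hij: "H $$ (j * q + a, k * q + b) = t (j + k) $$ (a, b)"
    if "j < Suc n" "k < Suc n" "a < q" "b < q" for j k a b
    using block_hankel_index[OF that] by (simp add: H_def)
  have KH: "row_block q j (B + \<alpha> \<cdot>\<^sub>m H) = row_block q (Suc j) H" if "j < n" for j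
  proof (rule eq_matI, goal_cases)
    case (1 a c)
    hence ac: "a < q" "c < Suc n * q" by (auto simp: N_def)
    hence "c div q < Suc n" "c mod q < q" "c div q * q + c mod q = c"
      by (auto intro: less_mult_imp_div_less)
    thus ?case using K[of j "c div q" a "c mod q"] Hij[of "Suc j" "c div q" a "c mod q"] ac that
      by (simp add: row_block_def N_def del: mult_Suc)
  qed auto
  \<comment> \<open>After multiplication by \<open>R\<close> from the right the claim is the Hankel
    shift \<open>KH\<close>. The factor \<open>X\<close> removes \<open>R\<close> again, because
    \<open>R * T\<close> and \<open>R\<close> are unchanged by the projection
    \<open>P\<close>.\<close>
  have step: "row_block q j (R * T) = row_block q (Suc j) R" if "j < n" for j
  proof -
    have j: "j < Suc n" "Suc j < Suc n" using that by auto
    have rm: "row_block q i (A * Y) = row_block q i A * Y" if "i < Suc n" "dim_row A = N" "dim_col A = dim_row Y" for i A Y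
      using that by (intro row_block_mult[of _ "Suc n"]) (auto simp: N_def)
    have "row_block q j (R * T) = row_block q j (R * T * R * X)"
      using RTP by (simp add: P_def mat_ring)
    also have "\<dots> = row_block q j (R * T * R) * X" by (rule rm) (use j in auto)
    also have "\<dots> = row_block q (Suc j) (R * R) * X" unfolding RTR KH[OF that] RR ..
    also have "\<dots> = row_block q (Suc j) (R * R * X)" by (rule rm[symmetric]) (use j in auto)
    also have "R * R * X = R" using RP by (simp add: P_def mat_ring)
    finally show ?thesis .
  qed
  define G where "G = R * U"
  have G [simp]: "dim_row G = N" "dim_col G = N" by (auto simp: G_def)
  have HG: "H = G * mat_adjoint G"
  proof -
    have "U * mat_adjoint U = 1\<^sub>m N" by (rule mat_left_inverse_imp_right[OF U(1) _ U(2)]) (use U in auto)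
    thus ?thesis by (simp add: G_def mat_adj mat_ring hR RR)
  qed
  have RTU: "R * T * U = G * real_diag N (\<lambda>i. d i + \<alpha>)"
  proof -
    have "R * T * U = R * (M * U) + \<alpha> \<cdot>\<^sub>m G" by (simp add: T_def G_def mat_ring)
    also have "M * U = U * real_diag N d" unfolding U(3) by (simp add: mat_ring U(2))
    also have "R * (U * real_diag N d) + \<alpha> \<cdot>\<^sub>m G = G * real_diag N d + \<alpha> \<cdot>\<^sub>m G" by (simp add: G_def mat_ring)
    also have "\<dots> = G * real_diag N (\<lambda>i. d i + \<alpha>)"
      by (intro eq_matI) (auto simp: index_mult_real_diag algebra_simps simp del: index_mult_mat(1))
    finally show ?thesis .
  qed
  \<comment> \<open>The moment of index 2 n + 1 does not occur in \<open>H\<close>; it is read off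
    from the corner of this matrix.\<close>
  have KG: "B + \<alpha> \<cdot>\<^sub>m H = G * real_diag N (\<lambda>i. d i + \<alpha>) * mat_adjoint G"
  proof -
    have "R * T * R = R * T * U * mat_adjoint U * R" by (simp add: mat_ring)
    thus ?thesis unfolding RTR RTU by (simp add: G_def mat_adj mat_ring hR)
  qed
  have Gstep: "G $$ (Suc j * q + a, i) = G $$ (j * q + a, i) * (d i + \<alpha>)" if "j < n" "a < q" "i < N" for j a i
  proof -
    have idx: "j * q + a < N" "Suc j * q + a < N"
      using block_index_less[of j "Suc n" a q] block_index_less[of "Suc j" "Suc n" a q] that by (auto simp: N_def)
    have rb: "row_block q k Y $$ (a, i) = Y $$ (k * q + a, i)" if "dim_col Y = N" for k Y
      using \<open>a < q\<close> \<open>i < N\<close> that by (simp add: row_block_def)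
    have "row_block q (Suc j) G = row_block q (Suc j) R * U"
      unfolding G_def using that by (intro row_block_mult[of _ "Suc n"]) (auto simp: N_def)
    also have "\<dots> = row_block q j (R * T) * U" by (simp add: step that)
    also have "\<dots> = row_block q j (R * T * U)"
      using that by (intro row_block_mult[of _ "Suc n", symmetric]) (auto simp: N_def)
    finally have "row_block q (Suc j) G $$ (a, i) = row_block q j (R * T * U) $$ (a, i)" by simp
    hence "G $$ (Suc j * q + a, i) = (G * real_diag N (\<lambda>i. d i + \<alpha>)) $$ (j * q + a, i)"
      unfolding RTU by (subst (asm) (1 2) rb) auto
    also have "\<dots> = G $$ (j * q + a, i) * complex_of_real (d i + \<alpha>)"
      using idx that by (intro index_mult_real_diag(1)) auto
    finally show ?thesis by simp
  qed
  define l where "l i = d i + \<alpha>" for i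
  \<comment> \<open>In the eigenbasis of \<open>T\<close>, passing to the next block row multiplies
    column i by the eigenvalue, so \<open>G\<close> has Vandermonde structure.\<close>
  have Gpow: "G $$ (j * q + a, i) = complex_of_real (l i) ^ j * G $$ (a, i)" if "j \<le> n" "a < q" "i < N" for j a i
    using that(1)
  proof (induction j)
    case (Suc j)
    thus ?case using Gstep[of j a i] that by (simp add: l_def)
  qed simp
  show ?thesis
  proof (rule that[of N l "\<lambda>a i. G $$ (a, i)"])
    show "\<alpha> \<le> l i" if "i < N" for i using d[OF that] by (simp add: l_def)
    fix k a b assume k: "k \<le> 2 * n + 1" and ab: "a < q" "b < q"
    have mult_adj: "(Y * mat_adjoint G) $$ (x, y) = (\<Sum>i<N. Y $$ (x, i) * cnj (G $$ (y, i)))"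
      if "dim_row Y = N" "dim_col Y = N" "x < N" "y < N" for Y x y
      using that by (auto simp: scalar_prod_def atLeast0LessThan intro!: sum.cong)
    have lt: "j * q + c < N" if "j \<le> n" "c < q" for j c
      using block_index_less[of j "Suc n" c q] that by (simp add: N_def)
    show "t k $$ (a, b) = (\<Sum>i<N. complex_of_real (l i) ^ k * (G $$ (a, i) * cnj (G $$ (b, i))))"
    proof (cases "k \<le> 2 * n")
      case True
      define i where "i = min k n"
      define j where "j = k - i"
      have ij: "i \<le> n" "j \<le> n" "i + j = k" using True by (auto simp: i_def j_def)
      have "t k $$ (a, b) = H $$ (i * q + a, j * q + b)" using Hij[of i j a b] ij ab by simp
      also have "\<dots> = (\<Sum>c<N. G $$ (i * q + a, c) * cnj (G $$ (j * q + b, c)))"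
        unfolding HG by (rule mult_adj) (use lt ij ab in auto)
      also have "\<dots> = (\<Sum>c<N. complex_of_real (l c) ^ k * (G $$ (a, c) * cnj (G $$ (b, c))))"
        using ij ab by (intro sum.cong) (auto simp: Gpow power_add mult_ac simp flip: ij(3))
      finally show ?thesis .
    next
      case False
      hence kk: "k = Suc (n + n)" using k by simp
      have "t k $$ (a, b) = (B + \<alpha> \<cdot>\<^sub>m H) $$ (n * q + a, n * q + b)" using K[of n n a b] ab kk by simp
      also have "\<dots> = (\<Sum>c<N. (G * real_diag N (\<lambda>i. d i + \<alpha>)) $$ (n * q + a, c) * cnj (G $$ (n * q + b, c)))"
        unfolding KG by (rule mult_adj) (use lt ab in auto)
      also have "\<dots> = (\<Sum>c<N. G $$ (n * q + a, c) * l c * cnj (G $$ (n * q + b, c)))"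
        using lt[of n a] ab by (intro sum.cong) (auto simp: index_mult_real_diag l_def simp del: index_mult_mat(1))
      also have "\<dots> = (\<Sum>c<N. complex_of_real (l c) ^ k * (G $$ (a, c) * cnj (G $$ (b, c))))"
        using ab by (intro sum.cong) (auto simp: Gpow kk power_add mult_ac)
      finally show ?thesis .
    qed
  qed
qed

section \<open>Integrals against measures with densities\<close>

lemma integrable_indicator_mult:
  fixes h :: "'a \<Rightarrow> 'b :: {real_normed_field, banach, second_countable_topology}"
  assumes "integrable M h" "B \<in> sets M"
  shows "integrable M (\<lambda>x. indicator B x * h x)"
proof (rule Bochner_Integration.integrable_bound[OF assms(1)])
  show "(\<lambda>x. indicator B x * h x) \<in> borel_measurable M"
    using borel_measurable_integrable[OF assms(1)] assms(2) by measurable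
  show "AE x in M. norm (indicator B x * h x) \<le> norm (h x)"
    by (auto split: split_indicator)
qed

text \<open>The supremum is attained at the part of B where h is positive. The density needs no
  explicit positive part, since \<open>ennreal\<close> truncates negative values.\<close>

lemma pos_variation_density:
  fixes h :: "'a \<Rightarrow> real"
  assumes sets: "sets T = sets M" and h: "integrable T h"
    and nu: "\<And>B. B \<in> sets M \<Longrightarrow> \<nu> B = (\<integral>x. indicator B x * h x \<partial>T)"
  shows "pos_variation M \<nu> = density T (\<lambda>x. ennreal (h x))"
proof -
  have space: "space T = space M" by (rule sets_eq_imp_space_eq[OF sets])
  have hm [measurable]: "h \<in> borel_measurable T" using h by (rule borel_measurable_integrable)
  let ?D = "density T (\<lambda>x. ennreal (h x))"
  have "(SUP C\<in>{C \<in> sets M. C \<subseteq> B}. ennreal (\<nu> C)) = emeasure ?D B" if B: "B \<in> sets M" for B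
  proof (rule antisym)
    have B': "B \<in> sets T" using B sets by simp
    have eD: "emeasure ?D B = (\<integral>\<^sup>+x. ennreal (h x) * indicator B x \<partial>T)"
      using B' by (simp add: emeasure_density)
    show "(SUP C\<in>{C \<in> sets M. C \<subseteq> B}. ennreal (\<nu> C)) \<le> emeasure ?D B"
    proof (rule SUP_least)
      fix C assume "C \<in> {C \<in> sets M. C \<subseteq> B}"
      hence C: "C \<in> sets M" "C \<in> sets T" "C \<subseteq> B" using sets by auto
      have i: "integrable T (\<lambda>x. max 0 (indicator C x * h x))"
        by (intro integrable_max integrable_zero integrable_indicator_mult h C)
      have "\<nu> C \<le> (\<integral>x. max 0 (indicator C x * h x) \<partial>T)"
        unfolding nu[OF C(1)] by (intro integral_mono i integrable_indicator_mult h C) auto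
      hence "ennreal (\<nu> C) \<le> ennreal (\<integral>x. max 0 (indicator C x * h x) \<partial>T)" by (rule ennreal_leI)
      also have "\<dots> = (\<integral>\<^sup>+x. ennreal (max 0 (indicator C x * h x)) \<partial>T)"
        by (rule nn_integral_eq_integral[symmetric]) (use i in auto)
      also have "\<dots> \<le> (\<integral>\<^sup>+x. ennreal (h x) * indicator B x \<partial>T)"
        using C(3) by (intro nn_integral_mono) (auto split: split_indicator simp: max_def ennreal_neg)
      finally show "ennreal (\<nu> C) \<le> emeasure ?D B" unfolding eD .
    qed
    define C where "C = {x \<in> space T. 0 < h x} \<inter> B"
    have "{x \<in> space T. 0 < h x} \<in> sets T" by measurable
    hence C: "C \<in> sets T" using B' unfolding C_def by (rule sets.Int)
    hence C: "C \<in> sets T" "C \<in> sets M" "C \<subseteq> B" using sets by (auto simp: C_def)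
    have i: "integrable T (\<lambda>x. indicator C x * h x)" by (intro integrable_indicator_mult h C)
    have "emeasure ?D B = (\<integral>\<^sup>+x. ennreal (indicator C x * h x) \<partial>T)"
      unfolding eD by (intro nn_integral_cong) (auto split: split_indicator simp: C_def ennreal_neg)
    also have "\<dots> = ennreal (\<integral>x. indicator C x * h x \<partial>T)"
      by (rule nn_integral_eq_integral[OF i]) (auto split: split_indicator simp: C_def)
    also have "\<dots> = ennreal (\<nu> C)" using nu C by simp
    finally have eC: "emeasure ?D B = ennreal (\<nu> C)" .
    show "emeasure ?D B \<le> (SUP C\<in>{C \<in> sets M. C \<subseteq> B}. ennreal (\<nu> C))"
      unfolding eC by (rule SUP_upper) (use C in auto)
  qed
  hence "pos_variation M \<nu> = measure_of (space M) (sets M) (emeasure ?D)"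
    unfolding pos_variation_def
    by (intro measure_of_eq sets.space_closed) (simp add: sets.sigma_sets_eq)
  also have "\<dots> = measure_of (space ?D) (sets ?D) (emeasure ?D)"
    by (simp add: sets space)
  finally show ?thesis by (simp only: measure_of_of_measure)
qed

text \<open>The positive and negative parts of h, multiplied by f, are each dominated by h f in
  absolute value and have h f as their difference. So integrability against both variations amounts
  to integrability of h f.\<close>

lemma signed_integral_density:
  fixes h f :: "'a \<Rightarrow> real"
  assumes sets: "sets T = sets M" and h: "integrable T h" and f: "f \<in> borel_measurable M"
    and nu: "\<And>B. B \<in> sets M \<Longrightarrow> \<nu> B = (\<integral>x. indicator B x * h x \<partial>T)"
  shows "signed_integrable M \<nu> f \<longleftrightarrow> integrable T (\<lambda>x. h x * f x)"
    "integrable T (\<lambda>x. h x * f x) \<Longrightarrow> signed_integral M \<nu> f = (\<integral>x. h x * f x \<partial>T)"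
proof -
  have hm [measurable]: "h \<in> borel_measurable T" using h by (rule borel_measurable_integrable)
  have fm [measurable]: "f \<in> borel_measurable T" using f sets by (simp cong: measurable_cong_sets)
  have p: "pos_variation M \<nu> = density T (\<lambda>x. ennreal (max 0 (h x)))"
    using pos_variation_density[OF sets h nu] by (simp add: max_def ennreal_neg cong: if_cong) (intro density_cong, auto simp: ennreal_neg)
  have "pos_variation M (\<lambda>B. - \<nu> B) = density T (\<lambda>x. ennreal (- h x))"
    by (rule pos_variation_density[OF sets]) (use h nu in auto)
  also have "\<dots> = density T (\<lambda>x. ennreal (max 0 (- h x)))"
    by (intro density_cong) (auto simp: max_def ennreal_neg)
  finally have n: "pos_variation M (\<lambda>B. - \<nu> B) = density T (\<lambda>x. ennreal (max 0 (- h x)))" .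
  have ip: "integrable (pos_variation M \<nu>) f \<longleftrightarrow> integrable T (\<lambda>x. max 0 (h x) * f x)"
    unfolding p by (rule integrable_real_density) auto
  have iN: "integrable (pos_variation M (\<lambda>B. - \<nu> B)) f \<longleftrightarrow> integrable T (\<lambda>x. max 0 (- h x) * f x)"
    unfolding n by (rule integrable_real_density) auto
  have split: "h x * f x = max 0 (h x) * f x - max 0 (- h x) * f x" for x by (auto simp: max_def)
  have le: "norm (max 0 y * z) \<le> norm (y * z)" "norm (max 0 (- y) * z) \<le> norm (y * z)" for y z :: real
    by (simp_all add: abs_mult mult_right_mono)
  have bnd: "integrable T (\<lambda>x. max 0 (h x) * f x) \<and> integrable T (\<lambda>x. max 0 (- h x) * f x)"
    if "integrable T (\<lambda>x. h x * f x)"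
    by (intro conjI; rule Bochner_Integration.integrable_bound[OF that]) (use le in auto)
  show iff: "signed_integrable M \<nu> f \<longleftrightarrow> integrable T (\<lambda>x. h x * f x)"
  proof -
    have "integrable T (\<lambda>x. h x * f x)"
      if "integrable T (\<lambda>x. max 0 (h x) * f x)" "integrable T (\<lambda>x. max 0 (- h x) * f x)"
      using Bochner_Integration.integrable_diff[OF that] by (simp only: split)
    thus ?thesis unfolding signed_integrable_def ip iN using bnd by blast
  qed
  assume i: "integrable T (\<lambda>x. h x * f x)"
  have "(\<integral>x. f x \<partial>pos_variation M \<nu>) = (\<integral>x. max 0 (h x) * f x \<partial>T)"
    unfolding p by (rule integral_real_density) auto
  moreover have "(\<integral>x. f x \<partial>pos_variation M (\<lambda>B. - \<nu> B)) = (\<integral>x. max 0 (- h x) * f x \<partial>T)"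
    unfolding n by (rule integral_real_density) auto
  moreover have "(\<integral>x. h x * f x \<partial>T) = (\<integral>x. max 0 (h x) * f x \<partial>T) - (\<integral>x. max 0 (- h x) * f x \<partial>T)"
    using bnd[OF i] by (subst split) (rule Bochner_Integration.integral_diff, auto)
  ultimately show "signed_integral M \<nu> f = (\<integral>x. h x * f x \<partial>T)" by (simp add: signed_integral_def)
qed

lemma complex_integrable_iff:
  "integrable T F \<longleftrightarrow> integrable T (\<lambda>x. Re (F x)) \<and> integrable T (\<lambda>x. Im (F x))"
proof
  assume "integrable T (\<lambda>x. Re (F x)) \<and> integrable T (\<lambda>x. Im (F x))"
  hence "integrable T (\<lambda>x. complex_of_real (Re (F x)) + \<i> * complex_of_real (Im (F x)))"
    by (intro Bochner_Integration.integrable_add integrable_mult_right integrable_of_real) auto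
  thus "integrable T F" by (simp flip: complex_eq)
qed auto

lemma cmeasure_integral_density:
  fixes F :: "'a \<Rightarrow> complex" and f :: "'a \<Rightarrow> real"
  assumes sets: "sets T = sets M" and F: "integrable T F" and f: "f \<in> borel_measurable M"
    and nu: "\<And>B. B \<in> sets M \<Longrightarrow> \<nu> B = (\<integral>x. indicator B x * F x \<partial>T)"
  shows "cmeasure_integrable M \<nu> f \<longleftrightarrow> integrable T (\<lambda>x. F x * f x)"
    "integrable T (\<lambda>x. F x * f x) \<Longrightarrow> cmeasure_integral M \<nu> f = (\<integral>x. F x * f x \<partial>T)"
proof -
  have "Re (\<nu> B) = (\<integral>x. indicator B x * Re (F x) \<partial>T)" "Im (\<nu> B) = (\<integral>x. indicator B x * Im (F x) \<partial>T)" if "B \<in> sets M" for B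
  proof -
    have i: "integrable T (\<lambda>x. indicator B x * F x)"
      using integrable_indicator_mult[OF F] that sets by simp
    have "Re (\<nu> B) = (\<integral>x. Re (indicator B x * F x) \<partial>T)" unfolding nu[OF that] by (rule integral_Re[OF i, symmetric])
    also have "\<dots> = (\<integral>x. indicator B x * Re (F x) \<partial>T)" by (intro Bochner_Integration.integral_cong) (auto split: split_indicator)
    finally show "Re (\<nu> B) = (\<integral>x. indicator B x * Re (F x) \<partial>T)" .
    have "Im (\<nu> B) = (\<integral>x. Im (indicator B x * F x) \<partial>T)" unfolding nu[OF that] by (rule integral_Im[OF i, symmetric])
    also have "\<dots> = (\<integral>x. indicator B x * Im (F x) \<partial>T)" by (intro Bochner_Integration.integral_cong) (auto split: split_indicator)
    finally show "Im (\<nu> B) = (\<integral>x. indicator B x * Im (F x) \<partial>T)" .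
  qed
  note R = signed_integral_density[OF sets integrable_Re[OF F] f this(1)]
    and I = signed_integral_density[OF sets integrable_Im[OF F] f this(2)]
  show "cmeasure_integrable M \<nu> f \<longleftrightarrow> integrable T (\<lambda>x. F x * f x)"
    using R(1) I(1) by (simp add: cmeasure_integrable_def complex_integrable_iff[of T "\<lambda>x. F x * f x"])
  assume i: "integrable T (\<lambda>x. F x * f x)"
  hence "integrable T (\<lambda>x. Re (F x) * f x)" "integrable T (\<lambda>x. Im (F x) * f x)"
    unfolding complex_integrable_iff[of T "\<lambda>x. F x * f x"] by auto
  thus "cmeasure_integral M \<nu> f = (\<integral>x. F x * f x \<partial>T)"
    unfolding cmeasure_integral_def using R(2) I(2) integral_Re[OF i] integral_Im[OF i] by (simp add: complex_eq_iff)
qed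

lemma measure_of_real_additive:
  fixes \<nu> :: "'a set \<Rightarrow> real"
  assumes nonneg: "\<And>B. B \<in> sets M \<Longrightarrow> 0 \<le> \<nu> B"
    and add: "\<And>F :: nat \<Rightarrow> 'a set. range F \<subseteq> sets M \<Longrightarrow> disjoint_family F \<Longrightarrow> (\<lambda>n. \<nu> (F n)) sums \<nu> (\<Union>n. F n)"
  obtains N where "sets N = sets M" "finite_measure N" "\<And>B. B \<in> sets M \<Longrightarrow> emeasure N B = ennreal (\<nu> B)"
proof -
  define N where "N = measure_of (space M) (sets M) (\<lambda>B. ennreal (\<nu> B))"
  have sN: "sets N = sets M" "space N = space M" unfolding N_def by auto
  \<comment> \<open>A constant series converges only if its terms vanish, so additivity already
    forces the value 0 at the empty set.\<close>
  have "(\<lambda>n::nat. \<nu> {}) sums \<nu> {}" using add[of "\<lambda>_. {}"] by (simp add: disjoint_family_on_def)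
  hence e: "\<nu> {} = 0" using sums_summable summable_const_iff by blast
  have eN: "emeasure N B = ennreal (\<nu> B)" if "B \<in> sets M" for B
  proof (rule emeasure_measure_of[OF N_def])
    show "positive (sets N) (\<lambda>B. ennreal (\<nu> B))" by (simp add: positive_def e)
    show "countably_additive (sets N) (\<lambda>B. ennreal (\<nu> B))"
      unfolding countably_additive_def sN
    proof (intro allI impI)
      fix A :: "nat \<Rightarrow> 'a set" assume A: "range A \<subseteq> sets M" "disjoint_family A"
      show "(\<Sum>i. ennreal (\<nu> (A i))) = ennreal (\<nu> (\<Union>i. A i))"
        using A(1) by (intro suminf_ennreal_eq nonneg add A) auto
    qed
  qed (simp_all add: that sN sets.space_closed)
  have "finite_measure N" by (rule finite_measureI) (simp add: sN eN)
  thus ?thesis using that[of N] sN eN by blast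
qed

text \<open>By the bound, adding T turns \<nu> into a positive measure which is absolutely
  continuous with respect to T. Its Radon-Nikodym density minus 1 is the wanted h.\<close>

lemma signed_density_exists:
  fixes \<nu> :: "'a set \<Rightarrow> real"
  assumes sets: "sets T = sets M" and "finite_measure T"
    and add: "\<And>F :: nat \<Rightarrow> 'a set. range F \<subseteq> sets M \<Longrightarrow> disjoint_family F \<Longrightarrow> (\<lambda>n. \<nu> (F n)) sums \<nu> (\<Union>n. F n)"
    and bound: "\<And>B. B \<in> sets M \<Longrightarrow> \<bar>\<nu> B\<bar> \<le> measure T B"
  obtains h where "integrable T h" "\<And>B. B \<in> sets M \<Longrightarrow> \<nu> B = (\<integral>x. indicator B x * h x \<partial>T)"
proof -
  interpret T: finite_measure T by fact
  have mT: "(\<lambda>n. measure T (F n)) sums measure T (\<Union>n. F n)"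
    if "range F \<subseteq> sets M" "disjoint_family F" for F :: "nat \<Rightarrow> 'a set"
    using T.finite_measure_UNION[of F] that sets by simp
  obtain N where N: "sets N = sets M" "finite_measure N" "\<And>B. B \<in> sets M \<Longrightarrow> emeasure N B = ennreal (\<nu> B + measure T B)"
  proof (rule measure_of_real_additive[of M "\<lambda>B. \<nu> B + measure T B"])
    show "0 \<le> \<nu> B + measure T B" if "B \<in> sets M" for B using bound[OF that] by linarith
    show "(\<lambda>n. \<nu> (F n) + measure T (F n)) sums (\<nu> (\<Union>n. F n) + measure T (\<Union>n. F n))"
      if "range F \<subseteq> sets M" "disjoint_family F" for F :: "nat \<Rightarrow> 'a set"
      by (intro sums_add add mT that)
  qed blast
  have ac: "absolutely_continuous T N"
    unfolding absolutely_continuous_def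
  proof (rule subsetI)
    fix B assume "B \<in> null_sets T"
    hence B: "B \<in> sets M" "measure T B = 0" using sets by (auto simp: null_sets_def measure_def)
    with bound[OF B(1)] N(3)[OF B(1)] show "B \<in> null_sets N" using N(1) by (auto simp: null_sets_def)
  qed
  have sNT: "sets N = sets T" using N(1) sets by simp
  obtain D where D: "D \<in> borel_measurable T" "AE x in T. RN_deriv T N x = ennreal (D x)" "\<And>x. 0 \<le> D x"
    using T.real_RN_deriv[OF N(2) ac sNT] by blast
  have eN: "emeasure N B = (\<integral>\<^sup>+x. ennreal (D x) * indicator B x \<partial>T)" if "B \<in> sets M" for B
  proof -
    have "emeasure N B = emeasure (density T (RN_deriv T N)) B"
      using T.density_RN_deriv[OF ac sNT] by simp
    also have "\<dots> = (\<integral>\<^sup>+x. RN_deriv T N x * indicator B x \<partial>T)"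
      using that sets by (intro emeasure_density) auto
    also have "\<dots> = (\<integral>\<^sup>+x. ennreal (D x) * indicator B x \<partial>T)"
      using D(2) by (intro nn_integral_cong_AE) auto
    finally show ?thesis .
  qed
  have iD: "integrable T D"
  proof (rule integrableI_bounded[OF D(1)])
    have "(\<integral>\<^sup>+x. ennreal (norm (D x)) \<partial>T) = (\<integral>\<^sup>+x. ennreal (D x) * indicator (space M) x \<partial>T)"
      using sets_eq_imp_space_eq[OF sets] D(3) by (intro nn_integral_cong) (auto split: split_indicator)
    also have "\<dots> = emeasure N (space M)" using eN by simp
    also have "\<dots> < \<infinity>" using finite_measure.emeasure_finite[OF N(2)] by (simp add: less_top)
    finally show "(\<integral>\<^sup>+x. ennreal (norm (D x)) \<partial>T) < \<infinity>" .
  qed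
  show ?thesis
  proof (rule that[of "\<lambda>x. D x - 1"])
    show "integrable T (\<lambda>x. D x - 1)" using iD by simp
    fix B assume B: "B \<in> sets M"
    hence B': "B \<in> sets T" using sets by simp
    have "ennreal (\<nu> B + measure T B) = (\<integral>\<^sup>+x. ennreal (indicator B x * D x) \<partial>T)"
      unfolding N(3)[OF B, symmetric] eN[OF B] by (intro nn_integral_cong) (auto split: split_indicator)
    also have "\<dots> = ennreal (\<integral>x. indicator B x * D x \<partial>T)"
      using integrable_indicator_mult[OF iD B'] D(3) by (intro nn_integral_eq_integral) auto
    finally have "\<nu> B + measure T B = (\<integral>x. indicator B x * D x \<partial>T)"
      using bound[OF B] D(3) by (subst (asm) ennreal_inj) (auto intro!: integral_nonneg_AE)
    moreover have "(\<integral>x. indicator B x * (D x - 1) \<partial>T) = (\<integral>x. indicator B x * D x - indicator B x \<partial>T)"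
      by (intro Bochner_Integration.integral_cong) (auto simp: algebra_simps)
    moreover have "\<dots> = (\<integral>x. indicator B x * D x \<partial>T) - measure T B"
      using integrable_indicator_mult[OF iD B'] B' by (subst Bochner_Integration.integral_diff) (auto simp: less_top[symmetric])
    ultimately show "\<nu> B = (\<integral>x. indicator B x * (D x - 1) \<partial>T)" by simp
  qed
qed

lemma AE_nonneg_if_integrals_nonneg:
  fixes g :: "'a \<Rightarrow> real"
  assumes g: "integrable T g" and nn: "\<And>B. B \<in> sets T \<Longrightarrow> 0 \<le> (\<integral>x. indicator B x * g x \<partial>T)"
  shows "AE x in T. 0 \<le> g x"
proof -
  have [measurable]: "g \<in> borel_measurable T" using g by auto
  define B where "B = {x \<in> space T. g x < 0}"
  have B: "B \<in> sets T" unfolding B_def by measurable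
  have i: "integrable T (\<lambda>x. - (indicator B x * g x))" using integrable_indicator_mult[OF g B] by simp
  have nn': "AE x in T. 0 \<le> - (indicator B x * g x)" by (auto simp: B_def split: split_indicator)
  have "0 \<le> (\<integral>x. - (indicator B x * g x) \<partial>T)" using nn' by (rule integral_nonneg_AE)
  hence "(\<integral>x. - (indicator B x * g x) \<partial>T) = 0" using nn[OF B] by simp
  hence "AE x in T. - (indicator B x * g x) = 0" using integral_nonneg_eq_0_iff_AE[OF i nn'] by simp
  thus ?thesis by (rule AE_mp) (auto simp: B_def split: split_indicator)
qed

section \<open>Densities of non-negative Hermitian measures\<close>

lemma nonneg_hermitian_if_form:
  assumes d: "dim_col A = dim_row A" and form: "\<And>v. dim_vec v = dim_row A \<Longrightarrow> 0 \<le> (A *\<^sub>v v) \<bullet>c v"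
  shows "nonneg_hermitian A"
proof -
  define n where "n = dim_row A"
  have [simp]: "dim_row A = n" "dim_col A = n" using d by (auto simp: n_def)
  define D where "D = \<i> \<cdot>\<^sub>m (A - mat_adjoint A)"
  have [simp]: "dim_row D = n" "dim_col D = n" by (auto simp: D_def)
  have hD: "mat_adjoint D = D"
    unfolding D_def by (intro eq_matI) (auto simp: algebra_simps)
  have form0: "(D *\<^sub>v v) \<bullet>c v = 0" if v: "dim_vec v = n" for v
  proof -
    have "(mat_adjoint A *\<^sub>v v) \<bullet>c v = v \<bullet>c (A *\<^sub>v v)"
      using v by (simp add: mat_adjoint_cscalar)
    also have "\<dots> = cnj ((A *\<^sub>v v) \<bullet>c v)"
      using v by (simp add: cscalar_prod_sum mult.commute del: index_mult_mat_vec)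
    also have "\<dots> = (A *\<^sub>v v) \<bullet>c v"
      using form[of v] v by (simp add: less_eq_complex_def complex_eq_iff)
    finally have "((A - mat_adjoint A) *\<^sub>v v) \<bullet>c v = 0"
      using v by (simp add: minus_mat_vec cscalar_minus_left)
    moreover have "(D *\<^sub>v v) \<bullet>c v = \<i> * (((A - mat_adjoint A) *\<^sub>v v) \<bullet>c v)"
      using v by (simp add: D_def cscalar_prod_sum mult_mat_vec_index sum_distrib_left sum_distrib_right mult.assoc del: index_mult_mat_vec)
    ultimately show ?thesis by simp
  qed
  have nD: "nonneg_hermitian D"
    by (rule nonneg_hermitianI) (auto simp: hD form0)
  have "D *\<^sub>v v = 0\<^sub>v n" if "dim_vec v = n" for v
    using nonneg_hermitian_form_zero[OF nD, of v] form0 that by simp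
  hence "D = 0\<^sub>m n n" using mat_zeroI[of D] by simp
  hence D0: "D $$ (i, j) = 0" if "i < n" "j < n" for i j using that by simp
  have "mat_adjoint A $$ (i, j) = A $$ (i, j)" if "i < n" "j < n" for i j
    using D0[OF that] that by (simp add: D_def)
  hence "mat_adjoint A = A" by (intro eq_matI) auto
  from nonneg_hermitianI[OF d this form] show ?thesis .
qed

text \<open>Entries of A are inner products of rows of its square root, so an entry is at most the
  mean of two diagonal entries. The trace therefore dominates every entry, which makes it a
  reference measure.\<close>

lemma nonneg_hermitian_entry_bound:
  assumes "nonneg_hermitian A" "dim_row A = q"
  shows "\<And>k. k < q \<Longrightarrow> 0 \<le> Re (A $$ (k, k))"
    "\<And>i j. i < q \<Longrightarrow> j < q \<Longrightarrow> cmod (A $$ (i, j)) \<le> (\<Sum>k<q. Re (A $$ (k, k)))"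
proof -
  define R where "R = mat_sqrt A"
  have R [simp]: "dim_row R = q" "dim_col R = q" and hR: "mat_adjoint R = R" and RR: "R * R = A"
    using mat_sqrt[OF assms(1)] assms(2) by (auto simp: R_def)
  have A: "A $$ (i, j) = (\<Sum>k<q. R $$ (i, k) * cnj (R $$ (j, k)))" if "i < q" "j < q" for i j
  proof -
    have "A = R * mat_adjoint R" by (simp add: RR hR)
    thus ?thesis using that by (auto simp: scalar_prod_def atLeast0LessThan intro!: sum.cong)
  qed
  have diag: "Re (A $$ (i, i)) = (\<Sum>k<q. (cmod (R $$ (i, k)))\<^sup>2)" if "i < q" for i
  proof -
    have "Re (z * cnj z) = (cmod z)\<^sup>2" for z unfolding cmod_power2 by (simp add: power2_eq_square)
    thus ?thesis unfolding A[OF that that] by (simp only: Re_sum)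
  qed
  show pos: "0 \<le> Re (A $$ (k, k))" if "k < q" for k
    unfolding diag[OF that] by (intro sum_nonneg) auto
  show "cmod (A $$ (i, j)) \<le> (\<Sum>k<q. Re (A $$ (k, k)))" if ij: "i < q" "j < q" for i j
  proof -
    have le: "Re (A $$ (k, k)) \<le> (\<Sum>k<q. Re (A $$ (k, k)))" if "k < q" for k
      using that pos by (intro member_le_sum) auto
    have "cmod (A $$ (i, j)) \<le> (\<Sum>k<q. cmod (R $$ (i, k)) * cmod (R $$ (j, k)))"
      unfolding A[OF ij] by (rule order_trans[OF norm_sum]) (simp add: norm_mult)
    also have "\<dots> \<le> (\<Sum>k<q. ((cmod (R $$ (i, k)))\<^sup>2 + (cmod (R $$ (j, k)))\<^sup>2) / 2)"
    proof (rule sum_mono)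
      fix k
      show "cmod (R $$ (i, k)) * cmod (R $$ (j, k)) \<le> ((cmod (R $$ (i, k)))\<^sup>2 + (cmod (R $$ (j, k)))\<^sup>2) / 2"
        using sum_squares_bound[of "cmod (R $$ (i, k))" "cmod (R $$ (j, k))"] by simp
    qed
    also have "\<dots> = (Re (A $$ (i, i)) + Re (A $$ (j, j))) / 2"
      using ij by (simp add: diag sum.distrib flip: sum_divide_distrib)
    finally show ?thesis using le[OF ij(1)] le[OF ij(2)] by simp
  qed
qed

section \<open>Quadratic forms of the density\<close>

text \<open>Works on functions of two indices, since the values of the density come as separate
  scalar functions and not as matrices.\<close>

definition quad :: "nat \<Rightarrow> (nat \<Rightarrow> nat \<Rightarrow> complex) \<Rightarrow> (nat \<Rightarrow> complex) \<Rightarrow> complex" where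
  "quad q A w = (\<Sum>i<q. \<Sum>j<q. A i j * w j * cnj (w i))"

lemma quad_cong: "(\<And>i. i < q \<Longrightarrow> w i = w' i) \<Longrightarrow> quad q A w = quad q A w'"
  by (simp add: quad_def)

lemma form_eq_quad:
  assumes "A \<in> carrier_mat q q"
  shows "(A *\<^sub>v vec q w) \<bullet>c vec q w = quad q (\<lambda>i j. A $$ (i, j)) w"
  using assms by (simp add: cscalar_prod_sum mult_mat_vec_index quad_def sum_distrib_right del: index_mult_mat_vec)

text \<open>Each test vector brings its own exceptional null set. Countably many vectors with
  rational coordinates keep the union null, and continuity of the form in the vector covers all
  others.\<close>

definition rational_complex :: "complex set" where
  "rational_complex = (\<lambda>(a, b). Complex a b) ` (\<rat> \<times> \<rat>)"

lemma countable_rational_complex: "countable rational_complex"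
  unfolding rational_complex_def by (intro countable_image countable_SIGMA countable_rat)

lemma rational_complex_approx: "\<exists>f. (\<forall>n. f n \<in> rational_complex) \<and> f \<longlonglongrightarrow> (z :: complex)"
proof -
  have "\<exists>f. (\<forall>n. f n \<in> \<rat>) \<and> f \<longlonglongrightarrow> r" for r :: real
  proof -
    have "\<forall>n. \<exists>p\<in>\<rat>. r < p \<and> p < r + inverse (real (Suc n))"
      by (intro allI Rats_dense_in_real) simp
    then obtain f where f: "\<And>n. f n \<in> \<rat>" "\<And>n. r < f n" "\<And>n. f n < r + inverse (real (Suc n))" by metis
    have "f \<longlonglongrightarrow> r"
      by (rule tendsto_sandwich[OF _ _ tendsto_const LIMSEQ_inverse_real_of_nat_add[of r]])
         (use f(2,3) in \<open>auto intro!: always_eventually less_imp_le\<close>)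
    thus ?thesis using f(1) by blast
  qed
  then obtain f g where f: "\<And>n. f n \<in> \<rat>" "f \<longlonglongrightarrow> Re z" and g: "\<And>n. g n \<in> \<rat>" "g \<longlonglongrightarrow> Im z" by metis
  have "(\<lambda>n. Complex (f n) (g n)) \<longlonglongrightarrow> Complex (Re z) (Im z)"
    by (intro tendsto_Complex f g)
  thus ?thesis using f(1) g(1) by (intro exI[of _ "\<lambda>n. Complex (f n) (g n)"]) (auto simp: rational_complex_def)
qed

lemma quad_nonneg_dense:
  assumes "\<And>w. w \<in> {..<q} \<rightarrow>\<^sub>E rational_complex \<Longrightarrow> 0 \<le> quad q A w"
  shows "0 \<le> quad q A w"
proof -
  have "\<forall>i. \<exists>f. (\<forall>n. f n \<in> rational_complex) \<and> f \<longlonglongrightarrow> w i"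
    using rational_complex_approx by blast
  from choice[OF this] obtain f
    where f: "\<And>i n. f i n \<in> rational_complex" "\<And>i. f i \<longlonglongrightarrow> w i" by blast
  have "0 \<le> quad q A (\<lambda>i. f i n)" for n
  proof -
    have "quad q A (\<lambda>i. f i n) = quad q A (restrict (\<lambda>i. f i n) {..<q})" by (rule quad_cong) simp
    thus ?thesis using assms[of "restrict (\<lambda>i. f i n) {..<q}"] f(1) by auto
  qed
  moreover have lim: "(\<lambda>n. quad q A (\<lambda>i. f i n)) \<longlonglongrightarrow> quad q A w"
    unfolding quad_def by (intro tendsto_sum tendsto_mult tendsto_const tendsto_cnj f)
  ultimately have "0 \<le> Re (quad q A w)" "Im (quad q A w) = 0"
    using LIMSEQ_le_const[OF tendsto_Re[OF lim], of 0] LIMSEQ_unique[OF tendsto_Im[OF lim], of 0]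
    by (auto simp: less_eq_complex_def)
  thus ?thesis by (simp add: less_eq_complex_def)
qed

text \<open>The reference measure is the trace of \<open>\<sigma>\<close>.\<close>

lemma nonneg_hermitian_measure_density:
  assumes sig: "\<sigma> \<in> nonneg_hermitian_measures q \<alpha>"
  obtains T F where "sets T = sets (half_line \<alpha>)"
    "\<And>i j. i < q \<Longrightarrow> j < q \<Longrightarrow> integrable T (F i j)"
    "\<And>i j B. i < q \<Longrightarrow> j < q \<Longrightarrow> B \<in> sets (half_line \<alpha>) \<Longrightarrow> \<sigma> B $$ (i, j) = (\<integral>x. indicator B x * F i j x \<partial>T)"
    "AE x in T. \<forall>w. 0 \<le> quad q (\<lambda>i j. F i j x) w"
proof -
  let ?M = "half_line \<alpha>"
  have s: "\<sigma> B \<in> carrier_mat q q" "nonneg_hermitian (\<sigma> B)" if "B \<in> sets ?M" for B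
    using sig that by (auto simp: nonneg_hermitian_measures_def)
  have add: "(\<lambda>n. \<sigma> (G n) $$ (i, j)) sums (\<sigma> (\<Union>n. G n) $$ (i, j))"
    if "range G \<subseteq> sets ?M" "disjoint_family G" "i < q" "j < q" for G :: "nat \<Rightarrow> real set" and i j
    using sig that by (auto simp: nonneg_hermitian_measures_def)
  define tr where "tr B = (\<Sum>k<q. Re (\<sigma> B $$ (k, k)))" for B
  have tr0: "0 \<le> tr B" if "B \<in> sets ?M" for B
    unfolding tr_def using nonneg_hermitian_entry_bound(1)[OF s(2)[OF that]] s(1)[OF that] by (intro sum_nonneg) auto
  obtain T where T: "sets T = sets ?M" "finite_measure T" "\<And>B. B \<in> sets ?M \<Longrightarrow> emeasure T B = ennreal (tr B)"
  proof (rule measure_of_real_additive[of ?M tr])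
    show "(\<lambda>n. tr (G n)) sums tr (\<Union>n. G n)" if "range G \<subseteq> sets ?M" "disjoint_family G" for G :: "nat \<Rightarrow> real set"
      unfolding tr_def using add[OF that] by (intro sums_sum sums_Re) auto
  qed (use tr0 in blast)+
  have mT: "measure T B = tr B" if "B \<in> sets ?M" for B
    using T(3)[OF that] tr0[OF that] by (simp add: measure_def)
  have bound: "cmod (\<sigma> B $$ (i, j)) \<le> measure T B" if "B \<in> sets ?M" "i < q" "j < q" for B i j
    unfolding mT[OF that(1)] tr_def using nonneg_hermitian_entry_bound(2)[OF s(2)[OF that(1)]] s(1)[OF that(1)] that by auto
  have ex: "\<exists>F. integrable T F \<and> (\<forall>B\<in>sets ?M. \<sigma> B $$ (i, j) = (\<integral>x. indicator B x * F x \<partial>T))"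
    if ij: "i < q" "j < q" for i j
  proof -
    obtain h where h: "integrable T h" "\<And>B. B \<in> sets ?M \<Longrightarrow> Re (\<sigma> B $$ (i, j)) = (\<integral>x. indicator B x * h x \<partial>T)"
    proof (rule signed_density_exists[OF T(1,2), of "\<lambda>B. Re (\<sigma> B $$ (i, j))"])
      show "(\<lambda>n. Re (\<sigma> (G n) $$ (i, j))) sums Re (\<sigma> (\<Union>n. G n) $$ (i, j))"
        if "range G \<subseteq> sets ?M" "disjoint_family G" for G :: "nat \<Rightarrow> real set"
        by (intro sums_Re add that ij)
      show "\<bar>Re (\<sigma> B $$ (i, j))\<bar> \<le> measure T B" if "B \<in> sets ?M" for B
        using bound[OF that ij] abs_Re_le_cmod order_trans by blast
    qed blast
    obtain g where g: "integrable T g" "\<And>B. B \<in> sets ?M \<Longrightarrow> Im (\<sigma> B $$ (i, j)) = (\<integral>x. indicator B x * g x \<partial>T)"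
    proof (rule signed_density_exists[OF T(1,2), of "\<lambda>B. Im (\<sigma> B $$ (i, j))"])
      show "(\<lambda>n. Im (\<sigma> (G n) $$ (i, j))) sums Im (\<sigma> (\<Union>n. G n) $$ (i, j))"
        if "range G \<subseteq> sets ?M" "disjoint_family G" for G :: "nat \<Rightarrow> real set"
        by (intro sums_Im add that ij)
      show "\<bar>Im (\<sigma> B $$ (i, j))\<bar> \<le> measure T B" if "B \<in> sets ?M" for B
        using bound[OF that ij] abs_Im_le_cmod order_trans by blast
    qed blast
    have i: "integrable T (\<lambda>x. Complex (h x) (g x))"
      by (subst complex_integrable_iff) (use h g in auto)
    have "\<sigma> B $$ (i, j) = (\<integral>x. indicator B x * Complex (h x) (g x) \<partial>T)" if B: "B \<in> sets ?M" for B
    proof -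
      have iB: "integrable T (\<lambda>x. indicator B x * Complex (h x) (g x))"
        using integrable_indicator_mult[OF i] B T(1) by simp
      have "Re (\<integral>x. indicator B x * Complex (h x) (g x) \<partial>T) = (\<integral>x. indicator B x * h x \<partial>T)"
        unfolding integral_Re[OF iB, symmetric] by (intro Bochner_Integration.integral_cong) (auto split: split_indicator)
      moreover have "Im (\<integral>x. indicator B x * Complex (h x) (g x) \<partial>T) = (\<integral>x. indicator B x * g x \<partial>T)"
        unfolding integral_Im[OF iB, symmetric] by (intro Bochner_Integration.integral_cong) (auto split: split_indicator)
      ultimately show ?thesis using h(2)[OF B] g(2)[OF B] by (simp add: complex_eq_iff)
    qed
    thus ?thesis using i by blast
  qed
  then obtain F where F: "\<And>i j. i < q \<Longrightarrow> j < q \<Longrightarrow> integrable T (F i j)"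
    "\<And>i j B. i < q \<Longrightarrow> j < q \<Longrightarrow> B \<in> sets ?M \<Longrightarrow> \<sigma> B $$ (i, j) = (\<integral>x. indicator B x * F i j x \<partial>T)"
    by metis
  have AE1: "AE x in T. 0 \<le> quad q (\<lambda>i j. F i j x) w" for w
  proof -
    let ?g = "\<lambda>x. quad q (\<lambda>i j. F i j x) w"
    have ig: "integrable T ?g"
      unfolding quad_def by (intro Bochner_Integration.integrable_sum integrable_mult_left F) auto
    have int: "(\<integral>x. indicator B x * ?g x \<partial>T) = (\<sigma> B *\<^sub>v vec q w) \<bullet>c vec q w" if B: "B \<in> sets T" for B
    proof -
      have B': "B \<in> sets ?M" using B T(1) by simp
      have "(\<integral>x. indicator B x * ?g x \<partial>T) = (\<integral>x. (\<Sum>i<q. \<Sum>j<q. indicator B x * F i j x * w j * cnj (w i)) \<partial>T)"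
        by (simp add: quad_def sum_distrib_left mult.assoc)
      also have "\<dots> = (\<Sum>i<q. \<Sum>j<q. (\<integral>x. indicator B x * F i j x \<partial>T) * w j * cnj (w i))"
        using integrable_indicator_mult[OF F(1) B]
        by (subst Bochner_Integration.integral_sum, (intro Bochner_Integration.integrable_sum integrable_mult_left; simp),
            intro sum.cong refl, subst Bochner_Integration.integral_sum) auto
      also have "\<dots> = quad q (\<lambda>i j. \<sigma> B $$ (i, j)) w"
        unfolding quad_def using F(2) B' by (intro sum.cong) auto
      also have "\<dots> = (\<sigma> B *\<^sub>v vec q w) \<bullet>c vec q w" using form_eq_quad[OF s(1)[OF B']] by simp
      finally show ?thesis .
    qed
    have pos: "0 \<le> (\<integral>x. indicator B x * ?g x \<partial>T)" if B: "B \<in> sets T" for B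
      unfolding int[OF B] using s[of B] B T(1) by (intro nonneg_hermitianD(3)) auto
    have ReIm: "(\<integral>x. indicator B x * Re (?g x) \<partial>T) = Re (\<integral>x. indicator B x * ?g x \<partial>T)"
      "(\<integral>x. indicator B x * Im (?g x) \<partial>T) = Im (\<integral>x. indicator B x * ?g x \<partial>T)" if B: "B \<in> sets T" for B
      unfolding integral_Re[OF integrable_indicator_mult[OF ig B], symmetric] integral_Im[OF integrable_indicator_mult[OF ig B], symmetric]
      by (intro Bochner_Integration.integral_cong; auto split: split_indicator)+
    have "AE x in T. 0 \<le> Re (?g x)"
      by (rule AE_nonneg_if_integrals_nonneg) (use ig pos ReIm in \<open>auto simp: less_eq_complex_def\<close>)
    \<comment> \<open>The order on the complex numbers also demands a vanishing imaginary part,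
      obtained from both signs.\<close>
    moreover have "AE x in T. 0 \<le> Im (?g x)"
      by (rule AE_nonneg_if_integrals_nonneg) (use ig pos ReIm in \<open>auto simp: less_eq_complex_def\<close>)
    moreover have "AE x in T. 0 \<le> - Im (?g x)"
      by (rule AE_nonneg_if_integrals_nonneg) (use ig pos ReIm in \<open>auto simp: less_eq_complex_def\<close>)
    ultimately show ?thesis by eventually_elim (simp add: less_eq_complex_def)
  qed
  have "countable ({..<q} \<rightarrow>\<^sub>E rational_complex)"
    by (intro countable_PiE countable_rational_complex) auto
  hence "AE x in T. \<forall>w\<in>{..<q} \<rightarrow>\<^sub>E rational_complex. 0 \<le> quad q (\<lambda>i j. F i j x) w"
    using AE1 by (simp add: AE_ball_countable)
  hence "AE x in T. \<forall>w. 0 \<le> quad q (\<lambda>i j. F i j x) w"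
    by eventually_elim (auto intro: quad_nonneg_dense)
  thus ?thesis using that[OF T(1) F] by blast
qed

section \<open>Moments of a density\<close>

definition vec_poly :: "nat \<Rightarrow> nat \<Rightarrow> complex vec \<Rightarrow> real \<Rightarrow> nat \<Rightarrow> complex" where
  "vec_poly q n u x b = (\<Sum>k<n. u $ (k * q + b) * complex_of_real (x ^ k))"

lemma vec_poly_lin_mult:
  assumes "b < q"
  shows "vec_poly q (Suc n) (lin_mult q \<alpha> n u) x b = complex_of_real (x - \<alpha>) * vec_poly q n u x b"
proof -
  define r where "r = lin_mult q \<alpha> n u"
  \<comment> \<open>A Kronecker delta in the inner index brings the evaluation at component b into
    the form of \<open>sum_lin_mult\<close>.\<close>
  have pick: "(\<Sum>c<q. (if c = b then z else 0) * y c) = z * y b" for z and y :: "nat \<Rightarrow> complex"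
    using assms by (simp add: if_distrib[of "\<lambda>z. z * _"] cong: if_cong)
  have "vec_poly q (Suc n) r x b = (\<Sum>k<Suc n. \<Sum>c<q. (if c = b then complex_of_real (x ^ k) else 0) * r $ (k * q + c))"
    unfolding vec_poly_def pick by (simp only: mult.commute)
  also have "\<dots> = (\<Sum>k<n. \<Sum>c<q. (if c = b then complex_of_real (x ^ Suc k) else 0) * u $ (k * q + c)) -
      \<alpha> * (\<Sum>k<n. \<Sum>c<q. (if c = b then complex_of_real (x ^ k) else 0) * u $ (k * q + c))"
    unfolding r_def by (rule sum_lin_mult)
  also have "\<dots> = complex_of_real (x - \<alpha>) * vec_poly q n u x b"
    unfolding vec_poly_def pick
    by (simp add: sum_distrib_left left_diff_distrib right_diff_distrib sum_subtractf mult_ac)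
  finally show ?thesis unfolding r_def .
qed

lemma quad_scale: "quad q A (\<lambda>i. complex_of_real c * w i) = complex_of_real (c\<^sup>2) * quad q A w"
  by (simp add: quad_def sum_distrib_left power2_eq_square mult_ac)

text \<open>\<open>T\<close> and \<open>F\<close> are the trace measure and the density of a solution.\<close>

locale moment_density =
  fixes q :: nat and \<alpha> :: real and T :: "real measure" and F :: "nat \<Rightarrow> nat \<Rightarrow> real \<Rightarrow> complex"
  assumes ge: "AE x in T. \<alpha> \<le> x"
    and pos: "AE x in T. \<forall>w. 0 \<le> quad q (\<lambda>i j. F i j x) w"
begin

abbreviation "Q x w \<equiv> quad q (\<lambda>i j. F i j x) w"

text \<open>The weight \<open>g\<close> is 1 for the moments and x - \<alpha> for the shifted
  sequence, so one computation serves both kinds of levels.\<close>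

lemma block_hankel_form_integral:
  fixes g :: "real \<Rightarrow> real"
  assumes y: "\<And>j a b. j + 2 \<le> 2 * n \<Longrightarrow> a < q \<Longrightarrow> b < q \<Longrightarrow>
      integrable T (\<lambda>x. F a b x * complex_of_real (g x * x ^ j)) \<and>
      y j $$ (a, b) = (\<integral>x. F a b x * complex_of_real (g x * x ^ j) \<partial>T)"
    and u: "dim_vec u = n * q"
  shows "integrable T (\<lambda>x. g x * Q x (vec_poly q n u x))"
    "(block_hankel q y n *\<^sub>v u) \<bullet>c u = (\<integral>x. g x * Q x (vec_poly q n u x) \<partial>T)"
proof -
  let ?c = "\<lambda>i a k b. u $ (k * q + b) * cnj (u $ (i * q + a))"
  let ?h = "\<lambda>i a k b x. F a b x * complex_of_real (g x * x ^ (i + k)) * ?c i a k b"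
  have i: "integrable T (?h i a k b)" if "i < n" "k < n" "a < q" "b < q" for i a k b
    using y[of "i + k" a b] that by (intro integrable_mult_left) auto
  have expand: "(\<lambda>x. g x * Q x (vec_poly q n u x)) = (\<lambda>x. \<Sum>i<n. \<Sum>a<q. \<Sum>k<n. \<Sum>b<q. ?h i a k b x)"
  proof
    fix x
    have "g x * Q x (vec_poly q n u x) = (\<Sum>a<q. \<Sum>b<q. \<Sum>k<n. \<Sum>i<n. ?h i a k b x)"
      unfolding quad_def vec_poly_def
      by (simp add: sum_distrib_left sum_distrib_right power_add mult_ac)
    also have "\<dots> = (\<Sum>a<q. \<Sum>b<q. \<Sum>i<n. \<Sum>k<n. ?h i a k b x)"
      by (intro sum.cong refl sum.swap)
    also have "\<dots> = (\<Sum>a<q. \<Sum>i<n. \<Sum>b<q. \<Sum>k<n. ?h i a k b x)"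
      by (intro sum.cong refl sum.swap)
    also have "\<dots> = (\<Sum>i<n. \<Sum>a<q. \<Sum>b<q. \<Sum>k<n. ?h i a k b x)"
      by (rule sum.swap)
    also have "\<dots> = (\<Sum>i<n. \<Sum>a<q. \<Sum>k<n. \<Sum>b<q. ?h i a k b x)"
      by (intro sum.cong refl sum.swap)
    finally show "g x * Q x (vec_poly q n u x) = (\<Sum>i<n. \<Sum>a<q. \<Sum>k<n. \<Sum>b<q. ?h i a k b x)" .
  qed
  show "integrable T (\<lambda>x. g x * Q x (vec_poly q n u x))"
    unfolding expand by (intro Bochner_Integration.integrable_sum i) auto
  have "(block_hankel q y n *\<^sub>v u) \<bullet>c u = (\<Sum>i<n. \<Sum>a<q. \<Sum>k<n. \<Sum>b<q. y (i + k) $$ (a, b) * ?c i a k b)"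
    unfolding block_hankel_form[OF u] hankel_act_def by (simp add: sum_distrib_right mult.assoc)
  also have "\<dots> = (\<Sum>i<n. \<Sum>a<q. \<Sum>k<n. \<Sum>b<q. (\<integral>x. ?h i a k b x \<partial>T))"
    by (intro sum.cong refl) (use y in \<open>subst integral_mult_left_zero, auto\<close>)
  also have "\<dots> = (\<integral>x. (\<Sum>i<n. \<Sum>a<q. \<Sum>k<n. \<Sum>b<q. ?h i a k b x) \<partial>T)"
  proof -
    have "(\<integral>x. (\<Sum>i<n. \<Sum>a<q. \<Sum>k<n. \<Sum>b<q. ?h i a k b x) \<partial>T) =
      (\<Sum>i<n. (\<integral>x. (\<Sum>a<q. \<Sum>k<n. \<Sum>b<q. ?h i a k b x) \<partial>T))"
      by (intro Bochner_Integration.integral_sum Bochner_Integration.integrable_sum i) auto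
    also have "\<dots> = (\<Sum>i<n. \<Sum>a<q. (\<integral>x. (\<Sum>k<n. \<Sum>b<q. ?h i a k b x) \<partial>T))"
      by (intro sum.cong refl Bochner_Integration.integral_sum Bochner_Integration.integrable_sum i) auto
    also have "\<dots> = (\<Sum>i<n. \<Sum>a<q. \<Sum>k<n. (\<integral>x. (\<Sum>b<q. ?h i a k b x) \<partial>T))"
      by (intro sum.cong refl Bochner_Integration.integral_sum Bochner_Integration.integrable_sum i) auto
    also have "\<dots> = (\<Sum>i<n. \<Sum>a<q. \<Sum>k<n. \<Sum>b<q. (\<integral>x. ?h i a k b x \<partial>T))"
      by (intro sum.cong refl Bochner_Integration.integral_sum Bochner_Integration.integrable_sum i) auto
    finally show ?thesis by simp
  qed
  finally show "(block_hankel q y n *\<^sub>v u) \<bullet>c u = (\<integral>x. g x * Q x (vec_poly q n u x) \<partial>T)" unfolding expand .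
qed

lemma integral_Q_nonneg:
  fixes g :: "real \<Rightarrow> real"
  assumes g: "AE x in T. 0 \<le> g x" and i: "integrable T (\<lambda>x. g x * Q x (w x))"
  shows "0 \<le> (\<integral>x. g x * Q x (w x) \<partial>T)"
    "(\<integral>x. g x * Q x (w x) \<partial>T) = 0 \<Longrightarrow> AE x in T. g x * Q x (w x) = 0"
proof -
  have nn: "AE x in T. 0 \<le> g x * Q x (w x)"
    using g pos by eventually_elim (simp add: less_eq_complex_def)
  hence re: "AE x in T. 0 \<le> Re (g x * Q x (w x))" and im: "AE x in T. Im (g x * Q x (w x)) = 0"
    by (eventually_elim, simp add: less_eq_complex_def)+
  have "0 \<le> Re (\<integral>x. g x * Q x (w x) \<partial>T)"
    unfolding integral_Re[OF i, symmetric] by (rule integral_nonneg_AE[OF re])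
  moreover have "(\<integral>x. Im (g x * Q x (w x)) \<partial>T) = (\<integral>x. 0 \<partial>T)"
    using im by (intro integral_cong_AE borel_measurable_integrable[OF integrable_Im[OF i]]) auto
  hence "Im (\<integral>x. g x * Q x (w x) \<partial>T) = 0"
    unfolding integral_Im[OF i, symmetric] by simp
  ultimately show "0 \<le> (\<integral>x. g x * Q x (w x) \<partial>T)" by (simp add: less_eq_complex_def)
  assume "(\<integral>x. g x * Q x (w x) \<partial>T) = 0"
  hence "(\<integral>x. Re (g x * Q x (w x)) \<partial>T) = 0" using integral_Re[OF i] by simp
  hence "AE x in T. Re (g x * Q x (w x)) = 0"
    using integral_nonneg_eq_0_iff_AE[OF integrable_Re[OF i] re] by simp
  with im show "AE x in T. g x * Q x (w x) = 0" by eventually_elim (simp add: complex_eq_iff)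
qed

context
  fixes t :: "nat \<Rightarrow> complex mat" and m :: nat
  assumes tc: "\<And>j. j \<le> m \<Longrightarrow> t j \<in> carrier_mat q q"
    and mom: "\<And>j a b. j \<le> m \<Longrightarrow> a < q \<Longrightarrow> b < q \<Longrightarrow>
      integrable T (\<lambda>x. F a b x * complex_of_real (x ^ j)) \<and>
      t j $$ (a, b) = (\<integral>x. F a b x * complex_of_real (x ^ j) \<partial>T)"
begin

text \<open>A form with n blocks reaches the moment of order 2 n - 2, and in
  \<open>form_shifted\<close> that of order 2 n - 1; hence the two bounds. The factor
  \<open>complex_of_real 1\<close> keeps the shape of the weight in
  \<open>integral_Q_nonneg\<close>.\<close>

lemma form_plain:
  assumes "2 * n \<le> Suc (Suc m)" "dim_vec u = n * q"
  shows "integrable T (\<lambda>x. complex_of_real 1 * Q x (vec_poly q n u x))"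
    "(block_hankel q t n *\<^sub>v u) \<bullet>c u = (\<integral>x. complex_of_real 1 * Q x (vec_poly q n u x) \<partial>T)"
proof -
  have *: "integrable T (\<lambda>x. F a b x * complex_of_real (1 * x ^ j)) \<and>
      t j $$ (a, b) = (\<integral>x. F a b x * complex_of_real (1 * x ^ j) \<partial>T)"
    if "j + 2 \<le> 2 * n" "a < q" "b < q" for j a b
    using mom[of j a b] that assms(1) by simp
  show "integrable T (\<lambda>x. complex_of_real 1 * Q x (vec_poly q n u x))"
    "(block_hankel q t n *\<^sub>v u) \<bullet>c u = (\<integral>x. complex_of_real 1 * Q x (vec_poly q n u x) \<partial>T)"
    by (rule block_hankel_form_integral[OF * assms(2)]; assumption)+
qed

lemma form_shifted:
  assumes "2 * n \<le> Suc m" "dim_vec u = n * q"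
  shows "integrable T (\<lambda>x. complex_of_real (x - \<alpha>) * Q x (vec_poly q n u x))"
    "(block_hankel q (shifted \<alpha> t) n *\<^sub>v u) \<bullet>c u = (\<integral>x. complex_of_real (x - \<alpha>) * Q x (vec_poly q n u x) \<partial>T)"
proof -
  have *: "integrable T (\<lambda>x. F a b x * complex_of_real ((x - \<alpha>) * x ^ j)) \<and>
      shifted \<alpha> t j $$ (a, b) = (\<integral>x. F a b x * complex_of_real ((x - \<alpha>) * x ^ j) \<partial>T)"
    if "j + 2 \<le> 2 * n" "a < q" "b < q" for j a b
  proof -
    have j: "Suc j \<le> m" "j \<le> m" using that assms by auto
    note i = mom[OF j(1) that(2,3)] mom[OF j(2) that(2,3)]
    have e: "F a b x * complex_of_real ((x - \<alpha>) * x ^ j) =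
      F a b x * complex_of_real (x ^ Suc j) - \<alpha> * (F a b x * complex_of_real (x ^ j))" for x
      by (simp add: algebra_simps)
    have "shifted \<alpha> t j $$ (a, b) = t (Suc j) $$ (a, b) - \<alpha> * t j $$ (a, b)"
      using tc[OF j(1)] tc[OF j(2)] that by (simp add: shifted_def)
    also have "\<dots> = (\<integral>x. F a b x * complex_of_real ((x - \<alpha>) * x ^ j) \<partial>T)"
      unfolding e using i by (subst Bochner_Integration.integral_diff) auto
    finally show ?thesis unfolding e using i by (auto intro!: Bochner_Integration.integrable_diff)
  qed
  show "integrable T (\<lambda>x. complex_of_real (x - \<alpha>) * Q x (vec_poly q n u x))"
    "(block_hankel q (shifted \<alpha> t) n *\<^sub>v u) \<bullet>c u = (\<integral>x. complex_of_real (x - \<alpha>) * Q x (vec_poly q n u x) \<partial>T)"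
    by (rule block_hankel_form_integral[OF * assms(2)]; assumption)+
qed

lemma ge': "AE x in T. 0 \<le> x - \<alpha>" using ge by eventually_elim simp

lemma level_mat_moments_nonneg:
  assumes "k \<le> m"
  shows "nonneg_hermitian (level_mat q \<alpha> k t)"
proof (rule nonneg_hermitian_if_form)
  fix v :: "complex vec" assume "dim_vec v = dim_row (level_mat q \<alpha> k t)"
  hence v: "dim_vec v = Suc (k div 2) * q" by simp
  show "0 \<le> (level_mat q \<alpha> k t *\<^sub>v v) \<bullet>c v"
  proof (cases "even k")
    case True
    hence "2 * Suc (k div 2) \<le> Suc (Suc m)" using assms by auto
    from form_plain[OF this v] show ?thesis
      using True integral_Q_nonneg(1)[of "\<lambda>_. 1"] by (simp add: level_mat_def level_seq_def)
  next
    case False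
    hence "2 * Suc (k div 2) \<le> Suc m" using assms by presburger
    from form_shifted[OF this v] show ?thesis
      using False integral_Q_nonneg(1)[OF ge'] by (simp add: level_mat_def level_seq_def)
  qed
qed auto

lemma Qmat_moments_kernel:
  assumes m: "m > 0" and ms: "mat_seq q m t"
    and v: "dim_vec v = q" "Qmat q \<alpha> t (m - 1) *\<^sub>v v = 0\<^sub>v q"
  shows "Qmat q \<alpha> t m *\<^sub>v v = 0\<^sub>v q"
proof -
  have nn: "nonneg_hermitian (level_mat q \<alpha> m t)" "nonneg_hermitian (level_mat q \<alpha> (m - 1) t)"
    by (auto intro: level_mat_moments_nonneg)
  obtain u where u: "dim_vec u = Suc ((m - 1) div 2) * q" "vec_last u q = v"
    "level_mat q \<alpha> (m - 1) t *\<^sub>v u = 0\<^sub>v (Suc ((m - 1) div 2) * q)"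
    using Qmat_kernel[OF mat_seq_mono[OF ms] nn(2) v(1)] v(2) by auto
  have "(level_mat q \<alpha> (m - 1) t *\<^sub>v u) \<bullet>c u = 0" using u(1) unfolding u(3) by simp
  note form0 = this
  have "\<exists>r. dim_vec r = Suc (m div 2) * q \<and> vec_last r q = v \<and> (level_mat q \<alpha> m t *\<^sub>v r) \<bullet>c r = 0"
  proof (cases "even m")
    case True
    then obtain n where n: "m = 2 * n" "n > 0" using m by auto
    have d: "Suc ((m - 1) div 2) = n" "m div 2 = n" "odd (m - 1)" using n by presburger+
    have du: "dim_vec u = n * q" using u(1) unfolding d(1) .
    have lv: "level_mat q \<alpha> (m - 1) t = block_hankel q (shifted \<alpha> t) n" "level_mat q \<alpha> m t = block_hankel q t (Suc n)"
      using True d by (auto simp: level_mat_def level_seq_def)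
    note fs = form_shifted[OF _ du]
    have "AE x in T. complex_of_real (x - \<alpha>) * Q x (vec_poly q n u x) = 0"
      by (rule integral_Q_nonneg(2)[OF ge']) (use fs n(1) form0[unfolded lv(1)] in auto)
    \<comment> \<open>Weight 1 for the product with X - \<alpha> is weight (x - \<alpha>)^2 for
      \<open>u\<close>, a multiple of the expression that vanishes almost everywhere.\<close>
    hence z: "AE x in T. complex_of_real 1 * Q x (vec_poly q (Suc n) (lin_mult q \<alpha> n u) x) = 0"
    proof eventually_elim
      case (elim x)
      have "Q x (vec_poly q (Suc n) (lin_mult q \<alpha> n u) x) = Q x (\<lambda>b. complex_of_real (x - \<alpha>) * vec_poly q n u x b)"
        by (rule quad_cong) (simp add: vec_poly_lin_mult)
      also have "\<dots> = complex_of_real (x - \<alpha>) * (complex_of_real (x - \<alpha>) * Q x (vec_poly q n u x))"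
        unfolding quad_scale by (simp add: power2_eq_square)
      finally show ?case using elim by simp
    qed
    note fp = form_plain[of "Suc n" "lin_mult q \<alpha> n u"]
    have "(\<integral>x. complex_of_real 1 * Q x (vec_poly q (Suc n) (lin_mult q \<alpha> n u) x) \<partial>T) = (\<integral>x. 0 \<partial>T)"
      by (rule integral_cong_AE) (use z fp(1) n in \<open>auto intro: borel_measurable_integrable\<close>)
    hence "(level_mat q \<alpha> m t *\<^sub>v lin_mult q \<alpha> n u) \<bullet>c lin_mult q \<alpha> n u = 0"
      unfolding lv(2) using fp(2) n(1) by simp
    thus ?thesis using vec_last_lin_mult[OF n(2) du] u(2) d by (intro exI[of _ "lin_mult q \<alpha> n u"]) simp
  next
    case False
    then obtain n where n: "m = 2 * n + 1" by (elim oddE)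
    have d: "Suc ((m - 1) div 2) = Suc n" "m div 2 = n" using n by auto
    have du: "dim_vec u = Suc n * q" using u(1) unfolding d(1) .
    have lv: "level_mat q \<alpha> (m - 1) t = block_hankel q t (Suc n)" "level_mat q \<alpha> m t = block_hankel q (shifted \<alpha> t) (Suc n)"
      using False n by (auto simp: level_mat_def level_seq_def)
    note fp = form_plain[OF _ du]
    have "AE x in T. complex_of_real 1 * Q x (vec_poly q (Suc n) u x) = 0"
      by (rule integral_Q_nonneg(2)) (use fp n form0[unfolded lv(1)] in auto)
    \<comment> \<open>For odd m the polynomial stays the same, and the extra factor is absorbed by
      the weight of the shifted level.\<close>
    hence z: "AE x in T. complex_of_real (x - \<alpha>) * Q x (vec_poly q (Suc n) u x) = 0"
      by eventually_elim simp
    note fs = form_shifted[OF _ du]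
    have "(\<integral>x. complex_of_real (x - \<alpha>) * Q x (vec_poly q (Suc n) u x) \<partial>T) = (\<integral>x. 0 \<partial>T)"
      by (rule integral_cong_AE) (use z fs(1) n in \<open>auto intro: borel_measurable_integrable\<close>)
    hence "(level_mat q \<alpha> m t *\<^sub>v u) \<bullet>c u = 0" unfolding lv(2) using fs(2) n by simp
    thus ?thesis using du u(2) d by (intro exI[of _ u]) simp
  qed
  then obtain r where r: "dim_vec r = Suc (m div 2) * q" "vec_last r q = v" "(level_mat q \<alpha> m t *\<^sub>v r) \<bullet>c r = 0" by blast
  have "level_mat q \<alpha> m t *\<^sub>v r = 0\<^sub>v (Suc (m div 2) * q)"
    using nonneg_hermitian_form_zero[OF nn(1) _ r(3)] r(1) by simp
  thus ?thesis using Qmat_kernel[OF ms nn(1) v(1)] r by blast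
qed

end

end

section \<open>Solutions and uniqueness\<close>

lemma power_measurable_half_line: "(\<lambda>x. x ^ k) \<in> borel_measurable (half_line \<alpha>)" for k :: nat
  by (rule measurable_restrict_space1) measurable

lemma moment_density_solution:
  assumes sig: "\<sigma> \<in> nonneg_hermitian_measures q \<alpha>" and ex: "moment_exists q \<alpha> \<sigma> m"
  obtains T F where "moment_density q \<alpha> T F"
    "\<And>j a b. j \<le> m \<Longrightarrow> a < q \<Longrightarrow> b < q \<Longrightarrow>
      integrable T (\<lambda>x. F a b x * complex_of_real (x ^ j)) \<and>
      moment q \<alpha> \<sigma> j $$ (a, b) = (\<integral>x. F a b x * complex_of_real (x ^ j) \<partial>T)"
proof -
  obtain T F where T: "sets T = sets (half_line \<alpha>)"
    and F: "\<And>i j. i < q \<Longrightarrow> j < q \<Longrightarrow> integrable T (F i j)"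
      "\<And>i j B. i < q \<Longrightarrow> j < q \<Longrightarrow> B \<in> sets (half_line \<alpha>) \<Longrightarrow> \<sigma> B $$ (i, j) = (\<integral>x. indicator B x * F i j x \<partial>T)"
    and pos: "AE x in T. \<forall>w. 0 \<le> quad q (\<lambda>i j. F i j x) w"
    using nonneg_hermitian_measure_density[OF sig] by blast
  have "space T = {\<alpha>..}" using sets_eq_imp_space_eq[OF T] by (simp add: space_restrict_space)
  hence "AE x in T. \<alpha> \<le> x" by (intro AE_I2) auto
  hence "moment_density q \<alpha> T F" using pos by unfold_locales
  moreover have "integrable T (\<lambda>x. F a b x * complex_of_real (x ^ j)) \<and>
      moment q \<alpha> \<sigma> j $$ (a, b) = (\<integral>x. F a b x * complex_of_real (x ^ j) \<partial>T)"
    if j: "j \<le> m" and ab: "a < q" "b < q" for j a b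
  proof -
    note D = cmeasure_integral_density[OF T F(1)[OF ab] power_measurable_half_line F(2)[OF ab]]
    have im: "integrable T (\<lambda>x. F a b x * complex_of_real (x ^ m))"
      using ex ab D(1)[of m] by (auto simp: moment_exists_def)
    have pm: "(\<lambda>x. x ^ j) \<in> borel_measurable T"
      unfolding measurable_cong_sets[OF T refl] by (rule power_measurable_half_line)
    have ij: "integrable T (\<lambda>x. F a b x * complex_of_real (x ^ j))"
    proof (rule Bochner_Integration.integrable_bound)
      show "integrable T (\<lambda>x. norm (F a b x) + norm (F a b x * complex_of_real (x ^ m)))"
        by (intro Bochner_Integration.integrable_add integrable_norm F(1) ab im)
      show "(\<lambda>x. F a b x * complex_of_real (x ^ j)) \<in> borel_measurable T"
        using pm borel_measurable_integrable[OF F(1)[OF ab]] by measurable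
      \<comment> \<open>\<open>moment_exists\<close> provides only order m. Lower orders are
        dominated by order m together with the density itself, which is integrable.\<close>
      have "\<bar>x\<bar> ^ j \<le> 1 + \<bar>x\<bar> ^ m" for x :: real
      proof (cases "\<bar>x\<bar> \<le> 1")
        case True
        hence "\<bar>x\<bar> ^ j \<le> 1" by (intro power_le_one) auto
        thus ?thesis by (smt (verit) zero_le_power abs_ge_zero)
      next
        case False
        hence "\<bar>x\<bar> ^ j \<le> \<bar>x\<bar> ^ m" using j by (intro power_increasing) auto
        thus ?thesis by simp
      qed
      hence "norm (F a b x) * \<bar>x\<bar> ^ j \<le> norm (F a b x) * (1 + \<bar>x\<bar> ^ m)" for x
        by (intro mult_left_mono) auto
      thus "AE x in T. norm (F a b x * complex_of_real (x ^ j)) \<le>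
          norm (norm (F a b x) + norm (F a b x * complex_of_real (x ^ m)))"
        by (intro AE_I2) (simp add: norm_mult norm_power power_abs distrib_left)
    qed
    moreover have "moment q \<alpha> \<sigma> j $$ (a, b) = (\<integral>x. F a b x * complex_of_real (x ^ j) \<partial>T)"
      using D(2)[OF _ ij] ab by (simp add: moment_def)
    ultimately show ?thesis by simp
  qed
  ultimately show ?thesis by (rule that)
qed

section \<open>Finitely atomic measures\<close>

lemma sums_sum_real_indicator:
  fixes G :: "nat \<Rightarrow> 'a set" and c :: complex
  assumes "disjoint_family G"
  shows "(\<lambda>n. indicator (G n) x * c) sums (indicator (\<Union>n. G n) x * c)"
proof -
  have "(\<lambda>n. indicator (G n) x :: real) sums indicator (\<Union>n. G n) x"
    by (rule indicator_sums) (use assms in \<open>auto simp: disjoint_family_on_def\<close>)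
  hence "(\<lambda>n. complex_of_real (indicator (G n) x)) sums complex_of_real (indicator (\<Union>n. G n) x)"
    by (rule sums_of_real)
  hence "(\<lambda>n. complex_of_real (indicator (G n) x) * c) sums (complex_of_real (indicator (\<Union>n. G n) x) * c)"
    by (rule sums_mult2)
  thus ?thesis by (simp add: indicator_def of_bool_def if_distrib[of complex_of_real] cong: if_cong)
qed

text \<open>The moments are integrals along Jordan decompositions, so they are not computed atom by
  atom. Counting measure on the set of atoms serves as reference measure, and
  \<open>cmeasure_integral_density\<close> reduces every moment to a finite sum.\<close>

lemma atomic_measure:
  fixes l :: "nat \<Rightarrow> real" and C :: "nat \<Rightarrow> nat \<Rightarrow> complex"
  assumes l: "\<And>i. i < N \<Longrightarrow> \<alpha> \<le> l i"
  obtains \<sigma> where "\<sigma> \<in> nonneg_hermitian_measures q \<alpha>" "\<And>k. moment_exists q \<alpha> \<sigma> k"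
    "\<And>k. moment q \<alpha> \<sigma> k = mat q q (\<lambda>(a, b). \<Sum>i<N. complex_of_real (l i) ^ k * (C a i * cnj (C b i)))"
proof -
  let ?M = "half_line \<alpha>"
  define \<sigma> where "\<sigma> = (\<lambda>B\<in>sets ?M. mat q q (\<lambda>(a, b). \<Sum>i<N. indicator B (l i) * (C a i * cnj (C b i))))"
  have s: "\<sigma> B $$ (a, b) = (\<Sum>i<N. indicator B (l i) * (C a i * cnj (C b i)))" if "B \<in> sets ?M" "a < q" "b < q" for B a b
    using that by (simp add: \<sigma>_def)
  have sc: "\<sigma> B \<in> carrier_mat q q" if "B \<in> sets ?M" for B using that by (simp add: \<sigma>_def)
  have psd: "nonneg_hermitian (\<sigma> B)" if B: "B \<in> sets ?M" for B
  proof (rule nonneg_hermitian_if_form)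
    fix v :: "complex vec" assume "dim_vec v = dim_row (\<sigma> B)"
    hence v: "dim_vec v = q" using sc[OF B] by simp
    define d where "d i = (\<Sum>b<q. cnj (C b i) * v $ b)" for i
    define e :: "nat \<Rightarrow> complex" where "e i = indicator B (l i)" for i
    have "(\<sigma> B *\<^sub>v v) \<bullet>c v = (\<Sum>a<q. \<Sum>b<q. \<Sum>i<N. e i * (C a i * cnj (C b i)) * v $ b * cnj (v $ a))"
      using sc[OF B] v
      by (simp add: cscalar_prod_sum mult_mat_vec_index s[OF B, folded e_def] sum_distrib_right del: index_mult_mat_vec)
    also have "\<dots> = (\<Sum>a<q. \<Sum>i<N. \<Sum>b<q. e i * (C a i * cnj (C b i)) * v $ b * cnj (v $ a))"
      by (intro sum.cong refl sum.swap)
    also have "\<dots> = (\<Sum>i<N. \<Sum>a<q. \<Sum>b<q. e i * (C a i * cnj (C b i)) * v $ b * cnj (v $ a))"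
      by (rule sum.swap)
    also have "\<dots> = (\<Sum>i<N. e i * (cnj (d i) * d i))"
    proof -
      have "cnj (d i) * d i = (\<Sum>a<q. \<Sum>b<q. (C a i * cnj (v $ a)) * (cnj (C b i) * v $ b))" for i
        by (simp add: d_def sum_product)
      thus ?thesis by (simp add: sum_distrib_left mult_ac)
    qed
    also have "0 \<le> \<dots>"
      by (intro sum_nonneg) (auto simp: e_def indicator_def less_eq_complex_def)
    finally show "0 \<le> (\<sigma> B *\<^sub>v v) \<bullet>c v" .
  qed (use sc[OF B] in auto)
  have add: "(\<lambda>n. \<sigma> (G n) $$ (a, b)) sums (\<sigma> (\<Union>n. G n) $$ (a, b))"
    if G: "range G \<subseteq> sets ?M" "disjoint_family G" and ab: "a < q" "b < q" for G :: "nat \<Rightarrow> real set" and a b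
  proof -
    have "G n \<in> sets ?M" for n using G(1) by auto
    moreover have "(\<Union>n. G n) \<in> sets ?M" using G(1) by (rule sets.countable_UN)
    ultimately show ?thesis
      by (simp only: s ab) (intro sums_sum sums_sum_real_indicator G(2))
  qed
  have mem: "\<sigma> \<in> nonneg_hermitian_measures q \<alpha>"
    unfolding nonneg_hermitian_measures_def
  proof (intro CollectI conjI allI impI)
    show "\<sigma> \<in> sets ?M \<rightarrow>\<^sub>E {A \<in> carrier_mat q q. nonneg_hermitian A}"
      using sc psd by (auto simp: PiE_iff) (simp add: \<sigma>_def)
  qed (rule add)
  define L where "L = l ` {..<N}"
  have L: "finite L" "L \<subseteq> {\<alpha>..}" using l by (auto simp: L_def)
  define T where "T = distr (count_space L) ?M (\<lambda>x. x)"
  have T: "sets T = sets ?M" by (simp add: T_def)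
  have idm: "(\<lambda>x. x) \<in> measurable (count_space L) ?M" using L by (auto simp: space_restrict_space)
  have int: "integrable T g \<and> (\<integral>x. g x \<partial>T) = (\<Sum>x\<in>L. g x)" if "g \<in> borel_measurable ?M" for g :: "real \<Rightarrow> complex"
    unfolding T_def using that L(1)
    by (simp add: integral_distr[OF idm] integrable_distr_eq[OF idm] lebesgue_integral_count_space_finite integrable_count_space)
  \<comment> \<open>The points \<open>l i\<close> may coincide. The reference measure counts each
    location once, so the density collects all weights sitting there.\<close>
  define F where "F a b x = (\<Sum>i<N. if l i = x then C a i * cnj (C b i) else 0)" for a b x
  have Fm: "F a b \<in> borel_measurable ?M" for a b
    unfolding F_def by (rule measurable_restrict_space1) measurable
  have sumF: "(\<Sum>x\<in>L. g x * F a b x) = (\<Sum>i<N. g (l i) * (C a i * cnj (C b i)))" for g :: "real \<Rightarrow> complex" and a b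
  proof -
    have "(\<Sum>x\<in>L. g x * F a b x) = (\<Sum>x\<in>L. \<Sum>i<N. if l i = x then g x * (C a i * cnj (C b i)) else 0)"
      by (simp add: F_def sum_distrib_left if_distrib[of "\<lambda>z. _ * z"] cong: if_cong)
    also have "\<dots> = (\<Sum>i<N. \<Sum>x\<in>L. if l i = x then g x * (C a i * cnj (C b i)) else 0)" by (rule sum.swap)
    also have "\<dots> = (\<Sum>i<N. g (l i) * (C a i * cnj (C b i)))"
      using L(1) by (intro sum.cong refl) (auto simp: L_def)
    finally show ?thesis .
  qed
  have dens: "\<sigma> B $$ (a, b) = (\<integral>x. indicator B x * F a b x \<partial>T)" if "B \<in> sets ?M" "a < q" "b < q" for B a b
  proof -
    have "(\<lambda>x. indicator B x * F a b x) \<in> borel_measurable ?M" using Fm that(1) by measurable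
    from int[OF this] show ?thesis using sumF[of "indicator B" a b] s[OF that] by simp
  qed
  have pw: "integrable T (\<lambda>x. F a b x * complex_of_real (x ^ k)) \<and>
    (\<integral>x. F a b x * complex_of_real (x ^ k) \<partial>T) = (\<Sum>i<N. complex_of_real (l i) ^ k * (C a i * cnj (C b i)))" for a b k
  proof -
    have "(\<lambda>x. F a b x * complex_of_real (x ^ k)) \<in> borel_measurable ?M"
      using Fm power_measurable_half_line[of k \<alpha>] by measurable
    from int[OF this] show ?thesis using sumF[of "\<lambda>x. complex_of_real (x ^ k)" a b] by (simp add: mult.commute)
  qed
  have D: "cmeasure_integrable ?M (\<lambda>B. \<sigma> B $$ (a, b)) (\<lambda>x. x ^ k)"
    "cmeasure_integral ?M (\<lambda>B. \<sigma> B $$ (a, b)) (\<lambda>x. x ^ k) = (\<Sum>i<N. complex_of_real (l i) ^ k * (C a i * cnj (C b i)))"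
    if "a < q" "b < q" for a b k
    using cmeasure_integral_density[OF T conjunct1[OF int[OF Fm[of a b]]] power_measurable_half_line[of k] dens] that pw[of a b k]
    by auto
  have "moment_exists q \<alpha> \<sigma> k" for k
    unfolding moment_exists_def using D(1) by simp
  moreover have "moment q \<alpha> \<sigma> k = mat q q (\<lambda>(a, b). \<Sum>i<N. complex_of_real (l i) ^ k * (C a i * cnj (C b i)))" for k
    unfolding moment_def using D(2) by (intro eq_matI) auto
  ultimately show ?thesis using that[OF mem] by blast
qed

lemma exact_solution_exists:
  assumes "t \<in> stieltjes_ext_seqs q \<alpha> m"
  obtains \<sigma> where "\<sigma> \<in> nonneg_hermitian_measures q \<alpha>" "moment_exists q \<alpha> \<sigma> m"
    "\<And>j. j \<le> m \<Longrightarrow> moment q \<alpha> \<sigma> j = t j"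
proof -
  obtain t' n where t': "\<And>j. j \<le> m \<Longrightarrow> t' j = t j" "m \<le> 2 * n + 1" "mat_seq q (2 * n + 1) t'"
    "nonneg_hermitian (block_hankel q t' (Suc n))" "nonneg_hermitian (block_hankel q (shifted \<alpha> t') (Suc n))"
    "\<And>u. dim_vec u = Suc n * q \<Longrightarrow> block_hankel q t' (Suc n) *\<^sub>v u = 0\<^sub>v (Suc n * q) \<Longrightarrow>
      block_hankel q (shifted \<alpha> t') (Suc n) *\<^sub>v u = 0\<^sub>v (Suc n * q)"
    by (rule ext_seq_full_data[OF assms]) (rule that)
  obtain N :: nat and l and C where l: "\<And>i. i < N \<Longrightarrow> \<alpha> \<le> l i"
    and rep: "\<And>k a b. k \<le> 2 * n + 1 \<Longrightarrow> a < q \<Longrightarrow> b < q \<Longrightarrow>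
       t' k $$ (a, b) = (\<Sum>i<N. complex_of_real (l i) ^ k * (C a i * cnj (C b i)))"
    using atomic_representation[OF t'(3-6)] by blast
  obtain \<sigma> where sig: "\<sigma> \<in> nonneg_hermitian_measures q \<alpha>" "\<And>k. moment_exists q \<alpha> \<sigma> k"
    "\<And>k. moment q \<alpha> \<sigma> k = mat q q (\<lambda>(a, b). \<Sum>i<N. complex_of_real (l i) ^ k * (C a i * cnj (C b i)))"
    using atomic_measure[of N \<alpha> l q C, OF l] by blast
  have "moment q \<alpha> \<sigma> j = t j" if j: "j \<le> m" for j
  proof -
    have "t' j \<in> carrier_mat q q" using t'(2,3) j by (auto simp: mat_seq_def)
    hence "moment q \<alpha> \<sigma> j = t' j" unfolding sig(3) using rep[of j] j t'(2) by (intro eq_matI) auto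
    thus ?thesis using t'(1)[OF j] by simp
  qed
  thus ?thesis using that sig by blast
qed

lemma ext_seq_unique:
  assumes t: "t \<in> stieltjes_ext_seqs q \<alpha> m" and t': "t' \<in> stieltjes_ext_seqs q \<alpha> m"
    and eq: "moment_solutions q \<alpha> m t = moment_solutions q \<alpha> m t'"
  shows "t = t'"
proof -
  \<comment> \<open>The exact solution for \<open>s\<close> has last moment \<open>s m\<close>; as a
    solution for \<open>s'\<close> it gives \<open>s m \<le> s' m\<close>. Antisymmetry of the order
    then settles the last entry.\<close>
  have half: "(\<forall>j<m. s j = s' j) \<and> nonneg_hermitian (s' m - s m)"
    if s: "s \<in> stieltjes_ext_seqs q \<alpha> m" and eq: "moment_solutions q \<alpha> m s = moment_solutions q \<alpha> m s'" for s s'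
  proof -
    obtain \<sigma> where sig: "\<sigma> \<in> nonneg_hermitian_measures q \<alpha>" "moment_exists q \<alpha> \<sigma> m"
      "\<And>j. j \<le> m \<Longrightarrow> moment q \<alpha> \<sigma> j = s j" using exact_solution_exists[OF s] by blast
    have "s m \<in> carrier_mat q q" using s by (auto simp: stieltjes_ext_seqs_def)
    hence "\<sigma> \<in> moment_solutions q \<alpha> m s"
      using sig by (simp add: moment_solutions_def mat_minus_self)
    hence "\<sigma> \<in> moment_solutions q \<alpha> m s'" using eq by simp
    thus ?thesis using sig(3) by (auto simp: moment_solutions_def)
  qed
  note h = half[OF t eq] half[OF t' eq[symmetric]]
  have c: "t \<in> {..m} \<rightarrow>\<^sub>E carrier_mat q q" "t' \<in> {..m} \<rightarrow>\<^sub>E carrier_mat q q"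
    using t t' by (auto simp: stieltjes_ext_seqs_def)
  have "t m = t' m"
    by (rule nonneg_hermitian_antisym[of _ _ q]) (use h c in auto)
  hence "t j = t' j" if "j \<le> m" for j using h that by (cases "j = m") auto
  thus ?thesis by (intro PiE_ext[OF c]) auto
qed

section \<open>The extremal matrix and its solutions\<close>

text \<open>The properties of the shorted matrix, translated by
  \<open>lower_bd q \<alpha> s m\<close>. Because the last part speaks of an arbitrary X, it can be
  applied to the last moment of any solution.\<close>

lemma Gam_Qmat:
  assumes "s \<in> stieltjes_seqs q \<alpha> m" "m > 0"
  defines "G \<equiv> Gam q \<alpha> s m"
  shows "G \<in> carrier_mat q q" "nonneg_hermitian (G - lower_bd q \<alpha> s m)" "nonneg_hermitian (s m - G)"
    "\<And>v. dim_vec v = q \<Longrightarrow> Qmat q \<alpha> s (m - 1) *\<^sub>v v = 0\<^sub>v q \<Longrightarrow> (G - lower_bd q \<alpha> s m) *\<^sub>v v = 0\<^sub>v q"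
    "\<And>X. X \<in> carrier_mat q q \<Longrightarrow> nonneg_hermitian (X - lower_bd q \<alpha> s m) \<Longrightarrow> nonneg_hermitian (s m - X) \<Longrightarrow>
      (\<And>v. dim_vec v = q \<Longrightarrow> Qmat q \<alpha> s (m - 1) *\<^sub>v v = 0\<^sub>v q \<Longrightarrow> (X - lower_bd q \<alpha> s m) *\<^sub>v v = 0\<^sub>v q) \<Longrightarrow>
      nonneg_hermitian (G - X)"
proof -
  note ms = mat_seq_stieltjes[OF assms(1)]
  have ms1: "mat_seq q (m - 1) s" by (rule mat_seq_mono[OF ms]) simp
  have lb: "lower_bd q \<alpha> s m \<in> carrier_mat q q" using lower_bd_mat_seq(1)[OF ms1, of \<alpha>] assms(2) by simp
  have sm: "s m \<in> carrier_mat q q" using ms by (auto simp: mat_seq_def)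
  have nQ: "nonneg_hermitian (Qmat q \<alpha> s m)"
    using Qmat_nonneg[OF ms] assms(1) by (auto simp: stieltjes_seqs_iff)
  define S where "S = schur_short (Qmat q \<alpha> s m) (vec_space.col_space q (Qmat q \<alpha> s (m - 1)))"
  note S = schur_short_col_space[OF nQ Qmat_carrier(1)[OF ms] Qmat_carrier[OF ms1, of \<alpha>], folded S_def]
  have G: "G = lower_bd q \<alpha> s m + S" using assms(2) by (simp add: G_def Gam_def S_def)
  note [simp] = carrier_matD[OF lb] carrier_matD[OF sm] carrier_matD[OF S(1)]
  have GS: "G - lower_bd q \<alpha> s m = S" unfolding G by (intro eq_matI) auto
  have Q: "Qmat q \<alpha> s m = s m - lower_bd q \<alpha> s m" by (rule Qmat_eq(2)[OF ms])
  have sG: "s m - G = Qmat q \<alpha> s m - S" unfolding G Q by (intro eq_matI) auto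
  show "G \<in> carrier_mat q q" unfolding G by auto
  show "nonneg_hermitian (G - lower_bd q \<alpha> s m)" unfolding GS by (rule S(2))
  show "nonneg_hermitian (s m - G)" unfolding sG by (rule S(3))
  show "(G - lower_bd q \<alpha> s m) *\<^sub>v v = 0\<^sub>v q" if "dim_vec v = q" "Qmat q \<alpha> s (m - 1) *\<^sub>v v = 0\<^sub>v q" for v
    unfolding GS by (rule S(4)[OF that])
  show "nonneg_hermitian (G - X)" if X: "X \<in> carrier_mat q q" "nonneg_hermitian (X - lower_bd q \<alpha> s m)" "nonneg_hermitian (s m - X)"
    and ker: "\<And>v. dim_vec v = q \<Longrightarrow> Qmat q \<alpha> s (m - 1) *\<^sub>v v = 0\<^sub>v q \<Longrightarrow> (X - lower_bd q \<alpha> s m) *\<^sub>v v = 0\<^sub>v q" for X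
  proof -
    note [simp] = carrier_matD[OF X(1)]
    have "Qmat q \<alpha> s m - (X - lower_bd q \<alpha> s m) = s m - X" unfolding Q by (intro eq_matI) auto
    moreover have "X - lower_bd q \<alpha> s m \<in> carrier_mat q q" using lb by auto
    ultimately have "nonneg_hermitian (S - (X - lower_bd q \<alpha> s m))"
      using S(5)[OF X(2)] X(3) ker by simp
    moreover have "S - (X - lower_bd q \<alpha> s m) = G - X" unfolding G by (intro eq_matI) auto
    ultimately show ?thesis by simp
  qed
qed

lemma Qmat_cong:
  assumes "mat_seq q k s" "\<And>j. j \<le> k \<Longrightarrow> s j = t j"
  shows "Qmat q \<alpha> s k = Qmat q \<alpha> t k"
proof -
  have "mat_seq q k t" using assms by (simp add: mat_seq_def)
  moreover have "lower_bd q \<alpha> s k = lower_bd q \<alpha> t k" by (rule lower_bd_cong) (simp add: assms(2))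
  ultimately show ?thesis using Qmat_eq(2)[OF assms(1)] Qmat_eq(2)[of q k t] assms(2) by simp
qed

text \<open>The last entry enters a level only in the corner block. Head, border and range condition
  are inherited, and the Schur complement alone decides.\<close>

lemma level_mat_change_top:
  assumes s: "mat_seq q m s" and t: "mat_seq q m t" and eq: "\<And>j. j < m \<Longrightarrow> s j = t j"
    and ns: "nonneg_hermitian (level_mat q \<alpha> m s)" and nt: "nonneg_hermitian (Qmat q \<alpha> t m)"
  shows "nonneg_hermitian (level_mat q \<alpha> m t)"
proof -
  interpret S: hermitian_block "m div 2 * q" q "level_head q \<alpha> m s"
    "level_col q \<alpha> m s" "level_seq \<alpha> m s (2 * (m div 2))" "level_mat q \<alpha> m s"
    by (rule level_block[OF s])
  interpret B: hermitian_block "m div 2 * q" q "level_head q \<alpha> m t"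
    "level_col q \<alpha> m t" "level_seq \<alpha> m t (2 * (m div 2))" "level_mat q \<alpha> m t"
    by (rule level_block[OF t])
  have low: "level_seq \<alpha> m s j = level_seq \<alpha> m t j" if "j < 2 * (m div 2)" for j
  proof -
    have "odd m \<Longrightarrow> Suc j < m" "j < m" using that by presburger+
    thus ?thesis using eq by (auto simp: level_seq_def shifted_def)
  qed
  have block_hankel_eq: "level_head q \<alpha> m s = level_head q \<alpha> m t"
    by (rule block_hankel_cong) (use low in auto)
  have "m div 2 + i div q < 2 * (m div 2)" if "i < m div 2 * q" for i
    using that by (simp add: less_mult_imp_div_less mult_2)
  hence col_eq: "level_col q \<alpha> m s = level_col q \<alpha> m t"
    by (intro eq_matI) (auto simp: block_col_def low)
  show ?thesis
  proof (rule B.nonneg_M)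
    show "nonneg_hermitian (level_head q \<alpha> m t)" using S.nonneg_M_imp(1)[OF ns] block_hankel_eq by simp
    show "level_head q \<alpha> m t * B.W = level_col q \<alpha> m t"
      using S.nonneg_M_imp(2)[OF ns] unfolding S.W_def B.W_def block_hankel_eq col_eq .
    show "nonneg_hermitian B.S" using nt Qmat_B[OF t, of \<alpha>] by simp
  qed
qed

lemma Gam_solutions:
  assumes sK: "s \<in> stieltjes_seqs q \<alpha> m" and m: "m > 0"
    and st_low: "\<And>j. j < m \<Longrightarrow> st j = s j" and st_top: "st m = Gam q \<alpha> s m"
  shows "moment_solutions q \<alpha> m st = moment_solutions q \<alpha> m s"
proof (intro equalityI subsetI)
  note ms = mat_seq_stieltjes[OF sK]
  have sm: "s m \<in> carrier_mat q q" using ms by (auto simp: mat_seq_def)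
  note G = Gam_Qmat[OF sK m, folded st_top]
  fix \<sigma>
  define X where "X = moment q \<alpha> \<sigma> m"
  have X: "X \<in> carrier_mat q q" by (simp add: X_def moment_def)
  note [simp] = carrier_matD[OF sm] carrier_matD[OF G(1)] carrier_matD[OF X]
  show "\<sigma> \<in> moment_solutions q \<alpha> m s" if \<sigma>: "\<sigma> \<in> moment_solutions q \<alpha> m st"
  proof -
    have "nonneg_hermitian ((s m - st m) + (st m - X))"
      using G(3) \<sigma> by (intro nonneg_hermitian_add) (auto simp: moment_solutions_def simp flip: X_def)
    moreover have "(s m - st m) + (st m - X) = s m - X" by (intro eq_matI) auto
    ultimately show ?thesis using \<sigma> st_low by (auto simp: moment_solutions_def X_def)
  qed
  show "\<sigma> \<in> moment_solutions q \<alpha> m st" if \<sigma>: "\<sigma> \<in> moment_solutions q \<alpha> m s"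
  proof -
    have sig: "\<sigma> \<in> nonneg_hermitian_measures q \<alpha>" "moment_exists q \<alpha> \<sigma> m" "nonneg_hermitian (s m - X)"
      "\<And>j. j < m \<Longrightarrow> moment q \<alpha> \<sigma> j = s j"
      using \<sigma> by (auto simp: moment_solutions_def X_def)
    \<comment> \<open>The moments of \<open>\<sigma>\<close> form a sequence of their own. It agrees
      with \<open>s\<close> below \<open>m\<close>, so it has the same lower bound at
      \<open>m\<close> and the same \<open>Qmat\<close> at \<open>m - 1\<close>; its last entry is
      the X to be compared with \<open>Gam\<close>.\<close>
    define t where "t = (\<lambda>j\<in>{..m}. moment q \<alpha> \<sigma> j)"
    have tc: "t j \<in> carrier_mat q q" if "j \<le> m" for j using that by (simp add: t_def moment_def)
    have t_low: "t j = s j" if "j < m" for j using that sig(4) by (simp add: t_def)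
    have t_top: "t m = X" by (simp add: t_def X_def)
    obtain T F where D: "moment_density q \<alpha> T F" and mom0: "\<And>j a b. j \<le> m \<Longrightarrow> a < q \<Longrightarrow> b < q \<Longrightarrow>
      integrable T (\<lambda>x. F a b x * complex_of_real (x ^ j)) \<and>
      moment q \<alpha> \<sigma> j $$ (a, b) = (\<integral>x. F a b x * complex_of_real (x ^ j) \<partial>T)"
    proof (rule moment_density_solution[OF sig(1,2)], goal_cases)
      case (1 T F)
      show ?case by (rule 1(1)[of T F, OF 1(2)]) (rule 1(3))
    qed
    have mom: "integrable T (\<lambda>x. F a b x * complex_of_real (x ^ j)) \<and>
      t j $$ (a, b) = (\<integral>x. F a b x * complex_of_real (x ^ j) \<partial>T)" if "j \<le> m" "a < q" "b < q" for j a b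
      using mom0[OF that] that(1) by (simp add: t_def)
    interpret moment_density q \<alpha> T F by (rule D)
    have nn: "nonneg_hermitian (level_mat q \<alpha> k t)" if "k \<le> m" for k
      by (rule level_mat_moments_nonneg[OF tc mom that])
    have "t \<in> stieltjes_seqs q \<alpha> m"
      unfolding stieltjes_seqs_iff using nn tc by (auto simp: PiE_iff) (simp add: t_def)
    hence mt: "mat_seq q m t" by (rule mat_seq_stieltjes)
    have lb: "lower_bd q \<alpha> t m = lower_bd q \<alpha> s m" by (rule lower_bd_cong) (simp add: t_low)
    have Qm: "Qmat q \<alpha> t m = X - lower_bd q \<alpha> s m" using Qmat_eq(2)[OF mt] by (simp add: lb t_top)
    have Qm1: "Qmat q \<alpha> t (m - 1) = Qmat q \<alpha> s (m - 1)"
      by (rule Qmat_cong[OF mat_seq_mono[OF mt]]) (use m t_low in auto)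
    have "nonneg_hermitian (st m - X)"
    proof (rule G(5)[OF X _ sig(3)])
      show "nonneg_hermitian (X - lower_bd q \<alpha> s m)" using Qmat_nonneg[OF mt nn] Qm by simp
      fix v :: "complex vec" assume "dim_vec v = q" "Qmat q \<alpha> s (m - 1) *\<^sub>v v = 0\<^sub>v q"
      thus "(X - lower_bd q \<alpha> s m) *\<^sub>v v = 0\<^sub>v q"
        using Qmat_moments_kernel[OF tc mom m mt, of v] Qm Qm1 by simp
    qed
    thus ?thesis using sig st_low by (auto simp: moment_solutions_def X_def)
  qed
qed

theorem theorem7p6:
  fixes q m :: nat and \<alpha> :: real and s :: "nat \<Rightarrow> complex mat"
  assumes "q > 0"
    and "s \<in> stieltjes_seqs q \<alpha> m"
  shows "moment_class q \<alpha> m s \<inter> stieltjes_ext_seqs q \<alpha> m =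
    {\<lambda>j\<in>{..m}. if j < m then s j else Gam q \<alpha> s m}"
proof -
  define st where "st = (\<lambda>j\<in>{..m}. if j < m then s j else Gam q \<alpha> s m)"
  note sK = assms(2)
  note ms = mat_seq_stieltjes[OF sK]
  have sc: "s \<in> {..m} \<rightarrow>\<^sub>E carrier_mat q q" using sK by (simp add: stieltjes_seqs_iff)
  have st_low: "st j = s j" if "j < m" for j using that by (simp add: st_def)
  have st_top: "st m = Gam q \<alpha> s m" by (simp add: st_def)
  have "st \<in> moment_class q \<alpha> m s \<and> st \<in> stieltjes_ext_seqs q \<alpha> m"
  proof (cases "m = 0")
    case True
    have "st = s" by (rule ext) (use sc True in \<open>auto simp: st_def Gam_def PiE_iff extensional_def\<close>)
    moreover have "s \<in> stieltjes_ext_seqs q \<alpha> m" by (rule extendable_if_kernel[OF sK]) (use True in auto)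
    ultimately show ?thesis using sK by (simp add: moment_class_def moment_equiv_def)
  next
    case False
    hence m: "m > 0" by simp
    note G = Gam_Qmat[OF sK m, folded st_top]
    have lb: "lower_bd q \<alpha> st m = lower_bd q \<alpha> s m" by (rule lower_bd_cong) (simp add: st_low)
    have sm: "s j \<in> carrier_mat q q" "mat_adjoint (s j) = s j" if "j \<le> m" for j
      using ms that by (auto simp: mat_seq_def)
    \<comment> \<open>\<open>st m\<close> is Hermitian as a difference of the Hermitian matrices
      \<open>s m\<close> and \<open>s m - st m\<close>; the latter is even non-negative.\<close>
    have "mat_adjoint (s m - (s m - st m)) = s m - (s m - st m)"
      using nonneg_hermitianD(2)[OF G(3)] carrier_matD[OF G(1)] carrier_matD[OF sm(1)[of m]] sm(2)[of m]
      by (subst mat_adjoint_minus) auto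
    moreover have "s m - (s m - st m) = st m"
      using carrier_matD[OF G(1)] carrier_matD[OF sm(1)[of m]] by (intro eq_matI) auto
    ultimately have "mat_adjoint (st m) = st m" by simp
    hence mst: "mat_seq q m st"
      using sm G(1) st_low unfolding mat_seq_def by (metis le_neq_implies_less)
    have Qm: "Qmat q \<alpha> st m = st m - lower_bd q \<alpha> s m" using Qmat_eq(2)[OF mst] by (simp add: lb)
    have Qm1: "Qmat q \<alpha> st (m - 1) = Qmat q \<alpha> s (m - 1)"
      by (rule Qmat_cong[OF mat_seq_mono[OF mst]]) (use m st_low in auto)
    have "nonneg_hermitian (level_mat q \<alpha> m s)" "nonneg_hermitian (level_mat q \<alpha> (m - 1) s)"
      using sK m by (auto simp: stieltjes_seqs_iff)
    moreover have "level_mat q \<alpha> (m - 1) st = level_mat q \<alpha> (m - 1) s"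
      by (rule level_mat_cong) (use m st_low in auto)
    ultimately have nn: "nonneg_hermitian (level_mat q \<alpha> m st)" "nonneg_hermitian (level_mat q \<alpha> (m - 1) st)"
      using level_mat_change_top[OF ms mst] st_low Qm G(2) by auto
    have "st \<in> {..m} \<rightarrow>\<^sub>E carrier_mat q q"
      using mst by (auto simp: PiE_iff mat_seq_def) (simp add: st_def)
    hence stK: "st \<in> stieltjes_seqs q \<alpha> m" using nn by (simp add: stieltjes_seqs_iff)
    have "st \<in> stieltjes_ext_seqs q \<alpha> m"
      by (rule extendable_if_kernel[OF stK]) (use G(4) Qm Qm1 in auto)
    thus ?thesis using stK Gam_solutions[OF sK m st_low st_top]
      by (simp add: moment_class_def moment_equiv_def)
  qed
  moreover have "t = st" if "t \<in> moment_class q \<alpha> m s" "t \<in> stieltjes_ext_seqs q \<alpha> m" for t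
    using calculation that by (intro ext_seq_unique[of t q \<alpha> m st]) (auto simp: moment_class_def moment_equiv_def)
  ultimately show ?thesis unfolding st_def[symmetric] by blast
qed

end
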